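(* Let $V^{[1]},\dots,V^{[P]}\in\mathbb C^2$ with $|V^{[\lambda]}|=1$, let $X=V^{[1]}\otimes\cdots\otimes V^{[P]}$, and let $S(X)=(S^{[1]}(X),\dots,S^{[P]}(X))\in(S_2)^P$ with $S^{[\lambda]}(X)=(\langle\sigma_1V^{[\lambda]},V^{[\lambda]}\rangle,\langle\sigma_2V^{[\lambda]},V^{[\lambda]}\rangle,\langle\sigma_3V^{[\lambda]},V^{[\lambda]}\rangle)$. Then for every $M\in\mathbb R^P$, $$\langle A_MX,X\rangle=-\frac12\int_{\mathbb R^3}\big|\mathbf B^{\rm class}(x,S(X))\big|^2dx-A_{11}(0)\sum_{\lambda=1}^P(M^{[\lambda]})^2,$$ where $A_{11}(0)=(2\pi)^{-3}\int_{\mathbb R^3}|\phi(|k|)|^2\frac{|k|^2-k_1^2}{|k|^2}dk$.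
   Context: Fix an integer $P\ge1$ and points $x^{[1]},\dots,x^{[P]}\in\mathbb R^3$. Let $\phi\in\mathcal S(\mathbb R)$ and for $k\in\mathbb R^3$ write $\phi(|k|)$. Let $\mathfrak H=\{V\in L^2(\mathbb R^3,\mathbb C^3):\ k\cdot V(k)=0\text{ a.e.}\}$, $\mathcal H_{\rm ph}$ the symmetric Fock space over $\mathfrak H$ with vacuum $\Psi_0$, Segal fields $\Phi_S(V)=\frac1{\sqrt2}(a^*(V)+a(V))$, $H_{\rm ph}=d\Gamma(M_\omega)$ with $M_\omega$ multiplication by $|k|$. Let $\mathcal H_{\rm sp}=(\mathbb C^2)^{\otimes P}$, $\sigma_1,\sigma_2,\sigma_3$ the Pauli matrices, $\sigma_m^{[\lambda]}$ acting as $\sigma_m$ on the $\lambda$-th factor and identity elsewhere. $B_{m,x}(k)=\frac{i\phi(|k|)|k|^{1/2}}{(2\pi)^{3/2}}e^{-ik\cdot x}\frac{k\times e_m}{|k|}$ ($e_m$ canonical basis of $\mathbb R^3$). For $M\in\mathbb R^P$, $H_{\rm int}(M)=\sum_{\lambda=1}^P\sum_{m=1}^3M^{[\lambda]}\Phi_S(B_{m,x^{[\lambda]}})\otimes\sigma_m^{[\lambda]}$, $EX=\Psi_0\otimes X$, and $A_MX=-E^*H_{\rm int}(M)(H_{\rm ph}^{-1}\otimes I)H_{\rm int}(M)EX$ (with $H_{\rm ph}^{-1}$ acting as multiplication by $1/|k|$ on the one-photon sector, where $H_{\rm int}(M)EX$ lies). $S_2$ is the unit sphere of $\mathbb R^3$.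 Let $\rho(x)=(2\pi)^{-3}\int_{\mathbb R^3}\phi(|k|)e^{ik\cdot x}dk$. For $S=(S^{[1]},\dots,S^{[P]})\in(S_2)^P$ let $\mathbf j^{\rm class}(x,S)=\sum_{\lambda=1}^PM^{[\lambda]}\nabla\rho(x-x^{[\lambda]})\times S^{[\lambda]}\in\mathbb R^3$ and let $\mathbf B^{\rm class}(\cdot,S)$ be the square-integrable vector field on $\mathbb R^3$ with $\nabla\cdot\mathbf B^{\rm class}=0$, $\nabla\times\mathbf B^{\rm class}=\mathbf j^{\rm class}(\cdot,S)$. *)

theory Defs
  imports "HOL-Analysis.Analysis"
begin

definition schwartz :: "(real \<Rightarrow> real) \<Rightarrow> bool" where
  "schwartz f \<longleftrightarrow> (\<forall>n t. ((deriv ^^ n) f) differentiable (at t)) \<and>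
     (\<forall>n p. \<exists>C. \<forall>t. \<bar>t\<bar> ^ p * \<bar>(deriv ^^ n) f t\<bar> \<le> C)"

(* C^2 is represented as bool => complex; False = first, True = second component *)
definition pmat :: "3 \<Rightarrow> bool \<Rightarrow> bool \<Rightarrow> complex" where
  "pmat m a b =
    (if m = 1 then (if a \<noteq> b then 1 else 0)
     else if m = 2 then (if \<not> a \<and> b then - \<i> else if a \<and> \<not> b then \<i> else 0)
     else (if a = b then (if a then -1 else 1) else 0))"

definition pauli :: "3 \<Rightarrow> (bool \<Rightarrow> complex) \<Rightarrow> (bool \<Rightarrow> complex)" where
  "pauli m v a = (\<Sum>b\<in>UNIV. pmat m a b * v b)"

definition inner2 :: "(bool \<Rightarrow> complex) \<Rightarrow> (bool \<Rightarrow> complex) \<Rightarrow> complex" where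
  "inner2 u v = (\<Sum>a\<in>UNIV. u a * cnj (v a))"

(* (C^2)^{\<otimes>P}: functions on bool lists of length P (basis index) *)
definition spin_idx :: "nat \<Rightarrow> bool list set" where
  "spin_idx P = {s. length s = P}"

definition spin_inner :: "nat \<Rightarrow> (bool list \<Rightarrow> complex) \<Rightarrow> (bool list \<Rightarrow> complex) \<Rightarrow> complex" where
  "spin_inner P Y X = (\<Sum>s\<in>spin_idx P. Y s * cnj (X s))"

definition tensor :: "nat \<Rightarrow> (nat \<Rightarrow> bool \<Rightarrow> complex) \<Rightarrow> bool list \<Rightarrow> complex" where
  "tensor P V s = (\<Prod>l<P. V l (s ! l))"

definition pauli_at :: "3 \<Rightarrow> nat \<Rightarrow> (bool list \<Rightarrow> complex) \<Rightarrow> bool list \<Rightarrow> complex" where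
  "pauli_at m l X s = (\<Sum>b\<in>UNIV. pmat m (s ! l) b * X (s[l := b]))"

definition Bfield :: "(real \<Rightarrow> real) \<Rightarrow> 3 \<Rightarrow> real^3 \<Rightarrow> real^3 \<Rightarrow> complex^3" where
  "Bfield \<phi> m x k = (\<chi> j. \<i> * of_real (\<phi> (norm k) * sqrt (norm k) / (2 * pi) powr (3/2))
      * exp (- \<i> * of_real (k \<bullet> x)) * of_real ((cross3 k (axis m 1)) $ j / norm k))"

(* H_int(M) E X, an element of the one-photon sector tensor spin space,
   represented as (k, polarisation component j, spin index s) \<mapsto> value.
   Uses Phi_S(B) Psi_0 = (1/sqrt 2) B. *)
definition HintE :: "(real \<Rightarrow> real) \<Rightarrow> nat \<Rightarrow> (nat \<Rightarrow> real^3) \<Rightarrow> (nat \<Rightarrow> real)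
    \<Rightarrow> (bool list \<Rightarrow> complex) \<Rightarrow> real^3 \<Rightarrow> 3 \<Rightarrow> bool list \<Rightarrow> complex" where
  "HintE \<phi> P xs M X k j s = (1 / sqrt 2) *
     (\<Sum>l<P. \<Sum>m\<in>UNIV. of_real (M l) * Bfield \<phi> m (xs l) k $ j * pauli_at m l X s)"

(* A_M X = - E^* H_int(M) (H_ph^{-1} \<otimes> I) H_int(M) E X.
   On a one-photon vector G, E^* (Phi_S(B) \<otimes> sigma) G = (1/sqrt 2) <B, G>_{L^2} (sigma applied),
   i.e. the vacuum component, with a(B) antilinear in B. *)
definition A_op :: "(real \<Rightarrow> real) \<Rightarrow> nat \<Rightarrow> (nat \<Rightarrow> real^3) \<Rightarrow> (nat \<Rightarrow> real)
    \<Rightarrow> (bool list \<Rightarrow> complex) \<Rightarrow> bool list \<Rightarrow> complex" where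
  "A_op \<phi> P xs M X s = - (\<Sum>l<P. \<Sum>m\<in>UNIV. of_real (M l) * (1 / sqrt 2) *
     integral\<^sup>L lborel (\<lambda>k. \<Sum>j\<in>UNIV. cnj (Bfield \<phi> m (xs l) k $ j) * of_real (1 / norm k) *
        pauli_at m l (HintE \<phi> P xs M X k j) s))"

definition spinvec :: "(bool \<Rightarrow> complex) \<Rightarrow> real^3" where
  "spinvec v = (\<chi> m. Re (inner2 (pauli m v) v))"

definition rho :: "(real \<Rightarrow> real) \<Rightarrow> real^3 \<Rightarrow> real" where
  "rho \<phi> x = Re ((2 * pi) powr (-3) *
      integral\<^sup>L lborel (\<lambda>k::real^3. of_real (\<phi> (norm k)) * exp (\<i> * of_real (k \<bullet> x))))"

definition pd :: "(real^3 \<Rightarrow> real) \<Rightarrow> 3 \<Rightarrow> real^3 \<Rightarrow> real" where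
  "pd f i x = deriv (\<lambda>t. f (x + t *\<^sub>R axis i 1)) 0"

definition grad :: "(real^3 \<Rightarrow> real) \<Rightarrow> real^3 \<Rightarrow> real^3" where
  "grad f x = (\<chi> i. pd f i x)"

definition divg :: "(real^3 \<Rightarrow> real^3) \<Rightarrow> real^3 \<Rightarrow> real" where
  "divg F x = (\<Sum>i\<in>UNIV. pd (\<lambda>y. F y $ i) i x)"

definition curl :: "(real^3 \<Rightarrow> real^3) \<Rightarrow> real^3 \<Rightarrow> real^3" where
  "curl F x = vector
     [pd (\<lambda>y. F y $ 3) 2 x - pd (\<lambda>y. F y $ 2) 3 x,
      pd (\<lambda>y. F y $ 1) 3 x - pd (\<lambda>y. F y $ 3) 1 x,
      pd (\<lambda>y. F y $ 2) 1 x - pd (\<lambda>y. F y $ 1) 2 x]"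

definition jclass :: "(real \<Rightarrow> real) \<Rightarrow> nat \<Rightarrow> (nat \<Rightarrow> real^3) \<Rightarrow> (nat \<Rightarrow> real)
    \<Rightarrow> (nat \<Rightarrow> real^3) \<Rightarrow> real^3 \<Rightarrow> real^3" where
  "jclass \<phi> P xs M S x = (\<Sum>l<P. M l *\<^sub>R cross3 (grad (rho \<phi>) (x - xs l)) (S l))"

definition A11 :: "(real \<Rightarrow> real) \<Rightarrow> real" where
  "A11 \<phi> = (2 * pi) powr (-3) *
     integral\<^sup>L lborel (\<lambda>k::real^3. \<bar>\<phi> (norm k)\<bar>^2 * ((norm k)^2 - (k $ 1)^2) / (norm k)^2)"

end

theory Submission
  imports Defs "HOL-Probability.Characteristic_Functions"
begin

text \<open>
  In Fourier space the classical field has to be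
  \<open>\<phi>(|k|) \<Sum>l. M l * exp (- i k \<bullet> x l) * (S l - (k \<bullet> S l) k / |k|^2)\<close>. Differentiation under the
  integral sign shows that this field solves the equations, and Plancherel gives its energy as a
  double sum over the spins. The operator side is the same double sum with the products
  \<open>S l $ m * S l' $ m'\<close> replaced by expectations of products of two Pauli matrices. These agree
  for \<open>l \<noteq> l'\<close>; for \<open>l = l'\<close> the kernel is \<open>A11\<close> times the identity, and \<open>\<sigma>\<^sub>m\<^sup>2 = 1\<close> gives the factor 3
  instead of \<open>|S l|^2 = 1\<close>. This accounts for the term with \<open>A11\<close>.

  The given field is only assumed differentiable and square integrable, so its uniqueness needs a
  divergence theorem without continuity of the derivatives. Goursat's bisection argument provides
  it. Applied to the difference \<open>D\<close> of two solutions, multiplied by derivatives of the regularised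
  Newton potential \<open>(1 + |x|^2)^(-1/2)\<close>, it shows that the averages of \<open>D\<close> against
  \<open>(1 + |x|^2)^(-5/2)\<close> vanish at every centre and every scale.
\<close>

section \<open>Fourier integrals\<close>

text \<open>Two obstacles shape the proof. The transverse projection has no limit at
  \<open>k = 0\<close>, so the transform of the field is in general discontinuous there; Plancherel
  is therefore proved, by Gaussian regularisation, for bounded integrable functions that are
  continuous almost everywhere. Secondly, \<open>Bc\<close> is not known to be a Fourier integral,
  its derivatives may be discontinuous, and its only decay is square integrability. Transforming its
  equations or applying a Liouville theorem to harmonic components is thus not directly available.
  Instead the test fields are arranged so that no derivative of \<open>D\<close> survives in their
  divergence, and boundary terms disappear by averaging the flux through a unit cube over all
  positions of the cube. Rescaling \<open>D\<close> around a point by \<open>e\<close> costs a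
  factor \<open>e^(-3)\<close> in the square integral; a Young inequality weighted by a power of
  \<open>e\<close> absorbs it.

  The factor 1/2 of the formula is the product of the two factors 1/sqrt 2 of the Segal fields. It
  also turns the excess 3 - 1 = 2 produced by the squares of the Pauli matrices into the coefficient
  1 of \<open>A11\<close>.\<close>

lemma lborel_integrable_affine:
  fixes f :: "'a::euclidean_space \<Rightarrow> 'b::{banach, second_countable_topology}"
  assumes "integrable lborel f" "c \<noteq> 0"
  shows "integrable lborel (\<lambda>x. f (t + c *\<^sub>R x))"
proof -
  have [measurable]: "f \<in> borel_measurable borel" using assms by auto
  have "integrable (density (distr lborel borel (\<lambda>x. t + c *\<^sub>R x)) (\<lambda>_. \<bar>c\<bar>^DIM('a))) f"
    using assms lborel_affine[of c t] by simp
  then have "integrable lborel (\<lambda>x. \<bar>c\<bar>^DIM('a) *\<^sub>R f (t + c *\<^sub>R x))"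
    by (subst (asm) integrable_density) (auto simp: integrable_distr_eq)
  from integrable_scaleR_right[OF this, of "1 / \<bar>c\<bar>^DIM('a)"] show ?thesis
    using assms by simp
qed

text \<open>If \<open>f\<close> is not integrable, neither is its affine transform, as the inverse
  map shows; both Bochner integrals then take the default value 0, so the formula is
  unconditional.\<close>

lemma lborel_integral_affine:
  fixes f :: "'a::euclidean_space \<Rightarrow> 'b::{banach, second_countable_topology}"
  assumes c: "c \<noteq> 0"
  shows "(\<integral>x. f x \<partial>lborel) = \<bar>c\<bar>^DIM('a) *\<^sub>R (\<integral>x. f (t + c *\<^sub>R x) \<partial>lborel)"
proof (cases "integrable lborel f")
  case True
  then have [measurable]: "f \<in> borel_measurable borel" by auto
  show ?thesis using c
    by (subst lborel_affine[OF c, of t]) (simp add: integral_density integral_distr)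
next
  case False
  have "\<not> integrable lborel (\<lambda>x. f (t + c *\<^sub>R x))"
  proof
    assume "integrable lborel (\<lambda>x. f (t + c *\<^sub>R x))"
    from lborel_integrable_affine[OF this, of "1/c" "- (1/c) *\<^sub>R t"] c
    have "integrable lborel f" by (simp add: scaleR_diff_right scaleR_add_right)
    with False show False by simp
  qed
  with False show ?thesis by (simp add: not_integrable_integral_eq)
qed

section \<open>Gaussian integrals, coordinate by coordinate\<close>

lemma integrable_lborel_prod_Basis:
  fixes f :: "'a::euclidean_space \<Rightarrow> real \<Rightarrow> 'b::{real_normed_field,banach,second_countable_topology}"
  assumes f: "\<And>b. b \<in> Basis \<Longrightarrow> integrable lborel (f b)"
  shows "integrable lborel (\<lambda>x. \<Prod>b\<in>Basis. f b (x \<bullet> b))"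
proof -
  interpret product_sigma_finite "\<lambda>_::'a. lborel :: real measure" ..
  have [measurable]: "f b \<in> borel_measurable borel" if "b \<in> Basis" for b
    using f[OF that] by auto
  have "integrable (\<Pi>\<^sub>M b\<in>Basis. lborel) (\<lambda>x. \<Prod>b\<in>Basis. f b (x b))"
    using f by (intro product_integrable_prod) auto
  then show ?thesis
    by (subst lborel_eq, subst integrable_distr_eq) (auto cong: prod.cong)
qed

lemma integral_lborel_prod_Basis:
  fixes f :: "'a::euclidean_space \<Rightarrow> real \<Rightarrow> 'b::{real_normed_field,banach,second_countable_topology}"
  assumes f: "\<And>b. b \<in> Basis \<Longrightarrow> integrable lborel (f b)"
  shows "(\<integral>x. (\<Prod>b\<in>Basis. f b (x \<bullet> b)) \<partial>lborel) = (\<Prod>b\<in>Basis. \<integral>x. f b x \<partial>lborel)"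
proof -
  interpret product_sigma_finite "\<lambda>_::'a. lborel :: real measure" ..
  have [measurable]: "f b \<in> borel_measurable borel" if "b \<in> Basis" for b
    using f[OF that] by auto
  show ?thesis
    by (subst lborel_eq, subst integral_distr)
      (auto simp: product_integral_prod[OF _ f] cong: prod.cong)
qed

text \<open>This is the characteristic function of the standard normal distribution with the
  density's factor \<open>1 / sqrt (2 * pi)\<close> moved to the other side.\<close>

lemma gaussian_1d:
  shows "integrable lborel (\<lambda>x::real. of_real (exp (- x\<^sup>2 / 2)) * iexp (a * x))" (is ?I)
    and "(\<integral>x. of_real (exp (- x\<^sup>2 / 2)) * iexp (a * x) \<partial>lborel)
      = complex_of_real (sqrt (2 * pi) * exp (- a\<^sup>2 / 2))" (is ?E)
proof -
  have "integrable lborel (\<lambda>x::real. std_normal_density x *\<^sub>R iexp (a * x))"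
    using integrable_std_normal_moment[of 0]
    by (rule Bochner_Integration.integrable_bound) (auto intro!: AE_I2 simp: normal_density_nonneg)
  then have "integrable lborel (\<lambda>x::real. sqrt (2 * pi) *\<^sub>R (std_normal_density x *\<^sub>R iexp (a * x)))"
    by (rule integrable_scaleR_right)
  then show ?I
    by (simp add: std_normal_density_def scaleR_conv_of_real)
  have "(\<integral>x. std_normal_density x *\<^sub>R iexp (a * x) \<partial>lborel) = complex_of_real (exp (- a\<^sup>2 / 2))"
    using char_std_normal_distribution unfolding char_def fun_eq_iff
    by (subst (asm) integral_density) (auto simp: normal_density_nonneg)
  then have "sqrt (2 * pi) *\<^sub>R (\<integral>x. std_normal_density x *\<^sub>R iexp (a * x) \<partial>lborel)
      = complex_of_real (sqrt (2 * pi) * exp (- a\<^sup>2 / 2))"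
    by (simp add: scaleR_conv_of_real)
  then have "(\<integral>x. sqrt (2 * pi) *\<^sub>R (std_normal_density x *\<^sub>R iexp (a * x)) \<partial>lborel)
      = complex_of_real (sqrt (2 * pi) * exp (- a\<^sup>2 / 2))"
    by (simp only: integral_scaleR_right)
  then show ?E
    by (simp add: std_normal_density_def scaleR_conv_of_real)
qed

definition gaussian :: "'a::euclidean_space \<Rightarrow> real" where
  "gaussian x = exp (- (norm x)\<^sup>2 / 2)"

lemma gaussian_props:
  "0 < gaussian x" "gaussian x \<le> 1" "gaussian (0::'a::euclidean_space) = 1"
  "(gaussian :: 'a \<Rightarrow> real) \<in> borel_measurable borel"
  by (auto simp: gaussian_def[abs_def])

text \<open>Both the Gaussian and the exponential factor over the coordinates, so Fubini reduces the
  claim to dimension one.\<close>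

lemma gaussian_fourier:
  fixes a :: "'a::euclidean_space"
  shows "integrable lborel (\<lambda>x. of_real (gaussian x) * iexp (a \<bullet> x))" (is ?I)
    and "(\<integral>x. of_real (gaussian x) * iexp (a \<bullet> x) \<partial>lborel)
      = complex_of_real (sqrt (2 * pi) ^ DIM('a) * gaussian a)" (is ?E)
proof -
  have g: "complex_of_real (gaussian x) = (\<Prod>b\<in>Basis. of_real (exp (- (x \<bullet> b)\<^sup>2 / 2)))" for x :: 'a
    unfolding gaussian_def power2_norm_eq_inner
    by (subst euclidean_inner)
      (simp add: exp_sum[symmetric] sum_divide_distrib sum_negf power2_eq_square flip: of_real_prod)
  have e: "iexp (a \<bullet> x) = (\<Prod>b\<in>Basis. iexp ((a \<bullet> b) * (x \<bullet> b)))" for x :: 'a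
    by (subst euclidean_inner) (simp add: exp_sum[symmetric] sum_distrib_left)
  note eq = g e prod.distrib[symmetric]
  show ?I unfolding eq
    by (intro integrable_lborel_prod_Basis gaussian_1d)
  have rhs: "complex_of_real (sqrt (2 * pi) ^ DIM('a) * gaussian a)
      = (\<Prod>b\<in>Basis. of_real (sqrt (2 * pi) * exp (- (a \<bullet> b)\<^sup>2 / 2)))"
    by (simp add: prod.distrib g)
  show ?E unfolding eq rhs
    by (subst integral_lborel_prod_Basis) (simp_all only: gaussian_1d)
qed

lemma gaussian_integral:
  shows "integrable lborel (gaussian :: 'a::euclidean_space \<Rightarrow> real)"
    and "(\<integral>x. gaussian (x::'a) \<partial>lborel) = sqrt (2 * pi) ^ DIM('a)"
proof -
  have "integrable lborel (\<lambda>x::'a. Re (of_real (gaussian x) * iexp (0 \<bullet> x)))"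
    by (intro integrable_Re gaussian_fourier)
  then show "integrable lborel (gaussian :: 'a \<Rightarrow> real)" by simp
  have "Re (\<integral>x. of_real (gaussian (x::'a)) * iexp (0 \<bullet> x) \<partial>lborel) = sqrt (2 * pi) ^ DIM('a)"
    unfolding gaussian_fourier by (simp add: gaussian_props)
  then show "(\<integral>x. gaussian (x::'a) \<partial>lborel) = sqrt (2 * pi) ^ DIM('a)"
    by simp
qed

lemma gaussian_fourier_scaled:
  fixes a :: "'a::euclidean_space"
  assumes "e > 0"
  shows "(\<integral>x. of_real (gaussian (e *\<^sub>R x)) * iexp (a \<bullet> x) \<partial>lborel)
      = complex_of_real ((sqrt (2 * pi) / e) ^ DIM('a) * gaussian ((1/e) *\<^sub>R a))"
proof -
  have "complex_of_real (sqrt (2 * pi) ^ DIM('a) * gaussian ((1/e) *\<^sub>R a))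
      = (\<integral>x. of_real (gaussian x) * iexp ((1/e) *\<^sub>R a \<bullet> x) \<partial>lborel)"
    by (simp only: gaussian_fourier)
  also have "\<dots> = e ^ DIM('a) *\<^sub>R (\<integral>x. of_real (gaussian (e *\<^sub>R x)) * iexp (a \<bullet> x) \<partial>lborel)"
    using assms by (subst lborel_integral_affine[of e _ 0]) (auto simp: )
  finally show ?thesis
    using assms by (simp add: scaleR_conv_of_real power_divide field_simps)
qed

section \<open>Fourier transform of integrable functions and Plancherel's theorem\<close>

definition fourier :: "('a::euclidean_space \<Rightarrow> complex) \<Rightarrow> 'a \<Rightarrow> complex" where
  "fourier F x = (\<integral>k. F k * iexp (k \<bullet> x) \<partial>lborel)"

lemma fourier_integrable:
  assumes "integrable lborel F"
  shows "integrable lborel (\<lambda>k::'a::euclidean_space. F k * iexp (k \<bullet> x))"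
proof (rule Bochner_Integration.integrable_bound[OF assms])
  have [measurable]: "F \<in> borel_measurable borel" using assms by auto
  show "(\<lambda>k. F k * iexp (k \<bullet> x)) \<in> borel_measurable lborel" by measurable
qed (simp add: norm_mult)

lemma fourier_bound:
  "norm (fourier F x) \<le> (\<integral>k. norm (F k) \<partial>lborel)"
  unfolding fourier_def
  by (rule order_trans[OF integral_norm_bound]) (simp add: norm_mult)

lemma isCont_fourier:
  fixes F :: "'a::euclidean_space \<Rightarrow> complex"
  assumes "integrable lborel F"
  shows "isCont (fourier F) x"
  unfolding continuous_at_sequentially
proof (intro allI impI)
  fix X assume X: "X \<longlonglongrightarrow> x"
  have [measurable]: "F \<in> borel_measurable borel" using assms by auto
  show "(fourier F \<circ> X) \<longlonglongrightarrow> fourier F x"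
    unfolding fourier_def comp_def
  proof (rule integral_dominated_convergence[where w="\<lambda>k. norm (F k)"])
    show "AE k in lborel. (\<lambda>n. F k * iexp (k \<bullet> X n)) \<longlonglongrightarrow> F k * iexp (k \<bullet> x)"
      by (intro AE_I2 tendsto_intros X)
  qed (use assms in \<open>auto simp: norm_mult\<close>)
qed

lemma fourier_measurable:
  fixes F :: "'a::euclidean_space \<Rightarrow> complex"
  assumes "integrable lborel F"
  shows "fourier F \<in> borel_measurable borel"
  by (rule borel_measurable_continuous_onI) (auto intro!: continuous_at_imp_continuous_on isCont_fourier assms)

lemma integrable_pair_lborel_bound:
  fixes f :: "'a::euclidean_space \<times> 'b::euclidean_space \<Rightarrow> 'c::{banach, second_countable_topology}"
    and g :: "'a \<Rightarrow> real" and h :: "'b \<Rightarrow> real"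
  assumes f: "f \<in> borel_measurable (lborel \<Otimes>\<^sub>M lborel)"
    and g: "integrable lborel g" and h: "integrable lborel h"
    and bd: "\<And>x y. norm (f (x, y)) \<le> g x * h y"
  shows "integrable (lborel \<Otimes>\<^sub>M lborel) f"
proof (rule Bochner_Integration.integrable_bound[where f="\<lambda>z. g (fst z) * h (snd z)"])
  have [measurable]: "g \<in> borel_measurable borel" "h \<in> borel_measurable borel"
    using g h by auto
  show "integrable (lborel \<Otimes>\<^sub>M lborel) (\<lambda>z. g (fst z) * h (snd z))"
    by (rule lborel_pair.Fubini_integrable) (use g h in \<open>simp_all add: abs_mult\<close>)
  show "AE z in lborel \<Otimes>\<^sub>M lborel. norm (f z) \<le> norm (g (fst z) * h (snd z))"
    using bd by (intro AE_I2) (metis abs_ge_self order_trans prod.collapse real_norm_def)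
qed (fact f)

text \<open>The Gaussian weight makes the double integrals absolutely convergent, so Fubini applies
  twice. The transform of the weight is again a Gaussian, of width \<open>e\<close>, and acts on
  \<open>F\<close> as an averaging kernel concentrated near \<open>k\<close>.\<close>

lemma plancherel_regularized:
  fixes F :: "'a::euclidean_space \<Rightarrow> complex"
  assumes F: "integrable lborel F" and e: "e > 0"
  shows "(\<integral>x. gaussian (e *\<^sub>R x) *\<^sub>R (fourier F x * cnj (fourier F x)) \<partial>lborel)
    = of_real (sqrt (2 * pi) ^ DIM('a)) *
      (\<integral>k. cnj (F k) * (\<integral>z. of_real (gaussian z) * F (k + e *\<^sub>R z) \<partial>lborel) \<partial>lborel)"
proof -
  have Fm[measurable]: "F \<in> borel_measurable borel" using F by auto
  have [measurable]: "(\<lambda>k. cnj (F k)) \<in> borel_measurable borel"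
    using borel_measurable_continuous_onI[OF continuous_on_cnj[OF continuous_on_id]] by measurable
  note fm[measurable] = fourier_measurable[OF F]
  note gm[measurable] = gaussian_props(4)
  let ?g = "\<lambda>x::'a. gaussian (e *\<^sub>R x)"
  have gi: "integrable lborel ?g"
    using lborel_integrable_affine[OF gaussian_integral(1), of e 0] e by simp
  have gF: "integrable lborel (\<lambda>x. of_real (?g x) * fourier F x)"
  proof (rule Bochner_Integration.integrable_bound)
    show "integrable lborel (\<lambda>x. ?g x * (\<integral>k. norm (F k) \<partial>lborel))"
      using gi by simp
    show "AE x in lborel. norm (of_real (?g x) * fourier F x) \<le> norm (?g x * (\<integral>k. norm (F k) \<partial>lborel))"
      by (intro AE_I2) (auto simp: norm_mult abs_mult fourier_bound intro!: mult_left_mono order_trans[OF fourier_bound abs_ge_self])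
  qed measurable
  have 1: "(\<integral>k. of_real (?g x) * fourier F x * (cnj (F k) * iexp (- (k \<bullet> x))) \<partial>lborel)
      = ?g x *\<^sub>R (fourier F x * cnj (fourier F x))" for x
  proof -
    have "cnj (fourier F x) = (\<integral>k. cnj (F k) * iexp (- (k \<bullet> x)) \<partial>lborel)"
      unfolding fourier_def by (simp add: exp_cnj flip: Bochner_Integration.integral_cnj)
    then show ?thesis by (simp only: integral_mult_right_zero scaleR_conv_of_real mult.assoc)
  qed
  have I1: "integrable (lborel \<Otimes>\<^sub>M lborel) (\<lambda>(x::'a, k::'a). of_real (?g x) * fourier F x * (cnj (F k) * iexp (- (k \<bullet> x))))"
  proof (rule integrable_pair_lborel_bound[OF _ integrable_norm[OF gF] integrable_norm[OF F]])
    show "(\<lambda>(x::'a, k::'a). of_real (?g x) * fourier F x * (cnj (F k) * iexp (- (k \<bullet> x)))) \<in> borel_measurable (lborel \<Otimes>\<^sub>M lborel)"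
      by measurable
  qed (simp add: norm_mult)
  have 2: "(\<integral>x. of_real (?g x) * fourier F x * iexp (- (k \<bullet> x)) \<partial>lborel)
      = of_real (sqrt (2 * pi) ^ DIM('a)) * (\<integral>z. of_real (gaussian z) * F (k + e *\<^sub>R z) \<partial>lborel)" for k
  proof -
    have I2: "integrable (lborel \<Otimes>\<^sub>M lborel) (\<lambda>(x::'a, k'::'a). of_real (?g x) * iexp (- (k \<bullet> x)) * (F k' * iexp (k' \<bullet> x)))"
    proof (rule integrable_pair_lborel_bound[OF _ gi integrable_norm[OF F]])
      show "(\<lambda>(x::'a, k'::'a). of_real (?g x) * iexp (- (k \<bullet> x)) * (F k' * iexp (k' \<bullet> x))) \<in> borel_measurable (lborel \<Otimes>\<^sub>M lborel)"
        by measurable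
    qed (simp add: norm_mult gaussian_props(1) less_imp_le)
    have "(\<integral>x. of_real (?g x) * fourier F x * iexp (- (k \<bullet> x)) \<partial>lborel)
       = (\<integral>x. (\<integral>k'. of_real (?g x) * iexp (- (k \<bullet> x)) * (F k' * iexp (k' \<bullet> x)) \<partial>lborel) \<partial>lborel)"
      by (simp only: integral_mult_right_zero fourier_def) (simp only: mult_ac)
    also have "\<dots> = (\<integral>k'. (\<integral>x. of_real (?g x) * iexp (- (k \<bullet> x)) * (F k' * iexp (k' \<bullet> x)) \<partial>lborel) \<partial>lborel)"
      by (rule lborel_pair.Fubini_integral[OF I2, symmetric])
    also have "\<dots> = (\<integral>k'. (\<integral>x. F k' * (of_real (?g x) * iexp ((k' - k) \<bullet> x)) \<partial>lborel) \<partial>lborel)"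
    proof (intro Bochner_Integration.integral_cong refl)
      fix x k' :: 'a
      have "iexp ((k' - k) \<bullet> x) = iexp (- (k \<bullet> x)) * iexp (k' \<bullet> x)"
        by (simp add: inner_diff_left algebra_simps flip: exp_add)
      then show "of_real (?g x) * iexp (- (k \<bullet> x)) * (F k' * iexp (k' \<bullet> x)) = F k' * (of_real (?g x) * iexp ((k' - k) \<bullet> x))"
        by (simp only: mult_ac)
    qed
    also have "\<dots> = (\<integral>k'. F k' * of_real ((sqrt (2 * pi) / e) ^ DIM('a) * gaussian ((1/e) *\<^sub>R (k' - k))) \<partial>lborel)"
      by (simp only: integral_mult_right_zero gaussian_fourier_scaled[OF e])
    \<comment> \<open>Substitution \<open>k' = k + e z\<close>. Its Jacobian cancels the power of
      \<open>1 / e\<close> in the transform of the scaled Gaussian, so that the kernel keeps a fixed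
      mass as \<open>e\<close> tends to 0.\<close>
    also have "\<dots> = e ^ DIM('a) *\<^sub>R (\<integral>z. F (k + e *\<^sub>R z) * of_real ((sqrt (2 * pi) / e) ^ DIM('a) * gaussian z) \<partial>lborel)"
      using e by (subst lborel_integral_affine[of e _ k]) auto
    also have "\<dots> = e ^ DIM('a) *\<^sub>R (\<integral>z. of_real ((sqrt (2 * pi) / e) ^ DIM('a)) * (of_real (gaussian z) * F (k + e *\<^sub>R z)) \<partial>lborel)"
      by (simp only: mult_ac of_real_mult)
    also have "\<dots> = of_real (sqrt (2 * pi) ^ DIM('a)) * (\<integral>z. of_real (gaussian z) * F (k + e *\<^sub>R z) \<partial>lborel)"
      using e by (simp only: integral_mult_right_zero) (simp add: scaleR_conv_of_real power_divide)
    finally show ?thesis .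
  qed
  have "(\<integral>x. ?g x *\<^sub>R (fourier F x * cnj (fourier F x)) \<partial>lborel)
     = (\<integral>k. (\<integral>x. of_real (?g x) * fourier F x * (cnj (F k) * iexp (- (k \<bullet> x))) \<partial>lborel) \<partial>lborel)"
    using lborel_pair.Fubini_integral[OF I1] by (simp only: 1)
  also have "\<dots> = (\<integral>k. of_real (sqrt (2 * pi) ^ DIM('a)) *
      (cnj (F k) * (\<integral>z. of_real (gaussian z) * F (k + e *\<^sub>R z) \<partial>lborel)) \<partial>lborel)"
  proof (intro Bochner_Integration.integral_cong refl)
    fix k
    have "(\<integral>x. of_real (?g x) * fourier F x * (cnj (F k) * iexp (- (k \<bullet> x))) \<partial>lborel)
       = cnj (F k) * (\<integral>x. of_real (?g x) * fourier F x * iexp (- (k \<bullet> x)) \<partial>lborel)"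
      unfolding integral_mult_right_zero[symmetric] by (simp only: mult_ac)
    then show "(\<integral>x. of_real (?g x) * fourier F x * (cnj (F k) * iexp (- (k \<bullet> x))) \<partial>lborel)
       = of_real (sqrt (2 * pi) ^ DIM('a)) *
         (cnj (F k) * (\<integral>z. of_real (gaussian z) * F (k + e *\<^sub>R z) \<partial>lborel))"
      by (simp only: 2 mult.left_commute)
  qed
  finally show ?thesis by (simp only: integral_mult_right_zero)
qed

text \<open>The Gaussian weights increase to 1, so monotone convergence gives integrability of
  \<open>\<bar>fourier F\<bar>\<^sup>2\<close> together with the value of its integral.\<close>

theorem plancherel:
  fixes F :: "'a::euclidean_space \<Rightarrow> complex"
  assumes F: "integrable lborel F" and bd: "\<And>k. norm (F k) \<le> C"
    and cont: "AE k in lborel. isCont F k"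
  shows "integrable lborel (\<lambda>x. (norm (fourier F x))\<^sup>2)"
    and "(\<integral>x. (norm (fourier F x))\<^sup>2 \<partial>lborel) = (2 * pi) ^ DIM('a) * (\<integral>k. (norm (F k))\<^sup>2 \<partial>lborel)"
proof -
  have Fm[measurable]: "F \<in> borel_measurable borel" using F by auto
  have [measurable]: "(\<lambda>k. cnj (F k)) \<in> borel_measurable borel"
    using borel_measurable_continuous_onI[OF continuous_on_cnj[OF continuous_on_id]] by measurable
  note fm[measurable] = fourier_measurable[OF F]
  note gm[measurable] = gaussian_props(4)
  define c where "c = sqrt (2 * pi) ^ DIM('a)"
  have cc: "c * c = (2 * pi) ^ DIM('a)" unfolding c_def by (simp only: power_mult_distrib[symmetric]) simp
  have C: "0 \<le> C" using order_trans[OF norm_ge_zero bd] by blast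
  define e where "e n = 1 / real (Suc n)" for n
  have e: "e n > 0" for n by (simp add: e_def)
  have e0: "e \<longlonglongrightarrow> 0" unfolding e_def by real_asymp
  \<comment> \<open>At a point of continuity the Gaussian averages tend to the value of
    \<open>F\<close> times the mass \<open>c\<close> of the Gaussian. Asking for this only almost
    everywhere accommodates the singular point \<open>k = 0\<close> of the transverse
    projection.\<close>
  have inner: "(\<lambda>n. \<integral>z. of_real (gaussian z) * F (k + e n *\<^sub>R z) \<partial>lborel) \<longlonglongrightarrow> of_real c * F k"
    if k: "isCont F k" for k
  proof -
    have "(\<lambda>n. \<integral>z. of_real (gaussian z) * F (k + e n *\<^sub>R z) \<partial>lborel) \<longlonglongrightarrow> (\<integral>z. of_real (gaussian (z::'a)) * F k \<partial>lborel)"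
    proof (rule integral_dominated_convergence[where w="\<lambda>z. C * gaussian z"])
      show "AE z in lborel. (\<lambda>n. of_real (gaussian z) * F (k + e n *\<^sub>R z)) \<longlonglongrightarrow> of_real (gaussian z) * F k"
      proof (intro AE_I2 tendsto_intros)
        fix z
        have "(\<lambda>n. k + e n *\<^sub>R z) \<longlonglongrightarrow> k + 0 *\<^sub>R z" by (intro tendsto_intros e0)
        then show "(\<lambda>n. F (k + e n *\<^sub>R z)) \<longlonglongrightarrow> F k" by (intro isCont_tendsto_compose[OF k]) simp
      qed
      show "integrable lborel (\<lambda>z::'a. C * gaussian z)" by (intro integrable_mult_right gaussian_integral(1))
    qed (use bd in \<open>simp_all add: norm_mult gaussian_props(1) less_imp_le mult.commute mult_right_mono\<close>)
    moreover have "(\<integral>z. of_real (gaussian (z::'a)) * F k \<partial>lborel) = of_real c * F k"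
      by (simp add: gaussian_integral(2) c_def)
    ultimately show ?thesis by auto
  qed
  have inner_bd: "norm (\<integral>z. of_real (gaussian z) * F (k + e n *\<^sub>R z) \<partial>lborel) \<le> C * c" for k n
  proof -
    have "norm (\<integral>z. of_real (gaussian z) * F (k + e n *\<^sub>R z) \<partial>lborel) \<le> (\<integral>z. C * gaussian (z::'a) \<partial>lborel)"
    proof (rule Bochner_Integration.integral_norm_bound_integral)
      show ig: "integrable lborel (\<lambda>z::'a. C * gaussian z)" by (intro integrable_mult_right gaussian_integral(1))
      show le: "norm (of_real (gaussian z) * F (k + e n *\<^sub>R z)) \<le> C * gaussian z" for z
        using bd by (simp add: norm_mult gaussian_props(1) less_imp_le mult.commute mult_right_mono)
      show "integrable lborel (\<lambda>z. of_real (gaussian z) * F (k + e n *\<^sub>R z))"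
        by (rule Bochner_Integration.integrable_bound[OF ig])
           (auto intro!: AE_I2 order_trans[OF le abs_ge_self])
    qed
    then show ?thesis by (simp add: gaussian_integral(2) c_def)
  qed
  have lim: "(\<lambda>n. \<integral>k. cnj (F k) * (\<integral>z. of_real (gaussian z) * F (k + e n *\<^sub>R z) \<partial>lborel) \<partial>lborel)
     \<longlonglongrightarrow> (\<integral>k. cnj (F k) * (of_real c * F k) \<partial>lborel)"
  proof (rule integral_dominated_convergence[where w="\<lambda>k. norm (F k) * (C * c)"])
    show "AE k in lborel. (\<lambda>n. cnj (F k) * (\<integral>z. of_real (gaussian z) * F (k + e n *\<^sub>R z) \<partial>lborel))
         \<longlonglongrightarrow> cnj (F k) * (of_real c * F k)"
      using cont by eventually_elim (intro tendsto_intros inner)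
  qed (measurable, use F inner_bd in \<open>simp_all add: norm_mult mult_left_mono\<close>)
  have eqn: "(\<integral>x. gaussian (e n *\<^sub>R x) * (norm (fourier F x))\<^sup>2 \<partial>lborel)
     = Re (of_real c * (\<integral>k. cnj (F k) * (\<integral>z. of_real (gaussian z) * F (k + e n *\<^sub>R z) \<partial>lborel) \<partial>lborel))" for n
  proof -
    have "complex_of_real (\<integral>x. gaussian (e n *\<^sub>R x) * (norm (fourier F x))\<^sup>2 \<partial>lborel) =
       (\<integral>x. gaussian (e n *\<^sub>R x) *\<^sub>R (fourier F x * cnj (fourier F x)) \<partial>lborel)"
      by (subst integral_complex_of_real[symmetric])
         (simp add: scaleR_conv_of_real flip: complex_norm_square)
    also note plancherel_regularized[OF F e]
    finally show ?thesis unfolding c_def by (metis Re_complex_of_real)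
  qed
  have rhs: "(\<integral>k. cnj (F k) * (of_real c * F k) \<partial>lborel) = of_real (c * (\<integral>k. (norm (F k))\<^sup>2 \<partial>lborel))"
  proof -
    have "cnj (F k) * (of_real c * F k) = of_real (c * (norm (F k))\<^sup>2)" for k
      by (simp only: of_real_mult complex_norm_square mult_ac)
    then show ?thesis by (simp only: integral_complex_of_real integral_mult_right_zero)
  qed
  have lim': "(\<lambda>n. \<integral>x. gaussian (e n *\<^sub>R x) * (norm (fourier F x))\<^sup>2 \<partial>lborel)
     \<longlonglongrightarrow> (2 * pi) ^ DIM('a) * (\<integral>k. (norm (F k))\<^sup>2 \<partial>lborel)"
    unfolding eqn using tendsto_Re[OF tendsto_mult[OF tendsto_const lim], of "of_real c"]
    by (simp only: rhs of_real_mult[symmetric] Re_complex_of_real cc[symmetric] mult.assoc)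
  have int: "integrable lborel (\<lambda>x. gaussian (e n *\<^sub>R x) * (norm (fourier F x))\<^sup>2)" for n
  proof (rule Bochner_Integration.integrable_bound)
    show "integrable lborel (\<lambda>x. gaussian (e n *\<^sub>R x) * (\<integral>k. norm (F k) \<partial>lborel)\<^sup>2)"
      using lborel_integrable_affine[OF gaussian_integral(1), of "e n" 0] e[of n] by auto
  qed (auto simp: abs_mult gaussian_props(1) less_imp_le intro!: AE_I2 mult_left_mono power_mono fourier_bound)
  \<comment> \<open>The widths \<open>e n\<close> decrease, hence the Gaussians
    \<open>gaussian (e n *\<^sub>R x)\<close> increase.\<close>
  have mono: "mono (\<lambda>n. gaussian (e n *\<^sub>R x) * (norm (fourier F x))\<^sup>2)" for x
  proof (rule monoI)
    fix m n :: nat assume "m \<le> n"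
    then have "e n \<le> e m" by (simp add: e_def frac_le)
    then show "gaussian (e m *\<^sub>R x) * (norm (fourier F x))\<^sup>2 \<le> gaussian (e n *\<^sub>R x) * (norm (fourier F x))\<^sup>2"
      using e[of n] by (intro mult_right_mono) (auto simp: gaussian_def intro!: power_mono mult_right_mono)
  qed
  have lim1: "(\<lambda>n. gaussian (e n *\<^sub>R x) * (norm (fourier F x))\<^sup>2) \<longlonglongrightarrow> (norm (fourier F x))\<^sup>2" for x
  proof -
    have "(\<lambda>n. gaussian (e n *\<^sub>R x) * (norm (fourier F x))\<^sup>2) \<longlonglongrightarrow> exp (- (norm (0 *\<^sub>R x))\<^sup>2 / 2) * (norm (fourier F x))\<^sup>2"
      unfolding gaussian_def by (intro tendsto_intros e0) auto
    then show ?thesis by simp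
  qed
  have "has_bochner_integral lborel (\<lambda>x. (norm (fourier F x))\<^sup>2) ((2 * pi) ^ DIM('a) * (\<integral>k. (norm (F k))\<^sup>2 \<partial>lborel))"
    by (rule has_bochner_integral_monotone_convergence[OF int _ _ lim'])
       (use mono lim1 in \<open>auto simp: gaussian_props(1) less_imp_le\<close>)
  then show "integrable lborel (\<lambda>x. (norm (fourier F x))\<^sup>2)"
    and "(\<integral>x. (norm (fourier F x))\<^sup>2 \<partial>lborel) = (2 * pi) ^ DIM('a) * (\<integral>k. (norm (F k))\<^sup>2 \<partial>lborel)"
    by (auto simp: has_bochner_integral_iff)
qed

section \<open>A divergence theorem for differentiable fields\<close>

text \<open>Half-open, so that the dyadic subcubes partition it exactly, without overlaps of measure
  zero.\<close>

definition unit_cube :: "(real^'n) set" where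
  "unit_cube = {y. \<forall>i. 0 \<le> y $ i \<and> y $ i < 1}"

text \<open>The index set of the dyadic children of the unit cube: the child belonging to
  \<open>c\<close> has lower corner \<open>c / 2\<close>.\<close>

definition cube_corners :: "(real^'n) set" where
  "cube_corners = {c. \<forall>i. c $ i = 0 \<or> c $ i = 1}"

text \<open>For \<open>a\<close> equal to 0 or 1 this projects a point of the cube onto one of the
  two faces orthogonal to axis \<open>i\<close>.\<close>

definition vec_upd :: "real^'n \<Rightarrow> 'n \<Rightarrow> real \<Rightarrow> real^'n" where
  "vec_upd y i a = (\<chi> j. if j = i then a else y $ j)"

lemma vec_upd_nth: "vec_upd y i a $ j = (if j = i then a else y $ j)"
  by (simp add: vec_upd_def)

lemma continuous_vec_upd [continuous_intros]:
  "continuous_on A f \<Longrightarrow> continuous_on A (\<lambda>x. vec_upd (f x) i a)"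
  unfolding vec_upd_def
proof (rule continuous_on_vec_lambda)
  fix j assume "continuous_on A f"
  then show "continuous_on A (\<lambda>x. if j = i then a else f x $ j)"
    by (cases "j = i") (simp_all add: continuous_intros)
qed

lemma unit_cube_subset: "unit_cube \<subseteq> cbox 0 (1::real^'n)"
  by (auto simp: unit_cube_def mem_box_cart less_imp_le)

lemma unit_cube_measurable [measurable]: "(unit_cube :: (real^'n) set) \<in> sets borel"
proof -
  have "unit_cube = (\<Inter>i. {y::real^'n. 0 \<le> y $ i} \<inter> {y. y $ i < 1})"
    by (auto simp: unit_cube_def)
  also have "\<dots> \<in> sets borel"
    by (intro sets.countable_INT' sets.Int borel_closed borel_open closed_halfspace_component_ge_cart
       open_halfspace_component_lt_cart) (auto simp: countable_finite closed_halfspace_component_ge_cart)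
  finally show ?thesis .
qed

lemma emeasure_unit_cube: "emeasure lborel (unit_cube :: (real^'n) set) = 1"
proof (rule antisym)
  have one: "(\<Prod>b\<in>(Basis :: (real^'n) set). (1 - 0) \<bullet> b) = 1"
    by (intro prod.neutral) (auto simp: Basis_vec_def inner_axis)
  have le: "\<And>b. b \<in> (Basis :: (real^'n) set) \<Longrightarrow> 0 \<bullet> b \<le> 1 \<bullet> b"
    by (auto simp: Basis_vec_def inner_axis)
  have "emeasure lborel (unit_cube :: (real^'n) set) \<le> emeasure lborel (cbox 0 (1::real^'n))"
    by (rule emeasure_mono[OF unit_cube_subset]) simp
  also have "\<dots> = 1" using one by (subst emeasure_lborel_cbox[OF le]) simp_all
  finally show "emeasure lborel (unit_cube :: (real^'n) set) \<le> 1" .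
  have "1 = emeasure lborel (box 0 (1::real^'n))" using one by (subst emeasure_lborel_box[OF le]) simp_all
  also have "\<dots> \<le> emeasure lborel (unit_cube :: (real^'n) set)"
    by (rule emeasure_mono) (auto simp: unit_cube_def mem_box_cart less_imp_le)
  finally show "1 \<le> emeasure lborel (unit_cube :: (real^'n) set)" .
qed

lemma integral_indicator_unit_cube:
  "integrable lborel (indicator unit_cube :: real^'n \<Rightarrow> real)"
  "(\<integral>y. indicator (unit_cube :: (real^'n) set) y \<partial>lborel) = (1::real)"
  using emeasure_unit_cube[where 'n='n] by (auto simp: measure_def)

lemma integrable_indicator_continuous:
  fixes h :: "real^'n \<Rightarrow> real"
  assumes "continuous_on UNIV h" "A \<in> sets borel" "bounded A"
  shows "integrable lborel (\<lambda>y. indicator A y * h y)"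
proof -
  obtain a where A: "A \<subseteq> cbox (-a) a" using bounded_subset_cbox_symmetric[OF assms(3)] by blast
  have "integrable lborel (\<lambda>y. indicator (cbox (-a) a) y *\<^sub>R h y)"
    using assms(1) by (intro borel_integrable_compact) (auto intro: continuous_on_subset)
  from integrable_mult_indicator[OF _ this, of A] assms(2) A
  have "integrable lborel (\<lambda>y. indicator A y *\<^sub>R indicator (cbox (-a) a) y *\<^sub>R h y)" by simp
  also have "(\<lambda>y. indicator A y *\<^sub>R indicator (cbox (-a) a) y *\<^sub>R h y) = (\<lambda>y. indicator A y * h y)"
    using A by (intro ext) (auto split: split_indicator)
  finally show ?thesis .
qed

lemma cube_corners_image: "cube_corners = (\<lambda>f. \<chi> i. f i) ` (PiE (UNIV::'n::finite set) (\<lambda>_. {0, 1::real}))"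
proof (intro set_eqI iffI)
  fix c :: "real^'n" assume "c \<in> cube_corners"
  then have "(\<lambda>i. c $ i) \<in> PiE UNIV (\<lambda>_. {0, 1})" "c = (\<chi> i. c $ i)"
    by (auto simp: cube_corners_def PiE_def)
  then show "c \<in> (\<lambda>f. \<chi> i. f i) ` (PiE (UNIV::'n::finite set) (\<lambda>_. {0, 1::real}))" by blast
qed (auto simp: cube_corners_def PiE_def Pi_def)

lemma finite_cube_corners: "finite (cube_corners :: (real^'n) set)"
  unfolding cube_corners_image by (intro finite_imageI finite_PiE) auto

lemma card_cube_corners: "card (cube_corners :: (real^'n) set) \<le> 2 ^ CARD('n)"
proof -
  have "card (cube_corners :: (real^'n) set) \<le> card (PiE (UNIV::'n set) (\<lambda>_. {0, 1::real}))"
    unfolding cube_corners_image by (intro card_image_le finite_PiE) auto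
  also have "\<dots> = 2 ^ CARD('n)" by (subst card_PiE) (auto simp: numeral_2_eq_2)
  finally show ?thesis .
qed

text \<open>Each point of the cube lies in exactly one child, namely the one whose corner is the
  componentwise floor of \<open>2 * y\<close>.\<close>

lemma indicator_unit_cube_refine:
  fixes y :: "real^'n"
  shows "indicator unit_cube y = (\<Sum>c\<in>cube_corners. indicator unit_cube (2 *\<^sub>R y - c) :: real)"
proof -
  have iff: "2 *\<^sub>R y - c \<in> unit_cube \<longleftrightarrow> c = (\<chi> i. of_int \<lfloor>2 * y $ i\<rfloor>) \<and> y \<in> unit_cube" if "c \<in> cube_corners" for c
  proof -
    have *: "0 \<le> 2 * t - b \<and> 2 * t - b < 1 \<longleftrightarrow> b = of_int \<lfloor>2 * t\<rfloor> \<and> 0 \<le> t \<and> t < 1" if "b = 0 \<or> b = 1" for b t :: real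
    proof
      assume h: "0 \<le> 2 * t - b \<and> 2 * t - b < 1"
      with that have "\<lfloor>2 * t\<rfloor> = (if b = 0 then 0 else 1)" by (auto simp: floor_eq_iff)
      with that h show "b = of_int \<lfloor>2 * t\<rfloor> \<and> 0 \<le> t \<and> t < 1" by auto
    next
      assume "b = of_int \<lfloor>2 * t\<rfloor> \<and> 0 \<le> t \<and> t < 1"
      then show "0 \<le> 2 * t - b \<and> 2 * t - b < 1" by linarith
    qed
    have "2 *\<^sub>R y - c \<in> unit_cube \<longleftrightarrow> (\<forall>i. 0 \<le> 2 * y $ i - c $ i \<and> 2 * y $ i - c $ i < 1)"
      by (simp add: unit_cube_def)
    also have "\<dots> \<longleftrightarrow> (\<forall>i. c $ i = of_int \<lfloor>2 * y $ i\<rfloor> \<and> 0 \<le> y $ i \<and> y $ i < 1)"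
      using that by (intro iff_allI *) (simp add: cube_corners_def)
    also have "\<dots> \<longleftrightarrow> c = (\<chi> i. of_int \<lfloor>2 * y $ i\<rfloor>) \<and> y \<in> unit_cube"
      by (auto simp: unit_cube_def vec_eq_iff)
    finally show ?thesis .
  qed
  have "(\<Sum>c\<in>cube_corners. indicator unit_cube (2 *\<^sub>R y - c) :: real)
     = (\<Sum>c\<in>cube_corners. if c = (\<chi> i. of_int \<lfloor>2 * y $ i\<rfloor>) then indicator unit_cube y else 0)"
    by (intro sum.cong) (auto simp: indicator_def iff)
  also have "\<dots> = (if (\<chi> i. of_int \<lfloor>2 * y $ i\<rfloor>) \<in> (cube_corners :: (real^'n) set) then indicator unit_cube y else 0)"
    by (simp add: sum.delta finite_cube_corners)
  also have "\<dots> = indicator unit_cube y"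
  proof -
    have "(\<chi> i. of_int \<lfloor>2 * y $ i\<rfloor>) \<in> (cube_corners :: (real^'n) set)" if "y \<in> unit_cube"
    proof -
      have "\<lfloor>2 * y $ i\<rfloor> = 0 \<or> \<lfloor>2 * y $ i\<rfloor> = 1" for i
      proof -
        have "0 \<le> y $ i" "y $ i < 1" using that by (auto simp: unit_cube_def)
        then show ?thesis by linarith
      qed
      then show ?thesis by (fastforce simp: cube_corners_def)
    qed
    then show ?thesis by (auto simp: indicator_def)
  qed
  finally show ?thesis ..
qed

lemma integral_unit_cube_refine:
  fixes h :: "real^'n \<Rightarrow> real"
  assumes h: "continuous_on UNIV h"
  shows "(\<integral>y. indicator unit_cube y * h y \<partial>lborel)
    = (\<Sum>c\<in>cube_corners. \<integral>z. indicator unit_cube z * h ((1/2) *\<^sub>R (z + c)) \<partial>lborel) / 2 ^ CARD('n)"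
proof -
  have b: "bounded {y::real^'n. 2 *\<^sub>R y - c \<in> unit_cube}" for c
  proof -
    have "bounded (unit_cube :: (real^'n) set)"
      using unit_cube_subset bounded_cbox bounded_subset by blast
    then have "bounded ((\<lambda>x. (1/2) *\<^sub>R c + x) ` (\<lambda>x. (1/2) *\<^sub>R x) ` (unit_cube :: (real^'n) set))"
      by (intro bounded_translation bounded_scaling)
    moreover have "y = (1/2) *\<^sub>R c + (1/2) *\<^sub>R (2 *\<^sub>R y - c)" for y
      by (simp add: scaleR_diff_right)
    ultimately show ?thesis
      by (elim bounded_subset) (auto simp: image_image image_iff intro!: bexI[of _ "2 *\<^sub>R _ - c"])
  qed
  have m[measurable]: "{y::real^'n. 2 *\<^sub>R y - c \<in> unit_cube} \<in> sets borel" for c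
    by measurable
  have ind: "indicator unit_cube (2 *\<^sub>R y - c) = (indicator {y::real^'n. 2 *\<^sub>R y - c \<in> unit_cube} y :: real)" for c y
    by (simp add: indicator_def)
  have "(\<integral>y. indicator unit_cube y * h y \<partial>lborel)
     = (\<integral>y. (\<Sum>c\<in>cube_corners. indicator unit_cube (2 *\<^sub>R y - c) * h y) \<partial>lborel)"
    by (subst indicator_unit_cube_refine) (simp add: sum_distrib_right)
  also have "\<dots> = (\<Sum>c\<in>cube_corners. \<integral>y. indicator unit_cube (2 *\<^sub>R y - c) * h y \<partial>lborel)"
    unfolding ind by (intro Bochner_Integration.integral_sum integrable_indicator_continuous h b m)
  also have "\<dots> = (\<Sum>c\<in>cube_corners. (\<integral>z. indicator unit_cube z * h ((1/2) *\<^sub>R (z + c)) \<partial>lborel) / 2 ^ CARD('n))"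
  proof (intro sum.cong refl)
    fix c :: "real^'n"
    have e: "2 *\<^sub>R ((1/2) *\<^sub>R c + (1/2) *\<^sub>R z) - c = z" "(1/2) *\<^sub>R c + (1/2) *\<^sub>R z = (1/2) *\<^sub>R (z + c)" for z
      by (simp_all add: scaleR_add_right)
    have "(\<integral>y. indicator unit_cube (2 *\<^sub>R y - c) * h y \<partial>lborel)
      = \<bar>1/2\<bar> ^ CARD('n) *\<^sub>R (\<integral>z. indicator unit_cube z * h ((1/2) *\<^sub>R (z + c)) \<partial>lborel)"
      by (subst lborel_integral_affine[of "1/2" _ "(1/2) *\<^sub>R c"]) (simp_all only: e, simp_all)
    then show "(\<integral>y. indicator unit_cube (2 *\<^sub>R y - c) * h y \<partial>lborel)
      = (\<integral>z. indicator unit_cube z * h ((1/2) *\<^sub>R (z + c)) \<partial>lborel) / 2 ^ CARD('n)"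
      by (simp add: power_one_over)
  qed
  finally show ?thesis by (simp add: sum_divide_distrib)
qed

text \<open>Integrated over the unit cube in \<open>y\<close>, this is the outward flux of
  \<open>G\<close> through the cube with lower corner \<open>p\<close> and side \<open>r\<close>,
  minus the integral of \<open>g\<close> over it, all divided by the volume
  \<open>r ^ CARD('n)\<close>. Writing face integrals as volume integrals of functions constant in
  \<open>y $ i\<close> avoids surface measures, and the normalisation makes different scales
  comparable.\<close>

definition box_flux_defect :: "(real^'n \<Rightarrow> real^'n) \<Rightarrow> (real^'n \<Rightarrow> real) \<Rightarrow> real^'n \<Rightarrow> real \<Rightarrow> real^'n \<Rightarrow> real" where
  "box_flux_defect G g p r y =
     (\<Sum>i\<in>UNIV. (G (p + r *\<^sub>R vec_upd y i 1) $ i - G (p + r *\<^sub>R vec_upd y i 0) $ i) / r) - g (p + r *\<^sub>R y)"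

lemma continuous_box_flux_defect:
  assumes "continuous_on UNIV G" "continuous_on UNIV g"
  shows "continuous_on UNIV (box_flux_defect G g p r)"
proof -
  have *: "continuous_on UNIV (\<lambda>y. f (h y))" if "continuous_on UNIV f" "continuous_on UNIV h"
    for h :: "real^'a \<Rightarrow> real^'a" and f :: "real^'a \<Rightarrow> 'c::topological_space"
    using continuous_on_compose2[OF that(1) that(2)] by simp
  show ?thesis
    unfolding box_flux_defect_def[abs_def] divide_inverse
    by (intro continuous_intros *[OF assms(1)] *[OF assms(2)])
qed

text \<open>Fluxes through the interior faces of the subdivision cancel: adding up over the two
  children adjacent in direction \<open>i\<close> telescopes.\<close>

lemma box_flux_defect_refine:
  fixes G :: "real^'n \<Rightarrow> real^'n"
  assumes r: "r > 0"
  shows "(\<Sum>c\<in>cube_corners. box_flux_defect G g p r ((1/2) *\<^sub>R (z + c)))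
    = (\<Sum>c\<in>cube_corners. box_flux_defect G g (p + (r/2) *\<^sub>R c) (r/2) z)"
proof -
  have key: "(\<Sum>c\<in>cube_corners. G (p + r *\<^sub>R vec_upd ((1/2) *\<^sub>R (z + c)) i 1) $ i - G (p + r *\<^sub>R vec_upd ((1/2) *\<^sub>R (z + c)) i 0) $ i)
    = 2 * (\<Sum>c\<in>cube_corners. G (p + (r/2) *\<^sub>R c + (r/2) *\<^sub>R vec_upd z i 1) $ i - G (p + (r/2) *\<^sub>R c + (r/2) *\<^sub>R vec_upd z i 0) $ i)"
    (is "sum ?par _ = 2 * sum ?ch _") for i
  proof -
    let ?flip = "\<lambda>c. vec_upd c i (1 - c $ i)"
    have bij: "bij_betw ?flip cube_corners cube_corners"
    proof (rule bij_betwI[where g="?flip"])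
      show "?flip \<in> cube_corners \<rightarrow> cube_corners" "?flip \<in> cube_corners \<rightarrow> cube_corners"
        unfolding cube_corners_def Pi_def mem_Collect_eq vec_upd_nth by (metis diff_0_right diff_self)+
    qed (simp_all add: vec_eq_iff vec_upd_nth)
    define h where "h c a = G (p + r *\<^sub>R vec_upd ((1/2) *\<^sub>R (z + c)) i a) $ i" for c a
    have hflip: "h (?flip c) a = h c a" for c a
      unfolding h_def by (rule arg_cong[where f="\<lambda>x. G (p + r *\<^sub>R x) $ i"]) (simp add: vec_eq_iff vec_upd_nth)
    have ch: "G (p + (r/2) *\<^sub>R c + (r/2) *\<^sub>R vec_upd z i a) $ i = h c ((a + c $ i) / 2)" for c a
      unfolding h_def by (rule arg_cong[where f="\<lambda>x. G x $ i"]) (simp add: vec_eq_iff vec_upd_nth algebra_simps)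
    \<comment> \<open>\<open>?flip c\<close> is the neighbour of \<open>c\<close> in direction
      \<open>i\<close>. The values at the common face, \<open>h c (1/2)\<close>, cancel. Summing
      over all corners counts each pair of neighbours twice, hence the 2 in \<open>key\<close>,
      which the halved side length absorbs.\<close>
    have "?par c = ?ch c + ?ch (?flip c)" if "c \<in> cube_corners" for c
    proof -
      have "c $ i = 0 \<or> c $ i = 1" using that by (simp add: cube_corners_def)
      then show ?thesis
        unfolding ch hflip unfolding h_def[symmetric] by (auto simp: vec_upd_nth)
    qed
    then have "sum ?par cube_corners = sum ?ch cube_corners + (\<Sum>c\<in>cube_corners. ?ch (?flip c))"
      by (simp add: sum.distrib)
    also have "(\<Sum>c\<in>cube_corners. ?ch (?flip c)) = sum ?ch cube_corners"
      by (rule sum.reindex_bij_betw[OF bij])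
    finally show ?thesis by simp
  qed
  have g: "g (p + r *\<^sub>R ((1/2) *\<^sub>R (z + c))) = g (p + (r/2) *\<^sub>R c + (r/2) *\<^sub>R z)" for c
    by (rule arg_cong[where f=g]) (simp add: vec_eq_iff algebra_simps)
  have "(\<Sum>c\<in>cube_corners. \<Sum>i\<in>UNIV. (G (p + r *\<^sub>R vec_upd ((1/2) *\<^sub>R (z + c)) i 1) $ i - G (p + r *\<^sub>R vec_upd ((1/2) *\<^sub>R (z + c)) i 0) $ i) / r)
    = (\<Sum>c\<in>cube_corners. \<Sum>i\<in>UNIV. (G (p + (r/2) *\<^sub>R c + (r/2) *\<^sub>R vec_upd z i 1) $ i - G (p + (r/2) *\<^sub>R c + (r/2) *\<^sub>R vec_upd z i 0) $ i) / (r/2))"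
    by (subst (1 2) sum.swap, rule sum.cong[OF refl], simp only: sum_divide_distrib[symmetric] key) (simp add: field_simps)
  then show ?thesis
    by (simp only: box_flux_defect_def sum_subtractf g)
qed

lemma box_flux_defect_integral_refine:
  fixes G :: "real^'n \<Rightarrow> real^'n"
  assumes "r > 0" "continuous_on UNIV G" "continuous_on UNIV g"
  shows "(\<integral>y. indicator unit_cube y * box_flux_defect G g p r y \<partial>lborel)
    = (\<Sum>c\<in>cube_corners. \<integral>y. indicator unit_cube y * box_flux_defect G g (p + (r/2) *\<^sub>R c) (r/2) y \<partial>lborel) / 2 ^ CARD('n)"
proof -
  have bd: "bounded (unit_cube :: (real^'n) set)"
    using unit_cube_subset bounded_cbox bounded_subset by blast
  note cont = continuous_box_flux_defect[OF assms(2,3)]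
  have int: "integrable lborel (\<lambda>y. indicator unit_cube y * h y)" if "continuous_on UNIV h" for h :: "real^'n \<Rightarrow> real"
    by (rule integrable_indicator_continuous[OF that unit_cube_measurable bd])
  have "(\<Sum>c\<in>cube_corners. \<integral>z. indicator unit_cube z * box_flux_defect G g p r ((1/2) *\<^sub>R (z + c)) \<partial>lborel)
    = (\<integral>z. indicator unit_cube z * (\<Sum>c\<in>cube_corners. box_flux_defect G g p r ((1/2) *\<^sub>R (z + c))) \<partial>lborel)"
    unfolding sum_distrib_left
    by (intro Bochner_Integration.integral_sum[symmetric] int continuous_on_compose2[OF cont] continuous_intros) auto
  also have "\<dots> = (\<integral>z. (\<Sum>c\<in>cube_corners. indicator unit_cube z * box_flux_defect G g (p + (r/2) *\<^sub>R c) (r/2) z) \<partial>lborel)"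
    unfolding box_flux_defect_refine[OF assms(1)] sum_distrib_left ..
  also have "\<dots> = (\<Sum>c\<in>cube_corners. \<integral>y. indicator unit_cube y * box_flux_defect G g (p + (r/2) *\<^sub>R c) (r/2) y \<partial>lborel)"
    by (intro Bochner_Integration.integral_sum int cont)
  finally show ?thesis
    unfolding integral_unit_cube_refine[OF cont] by (rule arg_cong)
qed

text \<open>The affine approximation of \<open>G\<close> at \<open>q\<close> has flux density equal
  to the trace of \<open>A\<close>, that is \<open>g q\<close>, so only the remainders count. In the
  l1 norm every point of the closed cube is within \<open>CARD('n) * r\<close> of \<open>q\<close>.
  Each of the two faces per direction thus contributes at most \<open>CARD('n) * \<eta>\<close>
  after division by \<open>r\<close>, and the variation of \<open>g\<close> contributes one more
  \<open>\<eta>\<close>.\<close>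

lemma box_flux_defect_small:
  fixes G :: "real^'n \<Rightarrow> real^'n"
  assumes r: "r > 0" and A: "(G has_derivative A) (at q)" and tr: "(\<Sum>i\<in>UNIV. A (axis i 1) $ i) = g q"
    and p: "\<And>i. p $ i \<le> q $ i" "\<And>i. q $ i \<le> p $ i + r"
    and lin: "\<And>x. dist x q \<le> real CARD('n) * r \<Longrightarrow> norm (G x - G q - A (x - q)) \<le> \<eta> * norm (x - q)"
    and g: "\<And>x. dist x q \<le> real CARD('n) * r \<Longrightarrow> \<bar>g x - g q\<bar> \<le> \<eta>"
    and y: "y \<in> unit_cube" and \<eta>: "\<eta> \<ge> 0"
  shows "\<bar>box_flux_defect G g p r y\<bar> \<le> (2 * real CARD('n) ^ 2 + 1) * \<eta>"
proof -
  interpret A: linear A using A by (rule has_derivative_linear)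
  define N where "N = real CARD('n)"
  have dq: "dist (p + r *\<^sub>R u) q \<le> N * r" if "\<And>j. 0 \<le> u $ j \<and> u $ j \<le> 1" for u
  proof -
    have "dist (p + r *\<^sub>R u) q \<le> (\<Sum>j\<in>UNIV. \<bar>(p + r *\<^sub>R u - q) $ j\<bar>)"
      unfolding dist_norm by (rule norm_le_l1_cart)
    also have "\<dots> \<le> (\<Sum>j\<in>(UNIV::'n set). r)"
    proof (rule sum_mono)
      fix j
      have "0 \<le> r * u $ j" "r * u $ j \<le> r" using that[of j] r by (auto simp: mult_left_le)
      with p[of j] show "\<bar>(p + r *\<^sub>R u - q) $ j\<bar> \<le> r"
        unfolding vector_minus_component vector_add_component vector_scaleR_component real_scaleR_def by linarith
    qed
    finally show ?thesis by (simp add: N_def)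
  qed
  have y01: "0 \<le> y $ j \<and> y $ j \<le> 1" for j using y by (auto simp: unit_cube_def less_imp_le)
  have face: "\<bar>(G (p + r *\<^sub>R vec_upd y i 1) $ i - G (p + r *\<^sub>R vec_upd y i 0) $ i) / r - A (axis i 1) $ i\<bar> \<le> 2 * N * \<eta>" for i
  proof -
    define x1 x0 where "x1 = p + r *\<^sub>R vec_upd y i 1" and "x0 = p + r *\<^sub>R vec_upd y i 0"
    have d: "dist x1 q \<le> N * r" "dist x0 q \<le> N * r"
      unfolding x1_def x0_def using y01 by (auto intro!: dq simp: vec_upd_nth)
    have "x1 - x0 = r *\<^sub>R axis i 1"
      by (simp add: x1_def x0_def vec_eq_iff vec_upd_nth axis_def)
    then have "x1 - q = (x0 - q) + r *\<^sub>R axis i 1" by (simp add: algebra_simps)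
    then have Ax: "A (x1 - q) = A (x0 - q) + r *\<^sub>R A (axis i 1)"
      by (simp only: A.add A.scaleR)
    have R: "\<bar>(G x - G q - A (x - q)) $ i\<bar> \<le> \<eta> * (N * r)" if "dist x q \<le> N * r" for x
      using component_le_norm_cart[of "G x - G q - A (x - q)" i] lin[of x] that \<eta>
        mult_left_mono[OF that \<eta>] unfolding N_def dist_norm by linarith
    have "G x1 $ i - G x0 $ i - r * A (axis i 1) $ i = (G x1 - G q - A (x1 - q)) $ i - (G x0 - G q - A (x0 - q)) $ i"
      by (simp add: Ax)
    then have "\<bar>G x1 $ i - G x0 $ i - r * A (axis i 1) $ i\<bar> \<le> 2 * (\<eta> * (N * r))"
      using R[OF d(1)] R[OF d(2)] by linarith
    then have "\<bar>(G x1 $ i - G x0 $ i - r * A (axis i 1) $ i) / r\<bar> \<le> 2 * N * \<eta>"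
      using r by (simp add: abs_divide divide_le_eq mult_ac)
    then show ?thesis
      using r unfolding x1_def[symmetric] x0_def[symmetric] by (simp add: diff_divide_distrib)
  qed
  have "box_flux_defect G g p r y = (\<Sum>i\<in>UNIV. (G (p + r *\<^sub>R vec_upd y i 1) $ i - G (p + r *\<^sub>R vec_upd y i 0) $ i) / r - A (axis i 1) $ i)
      - (g (p + r *\<^sub>R y) - g q)"
    unfolding box_flux_defect_def sum_subtractf tr by simp
  also have "\<bar>\<dots>\<bar> \<le> (\<Sum>i\<in>(UNIV::'n set). 2 * N * \<eta>) + \<eta>"
  proof (rule order_trans[OF abs_triangle_ineq4 add_mono])
    show "\<bar>\<Sum>i\<in>UNIV. (G (p + r *\<^sub>R vec_upd y i 1) $ i - G (p + r *\<^sub>R vec_upd y i 0) $ i) / r - A (axis i 1) $ i\<bar> \<le> (\<Sum>i\<in>(UNIV::'n set). 2 * N * \<eta>)"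
      by (rule order_trans[OF sum_abs sum_mono[OF face]])
    show "\<bar>g (p + r *\<^sub>R y) - g q\<bar> \<le> \<eta>"
      using y01 by (intro g[folded N_def] dq)
  qed
  also have "\<dots> = (2 * N ^ 2 + 1) * \<eta>" by (simp add: N_def power2_eq_square algebra_simps)
  finally show ?thesis unfolding N_def .
qed

text \<open>Goursat's bisection: a cube with a nonzero defect contains arbitrarily small cubes whose
  normalised defect is at least as large, contradicting differentiability at their common point.\<close>

lemma box_flux_defect_integral_zero:
  fixes G :: "real^'n \<Rightarrow> real^'n"
  assumes r: "r > 0" and A: "\<And>x. (G has_derivative A x) (at x)"
    and tr: "\<And>x. (\<Sum>i\<in>UNIV. A x (axis i 1) $ i) = g x" and g: "continuous_on UNIV g"
  shows "(\<integral>y. indicator unit_cube y * box_flux_defect G g p r y \<partial>lborel) = 0"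
proof (rule ccontr)
  have G: "continuous_on UNIV G"
    using A by (intro continuous_at_imp_continuous_on ballI has_derivative_continuous)
  define e where "e p r = (\<integral>y. indicator unit_cube y * box_flux_defect G g p r y \<partial>lborel)" for p r
  assume "\<not> ?thesis"
  then have \<epsilon>: "\<bar>e p r\<bar> > 0" by (simp add: e_def)
  define \<epsilon> where "\<epsilon> = \<bar>e p r\<bar>"
  \<comment> \<open>Pigeonhole: the normalised defect of the parent is the sum of those of at most
    \<open>2 ^ CARD('n)\<close> children, divided by \<open>2 ^ CARD('n)\<close>, so they cannot all
    be smaller in modulus than \<open>\<epsilon>\<close>.\<close>
  have child: "\<exists>c\<in>cube_corners. \<epsilon> \<le> \<bar>e (p' + (r'/2) *\<^sub>R c) (r'/2)\<bar>" if "r' > 0" "\<epsilon> \<le> \<bar>e p' r'\<bar>" for p' r'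
  proof (rule ccontr)
    assume "\<not> ?thesis"
    then have lt: "\<And>c. c \<in> cube_corners \<Longrightarrow> \<bar>e (p' + (r'/2) *\<^sub>R c) (r'/2)\<bar> < \<epsilon>" by force
    have ne: "(cube_corners :: (real^'n) set) \<noteq> {}" by (auto simp: cube_corners_def intro: exI[of _ 0])
    have "\<bar>e p' r'\<bar> * 2 ^ CARD('n) = \<bar>\<Sum>c\<in>cube_corners. e (p' + (r'/2) *\<^sub>R c) (r'/2)\<bar>"
      unfolding e_def by (subst box_flux_defect_integral_refine[OF that(1) G g]) simp
    also have "\<dots> \<le> (\<Sum>c\<in>cube_corners. \<bar>e (p' + (r'/2) *\<^sub>R c) (r'/2)\<bar>)" by (rule sum_abs)
    also have "\<dots> < (\<Sum>c\<in>(cube_corners :: (real^'n) set). \<epsilon>)"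
      by (rule sum_strict_mono[OF finite_cube_corners ne lt])
    also have "\<dots> \<le> 2 ^ CARD('n) * \<epsilon>"
    proof -
      have "real (card (cube_corners :: (real^'n) set)) \<le> real (2 ^ CARD('n))"
        by (rule of_nat_mono[OF card_cube_corners])
      then show ?thesis using \<epsilon> by (simp add: \<epsilon>_def)
    qed
    finally show False using that(2) by (simp add: mult.commute)
  qed
  have "\<exists>P. P 0 = p \<and> (\<forall>n. (\<epsilon> \<le> \<bar>e (P n) (r / 2 ^ n)\<bar>) \<and> (\<exists>c\<in>cube_corners. P (Suc n) = P n + (r / 2 ^ n / 2) *\<^sub>R c))"
  proof -
    have "\<exists>P. \<forall>n. (\<epsilon> \<le> \<bar>e (P n) (r / 2 ^ n)\<bar> \<and> (n = 0 \<longrightarrow> P n = p)) \<and> (\<exists>c\<in>cube_corners. P (Suc n) = P n + (r / 2 ^ n / 2) *\<^sub>R c)"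
    proof (rule dependent_nat_choice)
      show "\<exists>x. \<epsilon> \<le> \<bar>e x (r / 2 ^ 0)\<bar> \<and> (0 = 0 \<longrightarrow> x = p)" by (auto simp: \<epsilon>_def)
      fix x n assume "\<epsilon> \<le> \<bar>e x (r / 2 ^ n)\<bar> \<and> (n = 0 \<longrightarrow> x = p)"
      then obtain c where "c \<in> cube_corners" "\<epsilon> \<le> \<bar>e (x + (r / 2 ^ n / 2) *\<^sub>R c) (r / 2 ^ n / 2)\<bar>"
        using child[of "r / 2 ^ n" x] r by auto
      then show "\<exists>y. (\<epsilon> \<le> \<bar>e y (r / 2 ^ Suc n)\<bar> \<and> (Suc n = 0 \<longrightarrow> y = p)) \<and> (\<exists>c\<in>cube_corners. y = x + (r / 2 ^ n / 2) *\<^sub>R c)"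
        by (intro exI[of _ "x + (r / 2 ^ n / 2) *\<^sub>R c"]) (auto simp: field_simps)
    qed
    then show ?thesis by blast
  qed
  then obtain P where eP: "\<And>n. \<epsilon> \<le> \<bar>e (P n) (r / 2 ^ n)\<bar>"
    and PS: "\<And>n. \<exists>c\<in>cube_corners. P (Suc n) = P n + (r / 2 ^ n / 2) *\<^sub>R c" by blast
  have step: "P n $ i \<le> P (Suc n) $ i \<and> P (Suc n) $ i + r / 2 ^ Suc n \<le> P n $ i + r / 2 ^ n" for n i
  proof -
    obtain c where c: "c \<in> cube_corners" "P (Suc n) = P n + (r / 2 ^ n / 2) *\<^sub>R c" using PS by blast
    have "c $ i = 0 \<or> c $ i = 1" using c(1) by (simp add: cube_corners_def)
    then show ?thesis using r by (auto simp: c(2) field_simps)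
  qed
  have lim0: "(\<lambda>n. r / 2 ^ n) \<longlonglongrightarrow> 0" by real_asymp
  \<comment> \<open>Nested intervals in each coordinate: by \<open>step\<close> the lower ends
    increase and the upper ends decrease. The limits are the coordinates of a point \<open>q\<close>
    common to all closed cubes.\<close>
  have "\<exists>l. (\<forall>n. P n $ i \<le> l) \<and> (\<forall>n. l \<le> P n $ i + r / 2 ^ n)" for i
  proof -
    have "(\<lambda>n. P n $ i - (P n $ i + r / 2 ^ n)) \<longlonglongrightarrow> 0"
      using tendsto_minus[OF lim0] by simp
    from nested_sequence_unique[OF _ _ _ this] step r show ?thesis by auto
  qed
  then obtain q' where q': "\<And>i n. P n $ i \<le> q' i" "\<And>i n. q' i \<le> P n $ i + r / 2 ^ n" by metis
  define q where "q = (\<chi> i. q' i)"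
  define N where "N = real CARD('n)"
  have N: "N > 0" by (simp add: N_def)
  \<comment> \<open>Chosen so that the bound of \<open>box_flux_defect_small\<close> equals
    \<open>\<epsilon> / 2\<close>.\<close>
  define \<eta> where "\<eta> = \<epsilon> / (2 * (2 * N ^ 2 + 1))"
  have \<eta>: "\<eta> > 0" using \<epsilon> by (auto simp: \<eta>_def \<epsilon>_def intro!: divide_pos_pos add_nonneg_pos)
  obtain d1 where d1: "d1 > 0" "\<And>x. norm (x - q) < d1 \<Longrightarrow> norm (G x - G q - A q (x - q)) \<le> \<eta> * norm (x - q)"
    using A[of q] \<eta> unfolding has_derivative_at_alt by blast
  have "isCont g q" using g by (simp add: continuous_on_eq_continuous_at)
  then obtain d2 where d2: "d2 > 0" "\<And>x. dist x q < d2 \<Longrightarrow> dist (g x) (g q) < \<eta>"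
    using \<eta> unfolding continuous_at_eps_delta by (metis dist_commute)
  have "(\<lambda>n. N * (r / 2 ^ n)) \<longlonglongrightarrow> N * 0" by (intro tendsto_intros lim0)
  then have "\<forall>\<^sub>F n in sequentially. N * (r / 2 ^ n) < min d1 d2"
    using d1 d2 by (intro order_tendstoD) auto
  then obtain n where n: "N * (r / 2 ^ n) < d1" "N * (r / 2 ^ n) < d2"
    using eventually_happens by fastforce
  have small: "\<bar>box_flux_defect G g (P n) (r / 2 ^ n) y\<bar> \<le> (2 * N ^ 2 + 1) * \<eta>" if "y \<in> unit_cube" for y
    unfolding N_def
  proof (rule box_flux_defect_small[where q=q and A="A q"])
    show "norm (G x - G q - A q (x - q)) \<le> \<eta> * norm (x - q)" if "dist x q \<le> real CARD('n) * (r / 2 ^ n)" for x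
      using that n by (intro d1(2)) (simp add: N_def dist_norm)
    show "\<bar>g x - g q\<bar> \<le> \<eta>" if "dist x q \<le> real CARD('n) * (r / 2 ^ n)" for x
      using that n d2(2)[of x] by (simp add: N_def dist_real_def)
  qed (use that r \<eta> q' A tr in \<open>auto simp: q_def\<close>)
  have "\<bar>e (P n) (r / 2 ^ n)\<bar> \<le> (\<integral>y. indicator (unit_cube :: (real^'n) set) y * ((2 * N ^ 2 + 1) * \<eta>) \<partial>lborel)"
  proof -
    have bd: "bounded (unit_cube :: (real^'n) set)"
      using unit_cube_subset bounded_cbox bounded_subset by blast
    have "norm (e (P n) (r / 2 ^ n)) \<le> (\<integral>y. indicator (unit_cube :: (real^'n) set) y * ((2 * N ^ 2 + 1) * \<eta>) \<partial>lborel)"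
      unfolding e_def
    proof (rule Bochner_Integration.integral_norm_bound_integral)
      show "integrable lborel (\<lambda>y. indicator unit_cube y * box_flux_defect G g (P n) (r / 2 ^ n) y)"
        by (intro integrable_indicator_continuous continuous_box_flux_defect G g bd unit_cube_measurable)
    qed (use small integral_indicator_unit_cube in \<open>auto split: split_indicator simp: abs_mult\<close>)
    then show ?thesis by simp
  qed
  also have "\<dots> = \<epsilon> / 2"
  proof -
    have "K * (\<epsilon> / (2 * K)) = \<epsilon> / 2" if "K > 0" for K using that by simp
    from this[of "2 * N ^ 2 + 1"] have "(2 * N ^ 2 + 1) * \<eta> = \<epsilon> / 2"
      unfolding \<eta>_def by (simp add: add_nonneg_pos)
    then show ?thesis
      unfolding integral_mult_left_zero integral_indicator_unit_cube(2) by simp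
  qed
  finally show False using eP[of n] \<epsilon> by (simp add: \<epsilon>_def)
qed

text \<open>By Fubini the integral over \<open>p\<close> can be taken first. For fixed
  \<open>y\<close> translation invariance removes the offset \<open>a y\<close>, and the remaining
  cube has volume 1. When \<open>a\<close> projects onto a face, the result does not depend on which
  face.\<close>

lemma integral_translate_average:
  fixes T :: "real^'n \<Rightarrow> real" and a :: "real^'n \<Rightarrow> real^'n"
  assumes T: "integrable lborel T" and a[measurable]: "a \<in> borel_measurable borel"
  shows "integrable lborel (\<lambda>p. \<integral>y. indicator unit_cube y * T (p + a y) \<partial>lborel)" (is ?I)
    and "(\<integral>p. (\<integral>y. indicator unit_cube y * T (p + a y) \<partial>lborel) \<partial>lborel) = (\<integral>x. T x \<partial>lborel)" (is ?E)
proof -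
  have [measurable]: "T \<in> borel_measurable borel" using T by auto
  have tr: "integrable lborel (\<lambda>p. T (p + t))" "(\<integral>p. T (p + t) \<partial>lborel) = (\<integral>x. T x \<partial>lborel)"
      "(\<integral>p. \<bar>T (p + t)\<bar> \<partial>lborel) = (\<integral>x. \<bar>T x\<bar> \<partial>lborel)" for t
    using lborel_integrable_affine[OF T, of 1 t] lborel_integral_affine[of 1 T t] lborel_integral_affine[of 1 "\<lambda>x. \<bar>T x\<bar>" t]
    by (simp_all add: add.commute)
  have I: "integrable (lborel \<Otimes>\<^sub>M lborel) (\<lambda>(y::real^'n, p). indicator unit_cube y * T (p + a y))"
  proof (rule lborel_pair.Fubini_integrable)
    show "integrable lborel (\<lambda>y::real^'n. \<integral>p. norm (case (y, p) of (y, p) \<Rightarrow> indicator unit_cube y * T (p + a y)) \<partial>lborel)"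
      using integral_indicator_unit_cube(1)[where 'n='n] by (simp add: abs_mult tr)
    show "AE y::real^'n in lborel. integrable lborel (\<lambda>p. case (y, p) of (y, p) \<Rightarrow> indicator unit_cube y * T (p + a y))"
      by (simp add: tr)
  qed measurable
  show ?I
    using lborel_pair.integrable_snd[OF I] by simp
  show ?E
    using lborel_pair.Fubini_integral[OF I] integral_indicator_unit_cube(2)[where 'n='n]
    by (simp add: tr)
qed

text \<open>Exhausting space by growing cubes would need decay of \<open>G\<close> on their
  boundaries. Here the flux identity for the unit cube at \<open>p\<close> is integrated over all
  \<open>p\<close>: opposite faces then contribute the same total, so the flux disappears and only
  the integral of \<open>g\<close> remains. Integrability of \<open>G\<close> suffices for
  this.\<close>

theorem divergence_integral_zero:
  fixes G :: "real^'n \<Rightarrow> real^'n"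
  assumes A: "\<And>x. (G has_derivative A x) (at x)"
    and tr: "\<And>x. (\<Sum>i\<in>UNIV. A x (axis i 1) $ i) = g x" and g: "continuous_on UNIV g"
    and Gi: "\<And>i. integrable lborel (\<lambda>x. G x $ i)" and gi: "integrable lborel g"
  shows "(\<integral>x. g x \<partial>lborel) = 0"
proof -
  have Gc: "continuous_on UNIV G"
    using A by (intro continuous_at_imp_continuous_on ballI has_derivative_continuous)
  have bd: "bounded (unit_cube :: (real^'n) set)"
    using unit_cube_subset bounded_cbox bounded_subset by blast
  have cu: "continuous_on UNIV (\<lambda>y. vec_upd y i t)" for i :: 'n and t by (intro continuous_intros)
  then have m: "(\<lambda>y. vec_upd y i t) \<in> borel_measurable borel" for i :: 'n and t
    by (rule borel_measurable_continuous_onI)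
  let ?I = "\<lambda>T a p. \<integral>y. indicator (unit_cube :: (real^'n) set) y * T (p + a y) \<partial>lborel"
  have int: "integrable lborel (\<lambda>y::real^'n. indicator unit_cube y * T (p + a y))"
    if "continuous_on UNIV T" "continuous_on UNIV a" for T :: "real^'n \<Rightarrow> real" and a p
    by (intro integrable_indicator_continuous bd unit_cube_measurable continuous_on_compose2[OF that(1)] continuous_intros that(2)) auto
  have eq: "(\<Sum>i\<in>UNIV. ?I (\<lambda>x. G x $ i) (\<lambda>y. vec_upd y i 1) p - ?I (\<lambda>x. G x $ i) (\<lambda>y. vec_upd y i 0) p) - ?I g (\<lambda>y. y) p = 0" for p
  proof -
    have "0 = (\<integral>y. indicator (unit_cube :: (real^'n) set) y * box_flux_defect G g p 1 y \<partial>lborel)"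
      using box_flux_defect_integral_zero[OF _ A tr g, of 1 p] by simp
    also have "\<dots> = (\<integral>y. (\<Sum>i\<in>UNIV. indicator unit_cube y * G (p + vec_upd y i 1) $ i - indicator unit_cube y * G (p + vec_upd y i 0) $ i)
        - indicator (unit_cube :: (real^'n) set) y * g (p + y) \<partial>lborel)"
      by (simp add: box_flux_defect_def right_diff_distrib sum_distrib_left)
    also have "\<dots> = (\<Sum>i\<in>UNIV. ?I (\<lambda>x. G x $ i) (\<lambda>y. vec_upd y i 1) p - ?I (\<lambda>x. G x $ i) (\<lambda>y. vec_upd y i 0) p) - ?I g (\<lambda>y. y) p"
      using int[OF continuous_on_component[OF Gc] cu] int[OF g continuous_on_id] by simp
    finally show ?thesis by simp
  qed
  have "0 = (\<integral>p. ((\<Sum>i\<in>UNIV. ?I (\<lambda>x. G x $ i) (\<lambda>y. vec_upd y i 1) p - ?I (\<lambda>x. G x $ i) (\<lambda>y. vec_upd y i 0) p) - ?I g (\<lambda>y. y) p) \<partial>lborel)"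
    by (simp only: eq) simp
  also have "\<dots> = (\<Sum>i\<in>UNIV. (\<integral>x. G x $ i \<partial>lborel) - (\<integral>x. G x $ i \<partial>lborel)) - (\<integral>x. g x \<partial>lborel)"
    using integral_translate_average(1,2)[OF Gi m] integral_translate_average(1,2)[OF gi, of "\<lambda>y. y"] by simp
  finally show ?thesis by simp
qed

section \<open>Uniqueness of square-integrable fields with given divergence and curl\<close>

text \<open>The Japanese bracket, a smooth substitute for \<open>norm x\<close> that stays away from
  0.\<close>

definition bracket :: "'a::real_inner \<Rightarrow> real" where
  "bracket x = sqrt (1 + x \<bullet> x)"

lemma bracket_ge_1: "1 \<le> bracket x"
  by (simp add: bracket_def)

lemma bracket_pos [simp]: "0 < bracket x"
  using bracket_ge_1[of x] by linarith

lemma bracket_neq_0 [simp]: "bracket x \<noteq> 0"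
  using bracket_pos[of x] by linarith

lemma bracket_square: "(bracket x)\<^sup>2 = 1 + (norm x)\<^sup>2"
  by (simp add: bracket_def power2_norm_eq_inner)

lemma norm_le_bracket: "norm x \<le> bracket x"
  by (rule power2_le_imp_le) (simp_all add: bracket_square less_imp_le)

lemma continuous_bracket: "continuous_on A bracket"
  unfolding bracket_def[abs_def] by (intro continuous_intros)

lemma bracket_measurable [measurable]: "(bracket :: 'a::euclidean_space \<Rightarrow> real) \<in> borel_measurable borel"
  by (rule borel_measurable_continuous_onI[OF continuous_bracket])

text \<open>The exponent is a third of the power 4 in \<open>integrable_bracket4\<close>, one share
  for each coordinate, and 4/3 still exceeds 1.\<close>

lemma integrable_powr_abs:
  "integrable lborel (\<lambda>t::real. (1 + \<bar>t\<bar>) powr (-4/3))"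
proof -
  let ?f = "\<lambda>t::real. (1 + t) powr (-4/3)"
  let ?g = "\<lambda>t::real. ?f t * indicator {0..} t"
  have "(\<integral>\<^sup>+t. ennreal (?f t) * indicator {0..} t \<partial>lborel) = ennreal (0 - (- 3 * (1 + 0) powr (-1/3)))"
  proof (rule nn_integral_FTC_atLeast)
    show "((\<lambda>t::real. - 3 * (1 + t) powr (-1/3)) \<longlongrightarrow> 0) at_top" by real_asymp
    show "DERIV (\<lambda>t. - 3 * (1 + t) powr (-1/3)) t :> ?f t" if "0 \<le> t" for t
      using that by (auto intro!: derivative_eq_intros simp: field_simps)
  qed auto
  then have g: "integrable lborel ?g"
    by (intro integrableI_nonneg) (auto simp: ennreal_mult ennreal_indicator)
  have "integrable lborel (\<lambda>t. ?g t + ?g (0 + (-1) *\<^sub>R t))"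
    by (intro Bochner_Integration.integrable_add g lborel_integrable_affine[OF g]) simp
  then show ?thesis
    by (rule Bochner_Integration.integrable_bound) (auto intro!: AE_I2 split: split_indicator)
qed

text \<open>Instead of polar coordinates, each coordinate satisfies \<open>(1 + \<bar>x \<bullet>
  b\<bar>)\<^sup>2 \<le> 2 * (bracket x)\<^sup>2\<close>. Raising this to the power -2/3 and
  multiplying over the three coordinates bounds the function by a product of integrable functions of
  one variable.\<close>

lemma integrable_bracket4: "integrable lborel (\<lambda>x::real^3. 1 / bracket x ^ 4)"
proof (rule Bochner_Integration.integrable_bound)
  show "integrable lborel (\<lambda>x::real^3. 4 * (\<Prod>b\<in>Basis. (1 + \<bar>x \<bullet> b\<bar>) powr (-4/3)))"
    by (intro integrable_mult_right integrable_lborel_prod_Basis integrable_powr_abs)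
  show "(\<lambda>x::real^3. 1 / bracket x ^ 4) \<in> borel_measurable lborel" by measurable
  show "AE x in lborel. norm (1 / bracket (x::real^3) ^ 4) \<le> norm (4 * (\<Prod>b\<in>Basis. (1 + \<bar>x \<bullet> b\<bar>) powr (-4/3)))"
  proof (intro AE_I2)
    fix x :: "real^3"
    let ?w = "bracket x"
    have "1 / ?w ^ 4 = 4 * (2 * ?w\<^sup>2) powr (-2)"
      by (simp add: powr_minus powr_numeral field_simps flip: power_mult)
    also have "(2 * ?w\<^sup>2) powr (-2) = ((2 * ?w\<^sup>2) powr (-2/3)) ^ 3"
      by (subst powr_power) simp_all
    also have "\<dots> = (\<Prod>b\<in>(Basis :: (real^3) set). (2 * ?w\<^sup>2) powr (-2/3))" by simp
    also have "\<dots> \<le> (\<Prod>b\<in>Basis. (1 + \<bar>x \<bullet> b\<bar>) powr (-4/3))"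
    proof (intro prod_mono conjI)
      fix b :: "real^3" assume b: "b \<in> Basis"
      have "(x \<bullet> b)\<^sup>2 \<le> (norm x)\<^sup>2"
        using power_mono[OF Basis_le_norm[OF b, of x], of 2] by simp
      moreover have "(1 + \<bar>x \<bullet> b\<bar>)\<^sup>2 \<le> 2 * (1 + (x \<bullet> b)\<^sup>2)"
        using zero_le_power2[of "1 - \<bar>x \<bullet> b\<bar>"] by (simp add: power2_eq_square algebra_simps)
      ultimately have "(1 + \<bar>x \<bullet> b\<bar>)\<^sup>2 \<le> 2 * ?w\<^sup>2" by (simp add: bracket_square)
      then have "(2 * ?w\<^sup>2) powr (-2/3) \<le> ((1 + \<bar>x \<bullet> b\<bar>)\<^sup>2) powr (-2/3)"
        by (intro powr_mono2') auto
      also have "\<dots> = (1 + \<bar>x \<bullet> b\<bar>) powr (-4/3)"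
        by (simp add: powr_powr flip: powr_numeral)
      finally show "(2 * ?w\<^sup>2) powr (-2/3) \<le> (1 + \<bar>x \<bullet> b\<bar>) powr (-4/3)" .
    qed simp
    finally show "norm (1 / ?w ^ 4) \<le> norm (4 * (\<Prod>b\<in>Basis. (1 + \<bar>x \<bullet> b\<bar>) powr (-4/3)))"
      by (simp add: prod_nonneg)
  qed
qed

lemma integrable_bracket5: "integrable lborel (\<lambda>x::real^3. 1 / bracket x ^ 5)"
  by (rule Bochner_Integration.integrable_bound[OF integrable_bracket4])
     (auto intro!: AE_I2 divide_left_mono power_increasing simp: bracket_ge_1 less_imp_le)

section \<open>The regularised Newton potential and its derivatives\<close>

lemma bracket_has_derivative:
  "(bracket has_derivative (\<lambda>h. (x \<bullet> h) / bracket x)) (at x)"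
proof -
  have "1 + x \<bullet> x > 0" by (simp add: add_pos_nonneg)
  then show ?thesis
    unfolding bracket_def[abs_def]
    by (auto intro!: derivative_eq_intros simp: inner_commute field_simps fun_eq_iff)
qed

text \<open>The gradient of \<open>1 / bracket\<close>; \<open>newton_hess x\<close> below is the
  Hessian at \<open>x\<close>, applied to a vector.\<close>

definition newton_grad :: "'a::real_inner \<Rightarrow> 'a" where
  "newton_grad x = - (1 / bracket x ^ 3) *\<^sub>R x"

definition newton_hess :: "'a::real_inner \<Rightarrow> 'a \<Rightarrow> 'a" where
  "newton_hess x h = (3 * (x \<bullet> h) / bracket x ^ 5) *\<^sub>R x - (1 / bracket x ^ 3) *\<^sub>R h"

lemma newton_grad_has_derivative: "(newton_grad has_derivative newton_hess x) (at (x::'a::real_inner))"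
proof -
  have "DERIV (\<lambda>t. inverse (t ^ 3)) (bracket x) :> - 3 / bracket x ^ 4"
    by (auto intro!: derivative_eq_intros simp: field_simps less_imp_neq[OF bracket_pos, symmetric] eval_nat_numeral)
  from DERIV_compose_FDERIV[OF this bracket_has_derivative]
  have "((\<lambda>x. inverse (bracket x ^ 3)) has_derivative (\<lambda>h. (x \<bullet> h) / bracket x * (- 3 / bracket x ^ 4))) (at x)" .
  from has_derivative_scaleR[OF this has_derivative_ident]
  have "((\<lambda>x::'a. - (inverse (bracket x ^ 3) *\<^sub>R x)) has_derivative
     (\<lambda>h. - (inverse (bracket x ^ 3) *\<^sub>R h + ((x \<bullet> h) / bracket x * (- 3 / bracket x ^ 4)) *\<^sub>R x))) (at x)"
    by (rule has_derivative_minus)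
  moreover have "newton_grad = (\<lambda>x::'a. - (inverse (bracket x ^ 3) *\<^sub>R x))"
    by (simp add: fun_eq_iff newton_grad_def divide_inverse)
  moreover have "- (inverse (bracket x ^ 3) *\<^sub>R h + ((x \<bullet> h) / bracket x * (- 3 / bracket x ^ 4)) *\<^sub>R x)
      = newton_hess x h" for h
    by (simp add: newton_hess_def divide_inverse eval_nat_numeral mult_ac)
  ultimately show ?thesis by (simp only:)
qed

lemma norm_newton_grad: "norm (newton_grad x) \<le> 1 / bracket x ^ 2"
proof -
  have "norm (newton_grad x) = norm x / bracket x ^ 3"
    by (simp add: newton_grad_def less_imp_le)
  also have "\<dots> \<le> bracket x / bracket x ^ 3"
    by (intro divide_right_mono norm_le_bracket) (simp add: less_imp_le)
  also have "\<dots> = 1 / bracket x ^ 2" by (simp add: eval_nat_numeral)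
  finally show ?thesis .
qed

text \<open>In dimension three the contributions of order \<open>1 / bracket x ^ 3\<close> cancel
  once \<open>x \<bullet> x\<close> is replaced by \<open>bracket x ^ 2 - 1\<close>. What is left is
  a smoothed, integrable version of the point mass that is the Laplacian of the Newton
  potential.\<close>

lemma newton_laplace: "(\<Sum>j\<in>UNIV. newton_hess x (axis j 1) $ j) = - 3 / bracket (x::real^3) ^ 5"
proof -
  have b: "bracket x \<noteq> 0" using bracket_pos[of x] by linarith
  have "(\<Sum>j\<in>UNIV. newton_hess x (axis j 1) $ j) = (\<Sum>j\<in>UNIV. 3 / bracket x ^ 5 * (x $ j * x $ j) - 1 / bracket x ^ 3)"
    by (simp add: newton_hess_def inner_axis algebra_simps)
  also have "\<dots> = 3 / bracket x ^ 5 * (x \<bullet> x) - 3 / bracket x ^ 3"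
    by (simp only: sum_subtractf sum_distrib_left[symmetric] inner_vec_def inner_real_def sum_constant) simp
  also have "x \<bullet> x = bracket x ^ 2 - 1" by (simp add: bracket_square power2_norm_eq_inner)
  also have "3 / bracket x ^ 5 * (bracket x ^ 2 - 1) - 3 / bracket x ^ 3 = - 3 / bracket x ^ 5"
    using b by (simp add: divide_simps eval_nat_numeral)
  finally show ?thesis .
qed

text \<open>With \<open>\<psi> = 1 / bracket\<close> and \<open>p = \<nabla>\<psi>\<close>, the divergence of \<open>D\<^sub>i p + p\<^sub>i D - (D \<bullet> p) e\<^sub>i\<close> reduces, for a
  divergence-free and curl-free \<open>D\<close>, to \<open>D\<^sub>i \<Delta>\<psi> = - 3 D\<^sub>i / bracket\<^sup>5\<close>.\<close>

lemma harmonic_field_mean_zero: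
  fixes D :: "real^3 \<Rightarrow> real^3"
  assumes D: "\<And>x. (D has_derivative D' x) (at x)"
    and dv: "\<And>x. (\<Sum>j\<in>UNIV. D' x (axis j 1) $ j) = 0"
    and cl: "\<And>x i j. D' x (axis i 1) $ j = D' x (axis j 1) $ i"
    and L2: "integrable lborel (\<lambda>x. (norm (D x))\<^sup>2)"
  shows "integrable lborel (\<lambda>x. D x $ i / bracket x ^ 5)"
    and "(\<integral>x. D x $ i / bracket x ^ 5 \<partial>lborel) = 0"
proof -
  let ?p = "newton_grad :: real^3 \<Rightarrow> real^3" and ?H = "newton_hess :: real^3 \<Rightarrow> real^3 \<Rightarrow> real^3"
  have Dc: "continuous_on UNIV D"
    using D by (intro continuous_at_imp_continuous_on ballI has_derivative_continuous)
  have pc: "continuous_on UNIV ?p"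
    using newton_grad_has_derivative by (intro continuous_at_imp_continuous_on ballI has_derivative_continuous)
  \<comment> \<open>A row of the Maxwell stress tensor, polarised in the two gradient-like fields
    \<open>D\<close> and \<open>?p\<close>. It contains no derivative of \<open>D\<close>, so its
    integrability follows from that of \<open>(norm (D x))\<^sup>2\<close> and
    \<open>1 / bracket x ^ 4\<close>.\<close>
  define G where "G x = D x $ i *\<^sub>R ?p x + ?p x $ i *\<^sub>R D x - (D x \<bullet> ?p x) *\<^sub>R axis i 1" for x
  define A where "A x h = (D x $ i *\<^sub>R ?H x h + D' x h $ i *\<^sub>R ?p x) + (?p x $ i *\<^sub>R D' x h + ?H x h $ i *\<^sub>R D x)
     - (D x \<bullet> ?H x h + D' x h \<bullet> ?p x) *\<^sub>R axis i 1" for x h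
  have GA: "(G has_derivative A x) (at x)" for x
  proof -
    note dp = newton_grad_has_derivative[of x]
    have c: "((\<lambda>x. f x $ i) has_derivative (\<lambda>h. f' h $ i)) (at x)" if "(f has_derivative f') (at x)"
      for f f' :: "real^3 \<Rightarrow> real^3"
      by (rule bounded_linear.has_derivative[OF bounded_linear_vec_nth that])
    show ?thesis
      unfolding G_def[abs_def] A_def[abs_def]
      by (intro has_derivative_diff has_derivative_add has_derivative_scaleR has_derivative_inner c D dp
        has_derivative_scaleR_left)
  qed
  \<comment> \<open>The matrix of \<open>D' x\<close> is symmetric by \<open>cl\<close> and that of
    \<open>newton_hess x\<close> as a Hessian. Hence two of the four product terms add up to the
    derivative of \<open>D \<bullet> ?p\<close> along axis \<open>i\<close>, which the last part of
    \<open>G\<close> subtracts, and a third is a multiple of the divergence of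
    \<open>D\<close>.\<close>
  have tr: "(\<Sum>j\<in>UNIV. A x (axis j 1) $ j) = - 3 * (D x $ i / bracket x ^ 5)" for x
  proof -
    have ax: "(axis i 1 :: real^3) $ j = (if j = i then 1 else 0)" for j
      by (simp add: axis_def)
    have Hs: "?H x (axis j 1) $ i = ?H x (axis i 1) $ j" for j
      unfolding newton_hess_def vector_minus_component vector_scaleR_component inner_axis by (simp add: axis_def)
    have "(\<Sum>j\<in>UNIV. A x (axis j 1) $ j) = (\<Sum>j\<in>UNIV. D x $ i * ?H x (axis j 1) $ j + D' x (axis i 1) $ j * ?p x $ j
       + ?p x $ i * D' x (axis j 1) $ j + ?H x (axis i 1) $ j * D x $ j
       - (if j = i then D x \<bullet> ?H x (axis i 1) + D' x (axis i 1) \<bullet> ?p x else 0))"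
      by (intro sum.cong refl) (simp add: A_def Hs[symmetric] cl[of x i] ax)
    also have "\<dots> = D x $ i * (\<Sum>j\<in>UNIV. ?H x (axis j 1) $ j) + D' x (axis i 1) \<bullet> ?p x
       + ?p x $ i * (\<Sum>j\<in>UNIV. D' x (axis j 1) $ j) + D x \<bullet> ?H x (axis i 1)
       - (D x \<bullet> ?H x (axis i 1) + D' x (axis i 1) \<bullet> ?p x)"
      by (simp add: sum.distrib sum_subtractf sum_distrib_left inner_vec_def mult.commute)
    also have "\<dots> = - 3 * (D x $ i / bracket x ^ 5)"
      by (simp add: dv newton_laplace)
    finally show ?thesis .
  qed
  have dom: "integrable lborel (\<lambda>x. 3 / 2 * ((norm (D x))\<^sup>2 + 1 / bracket x ^ 4))"
    by (intro integrable_mult_right Bochner_Integration.integrable_add L2 integrable_bracket4)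
  have young: "norm (D x) * (1 / bracket x ^ 2) \<le> 1 / 2 * ((norm (D x))\<^sup>2 + 1 / bracket x ^ 4)" for x
    using sum_squares_bound[of "norm (D x)" "1 / bracket x ^ 2"]
    by (simp add: power_one_over mult.commute flip: power_mult)
  have Gi: "integrable lborel (\<lambda>x. G x $ j)" for j
  proof (rule Bochner_Integration.integrable_bound[OF dom])
    show "(\<lambda>x. G x $ j) \<in> borel_measurable lborel"
      unfolding measurable_lborel2 G_def
      by (rule borel_measurable_continuous_onI) (intro continuous_intros Dc pc)
    show "AE x in lborel. norm (G x $ j) \<le> norm (3 / 2 * ((norm (D x))\<^sup>2 + 1 / bracket x ^ 4))"
    proof (intro AE_I2)
      fix x
      have "norm (G x $ j) \<le> norm (G x)" by (simp add: component_le_norm_cart)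
      also have "\<dots> \<le> norm (D x $ i *\<^sub>R ?p x) + norm (?p x $ i *\<^sub>R D x) + norm ((D x \<bullet> ?p x) *\<^sub>R (axis i 1 :: real^3))"
        unfolding G_def by (intro order_trans[OF norm_triangle_ineq4] add_right_mono norm_triangle_ineq)
      also have "\<dots> \<le> norm (D x) * norm (?p x) + norm (?p x) * norm (D x) + norm (D x) * norm (?p x)"
        by (simp only: norm_scaleR norm_axis_1 mult_1_right real_norm_def)
          (intro add_mono mult_right_mono component_le_norm_cart Cauchy_Schwarz_ineq2 norm_ge_zero)
      also have "\<dots> = 3 * (norm (D x) * norm (?p x))" by simp
      also have "\<dots> \<le> 3 * (norm (D x) * (1 / bracket x ^ 2))"
        by (intro mult_left_mono norm_newton_grad) auto
      also have "\<dots> \<le> norm (3 / 2 * ((norm (D x))\<^sup>2 + 1 / bracket x ^ 4))"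
        using young[of x] by simp
      finally show "norm (G x $ j) \<le> norm (3 / 2 * ((norm (D x))\<^sup>2 + 1 / bracket x ^ 4))" .
    qed
  qed
  \<comment> \<open>Although \<open>D'\<close> may be discontinuous, the divergence of
    \<open>G\<close> is continuous, as \<open>divergence_integral_zero\<close> demands: by
    \<open>tr\<close> it involves only the values of \<open>D\<close>.\<close>
  have gc: "continuous_on UNIV (\<lambda>x. D x $ i / bracket x ^ 5)"
    by (intro continuous_intros Dc continuous_bracket) simp
  show gi: "integrable lborel (\<lambda>x. D x $ i / bracket x ^ 5)"
  proof (rule Bochner_Integration.integrable_bound[OF dom])
    show "(\<lambda>x. D x $ i / bracket x ^ 5) \<in> borel_measurable lborel"
      unfolding measurable_lborel2 by (rule borel_measurable_continuous_onI[OF gc])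
    show "AE x in lborel. norm (D x $ i / bracket x ^ 5) \<le> norm (3 / 2 * ((norm (D x))\<^sup>2 + 1 / bracket x ^ 4))"
    proof (intro AE_I2)
      fix x
      have "norm (D x $ i / bracket x ^ 5) = \<bar>D x $ i\<bar> * (1 / bracket x ^ 5)"
        by (simp add: less_imp_le)
      also have "\<dots> \<le> norm (D x) * (1 / bracket x ^ 2)"
        by (intro mult_mono component_le_norm_cart divide_left_mono power_increasing) (auto simp: bracket_ge_1 less_imp_le)
      also have "\<dots> \<le> norm (3 / 2 * ((norm (D x))\<^sup>2 + 1 / bracket x ^ 4))"
      proof -
        have "0 \<le> (norm (D x))\<^sup>2 + 1 / bracket x ^ 4" by (simp add: less_imp_le)
        with young[of x] show ?thesis unfolding real_norm_def by linarith
      qed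
      finally show "norm (D x $ i / bracket x ^ 5) \<le> norm (3 / 2 * ((norm (D x))\<^sup>2 + 1 / bracket x ^ 4))" .
    qed
  qed
  have "(\<integral>x. - 3 * (D x $ i / bracket x ^ 5) \<partial>lborel) = 0"
    by (rule divergence_integral_zero[OF GA tr _ Gi]) (intro continuous_intros gc integrable_mult_right gi)+
  then show "(\<integral>x. D x $ i / bracket x ^ 5 \<partial>lborel) = 0"
    unfolding integral_mult_right_zero by simp
qed

text \<open>The rescaled field \<open>z \<mapsto> D (y + e z)\<close> satisfies the same hypotheses,
  so its weighted mean vanishes for every \<open>e > 0\<close>. As \<open>e\<close> tends to 0 this
  mean tends to \<open>c\<close> times \<open>D y\<close>: continuity of \<open>D\<close> controls
  the points \<open>y + e z\<close> near \<open>y\<close>, the square integral controls the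
  others.\<close>

lemma harmonic_field_zero:
  fixes D :: "real^3 \<Rightarrow> real^3"
  assumes D: "\<And>x. (D has_derivative D' x) (at x)"
    and dv: "\<And>x. (\<Sum>j\<in>UNIV. D' x (axis j 1) $ j) = 0"
    and cl: "\<And>x i j. D' x (axis i 1) $ j = D' x (axis j 1) $ i"
    and L2: "integrable lborel (\<lambda>x. (norm (D x))\<^sup>2)"
  shows "D y = 0"
proof -
  define c where "c = (\<integral>x. 1 / bracket (x::real^3) ^ 5 \<partial>lborel)"
  define c4 where "c4 = (\<integral>x. 1 / bracket (x::real^3) ^ 4 \<partial>lborel)"
  define E where "E = (\<integral>x. (norm (D x))\<^sup>2 \<partial>lborel)"
  have c: "c > 0"
  proof -
    have "c \<noteq> 0"
      unfolding c_def
      by (subst integral_nonneg_eq_0_iff_AE[OF integrable_bracket5])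
         (auto simp: less_imp_le eventually_False ae_filter_eq_bot_iff)
    moreover have "c \<ge> 0" unfolding c_def by (auto intro!: integral_nonneg_AE simp: less_imp_le)
    ultimately show ?thesis by simp
  qed
  have "D y $ i = 0" for i
  proof -
    have scaled: "integrable lborel (\<lambda>z. D (y + e *\<^sub>R z) $ i / bracket z ^ 5)"
        "(\<integral>z. D (y + e *\<^sub>R z) $ i / bracket z ^ 5 \<partial>lborel) = 0"
        "integrable lborel (\<lambda>z. (norm (D (y + e *\<^sub>R z)))\<^sup>2)"
        "(\<integral>z. (norm (D (y + e *\<^sub>R z)))\<^sup>2 \<partial>lborel) = E / e ^ 3" if e: "e > 0" for e
    proof -
      interpret L: bounded_linear "D' x" for x using D by (rule has_derivative_bounded_linear)
      show int: "integrable lborel (\<lambda>z. (norm (D (y + e *\<^sub>R z)))\<^sup>2)"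
        using lborel_integrable_affine[OF L2, of e y] e by simp
      show "(\<integral>z. (norm (D (y + e *\<^sub>R z)))\<^sup>2 \<partial>lborel) = E / e ^ 3"
        using lborel_integral_affine[of e "\<lambda>x. (norm (D x))\<^sup>2" y] e by (simp add: E_def)
      have der: "((\<lambda>z. D (y + e *\<^sub>R z)) has_derivative (\<lambda>h. D' (y + e *\<^sub>R z) (e *\<^sub>R h))) (at z)" for z
        by (rule has_derivative_compose[OF _ D]) (auto intro!: derivative_eq_intros)
      show "integrable lborel (\<lambda>z. D (y + e *\<^sub>R z) $ i / bracket z ^ 5)"
        "(\<integral>z. D (y + e *\<^sub>R z) $ i / bracket z ^ 5 \<partial>lborel) = 0"
        using int dv cl by (auto intro!: harmonic_field_mean_zero[OF der] simp: L.scaleR sum_distrib_left[symmetric])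
    qed
    have main: "c * \<bar>D y $ i\<bar> \<le> \<eta> * c" if \<eta>: "\<eta> > 0" for \<eta>
    proof -
      have "isCont D y" using D by (rule has_derivative_continuous)
      then obtain d where d: "d > 0" "\<And>x. dist x y < d \<Longrightarrow> dist (D x) (D y) < \<eta>"
        using \<eta> unfolding continuous_at_eps_delta by (metis dist_commute)
      have bnd: "c * \<bar>D y $ i\<bar> \<le> \<eta> * c + (\<bar>D y $ i\<bar> * (e / d) * c4 + (e / 2 * E + e\<^sup>2 / (2 * d ^ 6) * c4))" if e: "e > 0" for e
      proof -
        have pt: "\<bar>D y $ i / bracket z ^ 5 - D (y + e *\<^sub>R z) $ i / bracket z ^ 5\<bar>
          \<le> \<eta> * (1 / bracket z ^ 5) + (\<bar>D y $ i\<bar> * (e / d) * (1 / bracket z ^ 4)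
            + (e ^ 4 / 2 * (norm (D (y + e *\<^sub>R z)))\<^sup>2 + e\<^sup>2 / (2 * d ^ 6) * (1 / bracket z ^ 4)))" (is "?L \<le> ?A + (?B + (?C1 + ?C2))") for z
        proof -
          have nn: "0 \<le> ?A" "0 \<le> ?B" "0 \<le> ?C1" "0 \<le> ?C2"
            using e d \<eta> by (auto intro!: mult_nonneg_nonneg simp: less_imp_le)
          show ?thesis
          proof (cases "dist (y + e *\<^sub>R z) y < d")
            case True
            have "\<bar>D y $ i - D (y + e *\<^sub>R z) $ i\<bar> \<le> \<eta>"
              using d(2)[OF True] component_le_norm_cart[of "D (y + e *\<^sub>R z) - D y" i] by (simp add: dist_norm)
            then have "?L \<le> ?A"
              by (simp add: divide_right_mono less_imp_le flip: diff_divide_distrib)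
            with nn show ?thesis by linarith
          next
            case False
            then have "d \<le> e * norm z" using e by (simp add: dist_norm)
            also have "\<dots> \<le> e * bracket z" using e by (intro mult_left_mono norm_le_bracket) simp
            finally have "d \<le> e * bracket z" .
            then have w: "1 / bracket z \<le> e / d"
              using d e by (simp add: field_simps)
            define v where "v = 1 / bracket z"
            have v: "0 < v" "v \<le> e / d" using w by (simp_all add: v_def)
            have vp: "a / bracket z ^ n = a * v ^ n" for a n by (simp add: v_def power_one_over)
            have "\<bar>D y $ i\<bar> * v ^ 5 \<le> \<bar>D y $ i\<bar> * (e / d) * v ^ 4"
            proof -
              have "v ^ 5 = v * v ^ 4" by (simp add: eval_nat_numeral)
              also have "\<dots> \<le> (e / d) * v ^ 4" using v by (intro mult_right_mono) auto
              finally show ?thesis by (simp only: mult.assoc mult_left_mono abs_ge_zero)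
            qed
            moreover have "\<bar>D (y + e *\<^sub>R z) $ i\<bar> * v ^ 5 \<le> e ^ 4 / 2 * (norm (D (y + e *\<^sub>R z)))\<^sup>2 + e\<^sup>2 / (2 * d ^ 6) * v ^ 4"
            proof -
              define N where "N = norm (D (y + e *\<^sub>R z))"
              have "\<bar>D (y + e *\<^sub>R z) $ i\<bar> * v ^ 5 \<le> N * v ^ 5"
                using v by (simp add: N_def component_le_norm_cart mult_right_mono)
              \<comment> \<open>Young's inequality with weight \<open>e\<^sup>2\<close>. The factor
                \<open>e ^ 4\<close> gained on the square of \<open>N\<close> exceeds the loss
                \<open>e ^ 3\<close> of the rescaled square integral. In the other square,
                \<open>v ^ 10 / e ^ 4\<close>, six powers of \<open>v\<close> are exchanged for
                \<open>(e / d) ^ 6\<close>, leaving a positive power of \<open>e\<close> and the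
                integrable \<open>v ^ 4\<close>.\<close>
              also have "N * v ^ 5 = (e\<^sup>2 * N) * (v ^ 5 / e\<^sup>2)" using e by simp
              also have "\<dots> \<le> (e\<^sup>2 * N)\<^sup>2 / 2 + (v ^ 5 / e\<^sup>2)\<^sup>2 / 2"
                using sum_squares_bound[of "e\<^sup>2 * N" "v ^ 5 / e\<^sup>2"] by linarith
              also have "(v ^ 5 / e\<^sup>2)\<^sup>2 = v ^ 6 * v ^ 4 / e ^ 4"
                by (simp add: power_divide flip: power_mult power_add)
              also have "\<dots> \<le> (e / d) ^ 6 * v ^ 4 / e ^ 4"
                using v e by (intro divide_right_mono mult_right_mono power_mono) auto
              also have "(e / d) ^ 6 * v ^ 4 / e ^ 4 = e\<^sup>2 / d ^ 6 * v ^ 4"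
                using e d by (simp add: field_simps eval_nat_numeral)
              finally show ?thesis by (simp add: N_def power_mult_distrib field_simps)
            qed
            moreover have "?L \<le> \<bar>D y $ i\<bar> * v ^ 5 + \<bar>D (y + e *\<^sub>R z) $ i\<bar> * v ^ 5"
              unfolding vp using v abs_triangle_ineq4[of "D y $ i * v ^ 5" "D (y + e *\<^sub>R z) $ i * v ^ 5"]
              by (simp add: abs_mult)
            ultimately show ?thesis using nn unfolding vp by linarith
          qed
        qed
        have ints: "integrable lborel (\<lambda>z::real^3. D y $ i / bracket z ^ 5)"
          using integrable_mult_right[OF integrable_bracket5, of "D y $ i"] by simp
        have "c * \<bar>D y $ i\<bar> = \<bar>\<integral>z. D y $ i / bracket (z::real^3) ^ 5 \<partial>lborel\<bar>"
        proof -
          have "(\<integral>z. D y $ i / bracket (z::real^3) ^ 5 \<partial>lborel) = (\<integral>z. D y $ i * (1 / bracket (z::real^3) ^ 5) \<partial>lborel)"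
            by simp
          also have "\<dots> = D y $ i * c" unfolding c_def by (rule integral_mult_right_zero)
          finally show ?thesis using c by (simp add: abs_mult)
        qed
        also have "\<dots> = \<bar>\<integral>z. D y $ i / bracket z ^ 5 - D (y + e *\<^sub>R z) $ i / bracket z ^ 5 \<partial>lborel\<bar>"
          using ints scaled[OF e] by (subst Bochner_Integration.integral_diff) auto
        also have "\<dots> \<le> (\<integral>z. \<eta> * (1 / bracket (z::real^3) ^ 5) + (\<bar>D y $ i\<bar> * (e / d) * (1 / bracket z ^ 4)
            + (e ^ 4 / 2 * (norm (D (y + e *\<^sub>R z)))\<^sup>2 + e\<^sup>2 / (2 * d ^ 6) * (1 / bracket z ^ 4))) \<partial>lborel)"
          using pt by (intro Bochner_Integration.integral_abs_bound_integral Bochner_Integration.integrable_diff ints scaled(1)[OF e]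
            Bochner_Integration.integrable_add integrable_mult_right integrable_bracket5 integrable_bracket4 scaled(3)[OF e])
        also have "\<dots> = \<eta> * c + (\<bar>D y $ i\<bar> * (e / d) * c4 + (e ^ 4 / 2 * (E / e ^ 3) + e\<^sup>2 / (2 * d ^ 6) * c4))"
          unfolding c_def c4_def scaled(4)[OF e, symmetric] integral_mult_right_zero[symmetric]
          by (simp only: Bochner_Integration.integral_add Bochner_Integration.integrable_add integrable_mult_right integrable_bracket5 integrable_bracket4 scaled(3)[OF e])
        also have "e ^ 4 / 2 * (E / e ^ 3) = e / 2 * E" using e by (simp add: eval_nat_numeral)
        finally show ?thesis .
      qed
      have "((\<lambda>e. \<eta> * c + (\<bar>D y $ i\<bar> * (e / d) * c4 + (e / 2 * E + e\<^sup>2 / (2 * d ^ 6) * c4))) \<longlongrightarrow>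
          \<eta> * c + (\<bar>D y $ i\<bar> * (0 / d) * c4 + (0 / 2 * E + 0\<^sup>2 / (2 * d ^ 6) * c4))) (at_right 0)"
        using d by (intro tendsto_intros) auto
      then have "c * \<bar>D y $ i\<bar> \<le> \<eta> * c + (\<bar>D y $ i\<bar> * (0 / d) * c4 + (0 / 2 * E + 0\<^sup>2 / (2 * d ^ 6) * c4))"
      proof (rule tendsto_lowerbound)
        show "\<forall>\<^sub>F e in at_right 0. c * \<bar>D y $ i\<bar> \<le> \<eta> * c + (\<bar>D y $ i\<bar> * (e / d) * c4 + (e / 2 * E + e\<^sup>2 / (2 * d ^ 6) * c4))"
          by (rule eventually_mono[OF eventually_at_right_less]) (rule bnd)
      qed simp
      then show ?thesis by simp
    qed
    have "\<bar>D y $ i\<bar> \<le> \<eta>" if "\<eta> > 0" for \<eta>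
      using main[OF that] c by (simp add: mult.commute)
    then show "D y $ i = 0" using field_le_epsilon[of "\<bar>D y $ i\<bar>" 0] by simp
  qed
  then show ?thesis by (simp add: vec_eq_iff)
qed

section \<open>Partial derivatives and uniqueness for the div-curl system\<close>

lemma pd_has_derivative:
  assumes "(f has_derivative f') (at x)"
  shows "pd f i x = f' (axis i 1)"
proof -
  interpret bounded_linear f' using assms by (rule has_derivative_bounded_linear)
  have "((\<lambda>t. f (x + t *\<^sub>R axis i 1)) has_derivative (\<lambda>t. f' (t *\<^sub>R axis i 1))) (at 0)"
    by (rule has_derivative_compose[where g=f]) (auto intro!: derivative_eq_intros assms)
  then have "DERIV (\<lambda>t. f (x + t *\<^sub>R axis i 1)) 0 :> f' (axis i 1)"
    by (simp add: has_field_derivative_def scaleR mult_commute_abs)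
  then show ?thesis unfolding pd_def by (rule DERIV_imp_deriv)
qed

lemma pd_component_has_derivative:
  assumes "(F has_derivative F') (at x)"
  shows "pd (\<lambda>y. F y $ j) i x = F' (axis i 1) $ j"
  by (rule pd_has_derivative[OF bounded_linear.has_derivative[OF bounded_linear_vec_nth assms]])

theorem div_curl_unique:
  fixes F H :: "real^3 \<Rightarrow> real^3"
  assumes "\<And>x. F differentiable (at x)" "\<And>x. H differentiable (at x)"
    and "integrable lborel (\<lambda>x. (norm (F x))\<^sup>2)" "integrable lborel (\<lambda>x. (norm (H x))\<^sup>2)"
    and dv: "\<And>x. divg F x = divg H x" and cl: "\<And>x. curl F x = curl H x"
  shows "F = H"
proof
  fix y
  obtain F' where F': "\<And>x. (F has_derivative F' x) (at x)"
    using assms(1) unfolding differentiable_def by metis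
  obtain H' where H': "\<And>x. (H has_derivative H' x) (at x)"
    using assms(2) unfolding differentiable_def by metis
  note pd = pd_component_has_derivative[OF F'] pd_component_has_derivative[OF H']
  have Fc: "continuous_on UNIV F" "continuous_on UNIV H"
    using F' H' by (auto intro!: continuous_at_imp_continuous_on has_derivative_continuous)
  then have m[measurable]: "F \<in> borel_measurable borel" "H \<in> borel_measurable borel"
    by (auto intro: borel_measurable_continuous_onI)
  have "F y - H y = 0"
  proof (rule harmonic_field_zero[where D="\<lambda>x. F x - H x" and D'="\<lambda>x h. F' x h - H' x h"])
    show "((\<lambda>x. F x - H x) has_derivative (\<lambda>h. F' x h - H' x h)) (at x)" for x
      by (intro has_derivative_diff F' H')
    show "(\<Sum>j\<in>UNIV. (F' x (axis j 1) - H' x (axis j 1)) $ j) = 0" for x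
      using dv[of x] by (simp add: divg_def pd sum_subtractf)
    \<comment> \<open>The components of the curl are the entries of the antisymmetric part of the
      derivative, so equal curls make the derivative of the difference symmetric.\<close>
    show "(F' x (axis i 1) - H' x (axis i 1)) $ j = (F' x (axis j 1) - H' x (axis j 1)) $ i" for x i j
    proof -
      have "\<forall>i j. (F' x (axis i 1) - H' x (axis i 1)) $ j = (F' x (axis j 1) - H' x (axis j 1)) $ i"
        using cl[of x] unfolding curl_def pd by (simp add: forall_3 vec_eq_iff)
      then show ?thesis by blast
    qed
    show "integrable lborel (\<lambda>x. (norm (F x - H x))\<^sup>2)"
    proof (rule Bochner_Integration.integrable_bound)
      show "integrable lborel (\<lambda>x. 2 * ((norm (F x))\<^sup>2 + (norm (H x))\<^sup>2))" using assms(3,4) by auto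
      show "AE x in lborel. norm ((norm (F x - H x))\<^sup>2) \<le> norm (2 * ((norm (F x))\<^sup>2 + (norm (H x))\<^sup>2))"
      proof (intro AE_I2)
        fix x
        have "(norm (F x - H x))\<^sup>2 \<le> (norm (F x) + norm (H x))\<^sup>2"
          by (intro power_mono norm_triangle_ineq4) simp
        also have "\<dots> \<le> 2 * ((norm (F x))\<^sup>2 + (norm (H x))\<^sup>2)"
          using zero_le_power2[of "norm (F x) - norm (H x)"] by (simp add: power2_diff power2_sum)
        finally show "norm ((norm (F x - H x))\<^sup>2) \<le> norm (2 * ((norm (F x))\<^sup>2 + (norm (H x))\<^sup>2))" by simp
      qed
    qed measurable
  qed
  then show "F y = H y" by simp
qed

section \<open>Pauli matrices on product states\<close>

lemma spin_idx_Suc: "spin_idx (Suc P) = (\<lambda>(s, a). s @ [a]) ` (spin_idx P \<times> UNIV)"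
proof (intro set_eqI iffI)
  fix t assume "t \<in> spin_idx (Suc P)"
  then obtain s a where "t = s @ [a]" "length s = P"
    by (auto simp: spin_idx_def length_Suc_conv_rev)
  then show "t \<in> (\<lambda>(s, a). s @ [a]) ` (spin_idx P \<times> UNIV)"
    by (auto simp: spin_idx_def)
qed (auto simp: spin_idx_def)

text \<open>Distributivity: expanding a product of sums yields one term for each list of choices.
  The induction splits off the last entry, which leaves the positions of the others
  unchanged.\<close>

lemma sum_prod_spin_idx:
  fixes f :: "nat \<Rightarrow> bool \<Rightarrow> 'a::comm_semiring_1"
  shows "(\<Sum>s\<in>spin_idx P. \<Prod>l<P. f l (s ! l)) = (\<Prod>l<P. \<Sum>a\<in>UNIV. f l a)"
proof (induction P)
  case 0
  show ?case by (simp add: spin_idx_def)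
next
  case (Suc P)
  have inj: "inj_on (\<lambda>(s, a). s @ [a]) (spin_idx P \<times> UNIV)" by (auto simp: inj_on_def)
  have "(\<Sum>s\<in>spin_idx (Suc P). \<Prod>l<Suc P. f l (s ! l))
      = (\<Sum>(s, a)\<in>spin_idx P \<times> UNIV. (\<Prod>l<P. f l (s ! l)) * f P a)"
    unfolding spin_idx_Suc sum.reindex[OF inj]
    by (intro sum.cong refl) (auto simp: nth_append spin_idx_def mult.commute intro!: arg_cong2[where f="(*)"] prod.cong)
  also have "\<dots> = (\<Sum>s\<in>spin_idx P. \<Prod>l<P. f l (s ! l)) * (\<Sum>a\<in>UNIV. f P a)"
    by (simp add: sum_product sum.cartesian_product)
  finally show ?case by (simp add: Suc.IH mult.commute)
qed

lemma spin_inner_tensor: "spin_inner P (tensor P U) (tensor P V) = (\<Prod>l<P. inner2 (U l) (V l))"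
  unfolding spin_inner_def tensor_def inner2_def
  by (subst sum_prod_spin_idx[symmetric]) (simp add: prod.distrib)

lemma pauli_at_tensor:
  assumes "l < P" "length s = P"
  shows "pauli_at m l (tensor P V) s = tensor P (V(l := pauli m (V l))) s"
proof -
  have split: "(\<Prod>j<P. g j) = g l * (\<Prod>j\<in>{..<P} - {l}. g j)" for g :: "nat \<Rightarrow> complex"
    using assms(1) by (subst prod.remove[of _ l]) auto
  have "pauli_at m l (tensor P V) s = (\<Sum>b\<in>UNIV. pmat m (s ! l) b * (V l b * (\<Prod>j\<in>{..<P} - {l}. V j (s ! j))))"
    unfolding pauli_at_def tensor_def split using assms by (intro sum.cong refl) (auto intro!: prod.cong)
  also have "\<dots> = tensor P (V(l := pauli m (V l))) s"
    unfolding tensor_def split by (simp add: pauli_def sum_distrib_right mult.assoc)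
  finally show ?thesis .
qed

text \<open>Updating an entry preserves the length, so agreement on lists of length \<open>P\<close>
  is enough. This allows \<open>pauli_at_tensor\<close>, an identity on such lists only, to be
  applied twice.\<close>

lemma pauli_at_cong:
  assumes "\<And>s. length s = P \<Longrightarrow> X s = Y s" "length s = P"
  shows "pauli_at m l X s = pauli_at m l Y s"
  unfolding pauli_at_def using assms by simp

lemma pauli_at_pauli_at_tensor:
  assumes "l < P" "l' < P" "length s = P"
  shows "pauli_at m l (pauli_at m' l' (tensor P V)) s
    = tensor P ((V(l' := pauli m' (V l')))(l := pauli m ((V(l' := pauli m' (V l'))) l))) s"
  using pauli_at_cong[OF pauli_at_tensor[OF assms(2)] assms(3)] pauli_at_tensor[OF assms(1,3)] by simp

lemma pauli_pauli: "pauli m (pauli m v) = v"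
proof
  fix a
  show "pauli m (pauli m v) a = v a"
    using exhaust_3[of m] by (cases a) (auto simp: pauli_def pmat_def UNIV_bool)
qed

text \<open>The Pauli matrices are Hermitian, so their expectations are real and the
  \<open>Re\<close> in \<open>spinvec\<close> loses nothing.\<close>

lemma inner2_pauli_real: "inner2 (pauli m v) v = of_real (spinvec v $ m)"
proof -
  have "Im (inner2 (pauli m v) v) = 0"
    using exhaust_3[of m] by (auto simp: inner2_def pauli_def pmat_def UNIV_bool)
  then show ?thesis by (simp add: spinvec_def complex_eq_iff)
qed

lemma inner2_self:
  assumes "(\<Sum>a\<in>UNIV. (cmod (v a))\<^sup>2) = 1"
  shows "inner2 v v = 1"
proof -
  have "inner2 v v = of_real (\<Sum>a\<in>UNIV. (cmod (v a))\<^sup>2)"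
    unfolding inner2_def of_real_sum complex_norm_square ..
  then show ?thesis by (simp add: assms)
qed

text \<open>The spin vector of a pure state lies on the Bloch sphere: its squared length is the
  fourth power of the norm of \<open>v\<close>, a polynomial identity in the four real coordinates
  of \<open>v\<close>.\<close>

lemma norm_spinvec:
  assumes "(\<Sum>a\<in>UNIV. (cmod (v a))\<^sup>2) = 1"
  shows "(\<Sum>m\<in>UNIV. spinvec v $ m * spinvec v $ m) = 1"
proof -
  define a b c d where "a = Re (v False)" and "b = Im (v False)" and "c = Re (v True)" and "d = Im (v True)"
  have "(\<Sum>m\<in>UNIV. spinvec v $ m * spinvec v $ m) = (a\<^sup>2 + b\<^sup>2 + c\<^sup>2 + d\<^sup>2)\<^sup>2"
    unfolding sum_3 a_def b_def c_def d_def
    by (simp add: spinvec_def inner2_def pauli_def pmat_def UNIV_bool power2_eq_square) algebra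
  also have "a\<^sup>2 + b\<^sup>2 + c\<^sup>2 + d\<^sup>2 = 1"
    using assms by (simp add: UNIV_bool cmod_power2 a_def b_def c_def d_def)
  finally show ?thesis by simp
qed

text \<open>At different sites the matrices act on different tensor factors, and the expectation
  factorises. At one site \<open>pauli_pauli\<close> applies. Different matrices at one site are
  left out, since they will be multiplied by the off-diagonal entries of
  \<open>transv_kernel_integral\<close>, which vanish.\<close>

lemma spin_inner_pauli_pauli:
  assumes V: "\<forall>l<P. (\<Sum>a\<in>UNIV. (cmod (V l a))\<^sup>2) = 1" and l: "l < P" "l' < P"
  shows "l \<noteq> l' \<Longrightarrow> spin_inner P (pauli_at m l (pauli_at m' l' (tensor P V))) (tensor P V)
      = of_real (spinvec (V l) $ m * spinvec (V l') $ m')"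
    and "l = l' \<Longrightarrow> m = m' \<Longrightarrow> spin_inner P (pauli_at m l (pauli_at m' l' (tensor P V))) (tensor P V) = 1"
proof -
  define U where "U = (V(l' := pauli m' (V l')))(l := pauli m ((V(l' := pauli m' (V l'))) l))"
  have "spin_inner P (pauli_at m l (pauli_at m' l' (tensor P V))) (tensor P V) = spin_inner P (tensor P U) (tensor P V)"
    unfolding spin_inner_def U_def
    by (intro sum.cong refl) (simp add: spin_idx_def pauli_at_pauli_at_tensor[OF l])
  also have "\<dots> = (\<Prod>j<P. inner2 (U j) (V j))" by (rule spin_inner_tensor)
  finally have eq: "spin_inner P (pauli_at m l (pauli_at m' l' (tensor P V))) (tensor P V) = (\<Prod>j<P. inner2 (U j) (V j))" .
  have one: "inner2 (U j) (V j) = 1" if "j < P" "j \<noteq> l" "j \<noteq> l'" for j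
    using that V by (simp add: U_def inner2_self)
  {
    assume ne: "l \<noteq> l'"
    have "(\<Prod>j<P. inner2 (U j) (V j)) = (\<Prod>j\<in>{l, l'}. inner2 (U j) (V j))"
      using l one by (intro prod.mono_neutral_right) auto
    also have "\<dots> = of_real (spinvec (V l) $ m * spinvec (V l') $ m')"
      using ne by (simp add: U_def inner2_pauli_real)
    finally show "spin_inner P (pauli_at m l (pauli_at m' l' (tensor P V))) (tensor P V)
      = of_real (spinvec (V l) $ m * spinvec (V l') $ m')" using eq by simp
  }
  {
    assume "l = l'" "m = m'"
    then have "inner2 (U j) (V j) = 1" if "j < P" for j
      using that V one[of j] by (cases "j = l") (auto simp: U_def pauli_pauli inner2_self)
    then show "spin_inner P (pauli_at m l (pauli_at m' l' (tensor P V))) (tensor P V) = 1"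
      unfolding eq by simp
  }
qed

section \<open>The solution in Fourier space\<close>

text \<open>The quadratic bound gives the pointwise limit of the difference quotients; the linear
  bound gives a dominating function that requires only a first moment of \<open>F\<close>.\<close>

lemma iexp_remainder: "cmod (iexp t - 1 - \<i> * of_real t) \<le> t\<^sup>2 / 2" "cmod (iexp t - 1 - \<i> * of_real t) \<le> 2 * \<bar>t\<bar>"
  using iexp_approx1[of t 1] iexp_approx2[of t 1]
  by (simp_all add: lessThan_Suc_atMost[symmetric] numeral_2_eq_2 diff_diff_eq power2_eq_square)

lemma fourier_has_derivative:
  fixes F :: "'a::euclidean_space \<Rightarrow> complex"
  assumes F: "integrable lborel F" and F1: "integrable lborel (\<lambda>k. norm k * norm (F k))"
  shows "(fourier F has_derivative (\<lambda>h. fourier (\<lambda>k. \<i> * of_real (k \<bullet> h) * F k) x)) (at x)"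
proof -
  have Fm[measurable]: "F \<in> borel_measurable borel" using F by auto
  have Fh: "integrable lborel (\<lambda>k. \<i> * of_real (k \<bullet> h) * F k)" for h
  proof (rule Bochner_Integration.integrable_bound)
    show "integrable lborel (\<lambda>k. norm h * (norm k * norm (F k)))" using F1 by (rule integrable_mult_right)
    show "AE k in lborel. norm (\<i> * of_real (k \<bullet> h) * F k) \<le> norm (norm h * (norm k * norm (F k)))"
    proof (intro AE_I2)
      fix k
      have "\<bar>k \<bullet> h\<bar> * norm (F k) \<le> norm k * norm h * norm (F k)"
        by (intro mult_right_mono Cauchy_Schwarz_ineq2) simp
      then show "norm (\<i> * of_real (k \<bullet> h) * F k) \<le> norm (norm h * (norm k * norm (F k)))"
        by (simp add: norm_mult mult_ac)
    qed
  qed measurable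
  note fi = fourier_integrable[OF F] fourier_integrable[OF Fh]
  have lin: "linear (\<lambda>h. fourier (\<lambda>k. \<i> * of_real (k \<bullet> h) * F k) x)"
  proof (rule linearI)
    fix h h' :: 'a and r :: real
    have "fourier (\<lambda>k. \<i> * of_real (k \<bullet> (h + h')) * F k) x
      = (\<integral>k. \<i> * of_real (k \<bullet> h) * F k * iexp (k \<bullet> x) + \<i> * of_real (k \<bullet> h') * F k * iexp (k \<bullet> x) \<partial>lborel)"
      unfolding fourier_def by (simp add: inner_add_right algebra_simps)
    then show "fourier (\<lambda>k. \<i> * of_real (k \<bullet> (h + h')) * F k) x
      = fourier (\<lambda>k. \<i> * of_real (k \<bullet> h) * F k) x + fourier (\<lambda>k. \<i> * of_real (k \<bullet> h') * F k) x"
      unfolding fourier_def by (simp only: Bochner_Integration.integral_add[OF fi(2) fi(2)])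
    have "fourier (\<lambda>k. \<i> * of_real (k \<bullet> (r *\<^sub>R h)) * F k) x
      = (\<integral>k. r *\<^sub>R (\<i> * of_real (k \<bullet> h) * F k * iexp (k \<bullet> x)) \<partial>lborel)"
      unfolding fourier_def by (simp add: scaleR_conv_of_real mult_ac)
    then show "fourier (\<lambda>k. \<i> * of_real (k \<bullet> (r *\<^sub>R h)) * F k) x = r *\<^sub>R fourier (\<lambda>k. \<i> * of_real (k \<bullet> h) * F k) x"
      unfolding fourier_def by (simp only: integral_scaleR_right)
  qed
  \<comment> \<open>The limit is taken along sequences of increments so that dominated convergence
    applies. All directions are treated at once, which gives the full derivative and not just
    partial ones.\<close>
  have lim: "(\<lambda>n. norm (fourier F (x + X n) - fourier F x - fourier (\<lambda>k. \<i> * of_real (k \<bullet> X n) * F k) x) / norm (X n)) \<longlonglongrightarrow> 0"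
    if X: "X \<longlonglongrightarrow> 0" and X0: "\<And>n. X n \<noteq> 0" for X
  proof -
    let ?R = "\<lambda>n k. (1 / norm (X n)) *\<^sub>R (F k * iexp (k \<bullet> x) * (iexp (k \<bullet> X n) - 1 - \<i> * of_real (k \<bullet> X n)))"
    have "fourier F (x + X n) - fourier F x - fourier (\<lambda>k. \<i> * of_real (k \<bullet> X n) * F k) x
       = (\<integral>k. F k * iexp (k \<bullet> x) * (iexp (k \<bullet> X n) - 1 - \<i> * of_real (k \<bullet> X n)) \<partial>lborel)" for n
      unfolding fourier_def
      by (subst Bochner_Integration.integral_diff[symmetric], (intro Bochner_Integration.integrable_diff fi)+)+
         (simp add: algebra_simps inner_add_right exp_add)
    then have eq: "norm (fourier F (x + X n) - fourier F x - fourier (\<lambda>k. \<i> * of_real (k \<bullet> X n) * F k) x) / norm (X n)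
       = norm (\<integral>k. ?R n k \<partial>lborel)" for n
      by (simp only: integral_scaleR_right) simp
    have "(\<lambda>n. \<integral>k. ?R n k \<partial>lborel) \<longlonglongrightarrow> (\<integral>k. 0 \<partial>(lborel :: 'a measure))"
    proof (rule integral_dominated_convergence[where w="\<lambda>k. 2 * (norm k * norm (F k))"])
      show "integrable lborel (\<lambda>k. 2 * (norm k * norm (F k)))" using F1 by (rule integrable_mult_right)
      have cs: "\<bar>k \<bullet> X n\<bar> \<le> norm k * norm (X n)" for k n by (rule Cauchy_Schwarz_ineq2)
      have nR: "norm (?R n k) = norm (F k) * cmod (iexp (k \<bullet> X n) - 1 - \<i> * of_real (k \<bullet> X n)) / norm (X n)" for n k
        by (simp add: norm_mult)
      show "AE k in lborel. norm (?R n k) \<le> 2 * (norm k * norm (F k))" for n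
      proof (intro AE_I2)
        fix k
        have "cmod (iexp (k \<bullet> X n) - 1 - \<i> * of_real (k \<bullet> X n)) \<le> 2 * (norm k * norm (X n))"
          using iexp_remainder(2)[of "k \<bullet> X n"] cs[of k n] by linarith
        then have "norm (F k) * cmod (iexp (k \<bullet> X n) - 1 - \<i> * of_real (k \<bullet> X n)) \<le> norm (F k) * (2 * (norm k * norm (X n)))"
          by (rule mult_left_mono) simp
        then show "norm (?R n k) \<le> 2 * (norm k * norm (F k))"
          unfolding nR using X0[of n] by (simp add: divide_le_eq mult_ac)
      qed
      show "AE k in lborel. (\<lambda>n. ?R n k) \<longlonglongrightarrow> 0"
      proof (intro AE_I2)
        fix k
        have "(\<lambda>n. norm (F k) * (norm k)\<^sup>2 / 2 * norm (X n)) \<longlonglongrightarrow> norm (F k) * (norm k)\<^sup>2 / 2 * norm (0::'a)"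
          by (intro tendsto_intros X)
        then have "(\<lambda>n. norm (F k) * (norm k)\<^sup>2 / 2 * norm (X n)) \<longlonglongrightarrow> 0" by simp
        then show "(\<lambda>n. ?R n k) \<longlonglongrightarrow> 0"
        proof (rule Lim_null_comparison[rotated], intro always_eventually allI)
          fix n
          have "(k \<bullet> X n)\<^sup>2 \<le> (norm k * norm (X n))\<^sup>2"
            using power_mono[OF cs[of k n], of 2] by simp
          then have "cmod (iexp (k \<bullet> X n) - 1 - \<i> * of_real (k \<bullet> X n)) \<le> (norm k)\<^sup>2 / 2 * (norm (X n))\<^sup>2"
            using iexp_remainder(1)[of "k \<bullet> X n"] by (simp add: power_mult_distrib)
          then have "norm (F k) * cmod (iexp (k \<bullet> X n) - 1 - \<i> * of_real (k \<bullet> X n)) \<le> norm (F k) * ((norm k)\<^sup>2 / 2 * (norm (X n))\<^sup>2)"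
            by (rule mult_left_mono) simp
          then show "norm (?R n k) \<le> norm (F k) * (norm k)\<^sup>2 / 2 * norm (X n)"
            unfolding nR using X0[of n] by (simp add: divide_le_eq power2_eq_square mult_ac)
        qed
      qed
    qed measurable
    then show ?thesis unfolding eq Bochner_Integration.integral_zero by (rule tendsto_norm_zero)
  qed
  show ?thesis
    unfolding has_derivative_at
  proof
    show "bounded_linear (\<lambda>h. fourier (\<lambda>k. \<i> * of_real (k \<bullet> h) * F k) x)"
      using lin by (simp add: linear_conv_bounded_linear)
    show "(\<lambda>h. norm (fourier F (x + h) - fourier F x - fourier (\<lambda>k. \<i> * of_real (k \<bullet> h) * F k) x) / norm h) \<midarrow>0\<rightarrow> 0"
      unfolding tendsto_at_iff_sequentially comp_def using lim by simp
  qed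
qed

lemma fourier_shift: "fourier F (x - a) = fourier (\<lambda>k. F k * iexp (- (k \<bullet> a))) x"
proof -
  have "iexp (k \<bullet> (x - a)) = iexp (- (k \<bullet> a)) * iexp (k \<bullet> x)" for k
    by (simp add: inner_diff_right algebra_simps flip: exp_add)
  then show ?thesis unfolding fourier_def by (simp only: mult.assoc)
qed

lemma fourier_real:
  assumes "\<And>k. cnj (F k) = F (- k)"
  shows "Im (fourier F x) = 0"
proof -
  have "cnj (fourier F x) = (\<integral>k. F (- k) * iexp ((- k) \<bullet> x) \<partial>lborel)"
    unfolding fourier_def by (simp add: exp_cnj assms flip: Bochner_Integration.integral_cnj)
  also have "\<dots> = fourier F x"
    unfolding fourier_def by (subst (2) lborel_integral_affine[of "-1" _ 0]) simp_all
  finally show ?thesis by (simp add: complex_eq_iff)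
qed

text \<open>The preimage of a box is a box with the same side lengths up to order, and the measure
  is determined by its values on boxes.\<close>

lemma lborel_distr_signed_permutation:
  fixes s :: "'n::finite \<Rightarrow> real" and \<pi> :: "'n \<Rightarrow> 'n"
  assumes \<pi>: "bij \<pi>" and s: "\<And>i. s i = 1 \<or> s i = -1"
  shows "distr lborel borel (\<lambda>x::real^'n. \<chi> i. s i * x $ \<pi> i) = lborel" (is "distr _ _ ?T = _")
proof (rule lborel_eqI[symmetric])
  fix l u :: "real^'n" assume le: "\<And>b. b \<in> Basis \<Longrightarrow> l \<bullet> b \<le> u \<bullet> b"
  have [measurable]: "?T \<in> borel_measurable borel"
    by (intro borel_measurable_continuous_onI continuous_intros)
  have lu: "l $ i \<le> u $ i" for i using le[of "axis i 1"] by (simp add: inner_axis)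
  have prd: "(\<Prod>b\<in>Basis. (v::real^'n) \<bullet> b) = (\<Prod>i\<in>UNIV. v $ i)" for v
    by (simp add: Basis_vec_def prod.UNION_disjoint axis_eq_axis inner_axis UNION_singleton_eq_range prod.reindex inj_on_def)
  define \<rho> where "\<rho> = inv \<pi>"
  have \<rho>: "\<pi> (\<rho> j) = j" "\<rho> (\<pi> j) = j" "bij \<rho>" for j
    using \<pi> by (auto simp: \<rho>_def bij_is_surj surj_f_inv_f bij_is_inj bij_imp_bij_inv)
  \<comment> \<open>A sign -1 reflects the interval of that coordinate, so its end points are
    negated and exchanged.\<close>
  define l' u' :: "real^'n" where "l' = (\<chi> j. if s (\<rho> j) = 1 then l $ \<rho> j else - u $ \<rho> j)"
    and "u' = (\<chi> j. if s (\<rho> j) = 1 then u $ \<rho> j else - l $ \<rho> j)"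
  have comp: "l $ i < s i * x $ \<pi> i \<and> s i * x $ \<pi> i < u $ i \<longleftrightarrow> l' $ \<pi> i < x $ \<pi> i \<and> x $ \<pi> i < u' $ \<pi> i" for x i
    using s[of i] by (auto simp: l'_def u'_def \<rho>)
  have "?T -` box l u = box l' u'"
  proof (intro set_eqI)
    fix x
    have "x \<in> ?T -` box l u \<longleftrightarrow> (\<forall>i. l' $ \<pi> i < x $ \<pi> i \<and> x $ \<pi> i < u' $ \<pi> i)"
      by (simp add: mem_box_cart comp)
    also have "\<dots> \<longleftrightarrow> x \<in> box l' u'"
      unfolding mem_box_cart by (metis \<rho>(1))
    finally show "x \<in> ?T -` box l u \<longleftrightarrow> x \<in> box l' u'" .
  qed
  moreover have "l' \<bullet> b \<le> u' \<bullet> b" if "b \<in> Basis" for b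
    using that lu by (auto simp: Basis_vec_def inner_axis l'_def u'_def)
  moreover have "(\<Prod>i\<in>UNIV. (u' - l') $ i) = (\<Prod>i\<in>UNIV. (u - l) $ i)"
  proof -
    have "(\<Prod>i\<in>UNIV. (u' - l') $ i) = (\<Prod>i\<in>UNIV. (u - l) $ \<rho> i)"
      by (intro prod.cong refl) (auto simp: l'_def u'_def)
    also have "\<dots> = (\<Prod>i\<in>UNIV. (u - l) $ i)"
      using prod.reindex_bij_betw[OF \<rho>(3), of "\<lambda>i. (u - l) $ i"] by simp
    finally show ?thesis .
  qed
  ultimately show "emeasure (distr lborel borel ?T) (box l u) = (\<Prod>b\<in>Basis. (u - l) \<bullet> b)"
    by (simp add: emeasure_distr prd)
qed simp

lemma integral_signed_permutation:
  fixes f :: "real^'n \<Rightarrow> 'b::{banach, second_countable_topology}" and \<pi> :: "'n \<Rightarrow> 'n"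
  assumes "f \<in> borel_measurable borel" "bij \<pi>" "\<And>i. s i = 1 \<or> s i = -1"
  shows "(\<integral>x. f (\<chi> i. s i * x $ \<pi> i) \<partial>lborel) = (\<integral>x. f x \<partial>lborel)"
proof -
  have m: "(\<lambda>x::real^'n. \<chi> i. s i * x $ \<pi> i) \<in> borel_measurable borel"
    by (intro borel_measurable_continuous_onI continuous_intros)
  show ?thesis
    using integral_distr[of "\<lambda>x::real^'n. \<chi> i. s i * x $ \<pi> i" lborel borel f] m assms(1)
    by (simp add: lborel_distr_signed_permutation[OF assms(2,3)])
qed

section \<open>Decay and integrability of Schwartz profiles\<close>

lemma schwartz_continuous: "schwartz \<phi> \<Longrightarrow> continuous_on UNIV \<phi>"
  unfolding schwartz_def
  by (auto intro!: continuous_at_imp_continuous_on differentiable_imp_continuous_within dest!: spec[of _ "0::nat"])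

text \<open>Expanding \<open>(1 + (norm k)\<^sup>2) ^ 3\<close> reduces the claim to the seminorms
  with powers 0, 2, 4 and 6, whence the coefficients 1, 3, 3, 1. The power 6 covers both
  \<open>integrable_bracket4\<close> and an extra factor \<open>norm k\<close>.\<close>

lemma schwartz_decay:
  assumes "schwartz \<phi>"
  obtains C where "\<And>k::'a::euclidean_space. \<bar>\<phi> (norm k)\<bar> \<le> C / bracket k ^ 6"
proof -
  have "\<exists>C. \<forall>t. \<bar>t\<bar> ^ p * \<bar>\<phi> t\<bar> \<le> C" for p
    using assms unfolding schwartz_def by (metis funpow_0)
  then obtain C where C: "\<And>p t. \<bar>t\<bar> ^ p * \<bar>\<phi> t\<bar> \<le> C p" by metis
  have "\<bar>\<phi> (norm k)\<bar> \<le> (C 0 + 3 * C 2 + 3 * C 4 + C 6) / bracket k ^ 6" for k :: 'a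
  proof -
    have "bracket k ^ 6 = (1 + (norm k)\<^sup>2) ^ 3"
      by (simp flip: bracket_square power_mult)
    also have "\<dots> * \<bar>\<phi> (norm k)\<bar> = norm k ^ 0 * \<bar>\<phi> (norm k)\<bar> + 3 * (norm k ^ 2 * \<bar>\<phi> (norm k)\<bar>)
       + 3 * (norm k ^ 4 * \<bar>\<phi> (norm k)\<bar>) + norm k ^ 6 * \<bar>\<phi> (norm k)\<bar>"
      by (simp add: eval_nat_numeral algebra_simps)
    also have "\<dots> \<le> C 0 + 3 * C 2 + 3 * C 4 + C 6"
      using C[of "norm k" 0] C[where t="norm k"] by (intro add_mono mult_left_mono) simp_all
    finally show ?thesis by (simp add: pos_le_divide_eq mult.commute)
  qed
  then show thesis by (rule that)
qed

text \<open>Supplies together the hypotheses of \<open>fourier_has_derivative\<close> and the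
  integrability and boundedness asked for by \<open>plancherel\<close>.\<close>

lemma integrable_schwartz_bound:
  fixes F :: "real^3 \<Rightarrow> complex"
  assumes \<phi>: "schwartz \<phi>" and F[measurable]: "F \<in> borel_measurable borel"
    and bd: "\<And>k. norm (F k) \<le> K * \<bar>\<phi> (norm k)\<bar>" and K: "0 \<le> K"
  shows "integrable lborel F" "integrable lborel (\<lambda>k. norm k * norm (F k))" "\<exists>B. \<forall>k. norm (F k) \<le> B"
proof -
  obtain C where C: "\<And>k::real^3. \<bar>\<phi> (norm k)\<bar> \<le> C / bracket k ^ 6" using schwartz_decay[OF \<phi>] by blast
  have C0: "0 \<le> C" using order_trans[OF abs_ge_zero C[of 0]] by (simp add: bracket_def)
  have b: "norm (F k) \<le> K * C / bracket k ^ 6" for k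
    using order_trans[OF bd mult_left_mono[OF C K]] by simp
  have pw: "a / bracket k ^ 6 \<le> a / bracket k ^ n" if "n \<le> 6" "0 \<le> a" for a k n
    using that bracket_ge_1[of k] by (intro divide_left_mono power_increasing mult_pos_pos) auto
  have KC: "0 \<le> K * C" using K C0 by simp
  have i4: "integrable lborel (\<lambda>k::real^3. K * C * (1 / bracket k ^ 4))"
    by (rule integrable_mult_right[OF integrable_bracket4])
  show "integrable lborel F"
  proof (rule Bochner_Integration.integrable_bound[OF i4])
    show "AE k in lborel. norm (F k) \<le> norm (K * C * (1 / bracket k ^ 4))"
      using order_trans[OF b pw[of 4, OF _ KC]] unfolding real_norm_def
      by (intro AE_I2 order_trans[OF _ abs_ge_self]) simp
  qed measurable
  show "integrable lborel (\<lambda>k. norm k * norm (F k))"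
  proof (rule Bochner_Integration.integrable_bound[OF i4])
    show "AE k in lborel. norm (norm k * norm (F k)) \<le> norm (K * C * (1 / bracket k ^ 4))"
    proof (intro AE_I2)
      fix k
      have "norm k * norm (F k) \<le> bracket k * (K * C / bracket k ^ 6)"
        by (intro mult_mono norm_le_bracket b) (auto simp: less_imp_le)
      also have "\<dots> = K * C / bracket k ^ 5" by (simp add: eval_nat_numeral)
      also have "\<dots> \<le> K * C / bracket k ^ 4"
        using bracket_ge_1[of k] KC by (intro divide_left_mono power_increasing mult_pos_pos) auto
      also have "\<dots> \<le> norm (K * C * (1 / bracket k ^ 4))" unfolding real_norm_def by (intro order_trans[OF _ abs_ge_self]) simp
      finally show "norm (norm k * norm (F k)) \<le> norm (K * C * (1 / bracket k ^ 4))" by simp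
    qed
  qed measurable
  show "\<exists>B. \<forall>k. norm (F k) \<le> B"
    using order_trans[OF b pw[of 0, OF _ KC]] by auto
qed

lemma fourier_pd:
  fixes F :: "real^3 \<Rightarrow> complex"
  assumes "integrable lborel F" "integrable lborel (\<lambda>k. norm k * norm (F k))"
  shows "pd (\<lambda>x. c * Re (fourier F x)) i x = c * Re (fourier (\<lambda>k. \<i> * of_real (k $ i) * F k) x)"
    and "(\<lambda>x. c * Re (fourier F x)) differentiable (at x)"
proof -
  have d: "((\<lambda>x. c * Re (fourier F x)) has_derivative (\<lambda>h. c * Re (fourier (\<lambda>k. \<i> * of_real (k \<bullet> h) * F k) x))) (at x)"
    by (intro has_derivative_mult_right bounded_linear.has_derivative[OF bounded_linear_Re] fourier_has_derivative assms)
  show "pd (\<lambda>x. c * Re (fourier F x)) i x = c * Re (fourier (\<lambda>k. \<i> * of_real (k $ i) * F k) x)"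
    using pd_has_derivative[OF d, of i] by (simp add: inner_axis)
  show "(\<lambda>x. c * Re (fourier F x)) differentiable (at x)" using d by (auto simp: differentiable_def)
qed

text \<open>The projection onto the orthogonal complement of \<open>k\<close>, with value 0 at \<open>k = 0\<close>.\<close>

definition transv :: "real^3 \<Rightarrow> real^3 \<Rightarrow> real^3" where
  "transv k S = (1 / (k \<bullet> k)) *\<^sub>R ((k \<bullet> k) *\<^sub>R S - (k \<bullet> S) *\<^sub>R k)"

text \<open>The matrix entries of the projection \<open>transv k\<close>. The projection is
  symmetric and idempotent, so they are also the coefficients of the form in
  \<open>transv_kernel_sum\<close>.\<close>

definition transv_kernel :: "3 \<Rightarrow> 3 \<Rightarrow> real^3 \<Rightarrow> real" where
  "transv_kernel m m' k = ((if m = m' then k \<bullet> k else 0) - k $ m * k $ m') / (k \<bullet> k)"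

lemma transv_inner: "transv k S \<bullet> transv k U = ((k \<bullet> k) * (S \<bullet> U) - (k \<bullet> S) * (k \<bullet> U)) / (k \<bullet> k)"
  by (cases "k = 0") (simp_all add: transv_def inner_diff_left inner_diff_right inner_commute field_simps)

lemma inner_transv: "k \<bullet> transv k S = 0"
  by (simp add: transv_def inner_diff_right)

lemma norm_transv: "norm (transv k S) \<le> norm S"
proof (rule power2_le_imp_le)
  have "(norm (transv k S))\<^sup>2 = ((k \<bullet> k) * (S \<bullet> S) - (k \<bullet> S) * (k \<bullet> S)) / (k \<bullet> k)"
    by (simp only: power2_norm_eq_inner transv_inner)
  also have "\<dots> \<le> (k \<bullet> k) * (S \<bullet> S) / (k \<bullet> k)" by (intro divide_right_mono) auto
  also have "\<dots> \<le> (norm S)\<^sup>2" by (simp add: power2_norm_eq_inner)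
  finally show "(norm (transv k S))\<^sup>2 \<le> (norm S)\<^sup>2" .
qed simp

text \<open>\<open>transv k S\<close> differs from \<open>S\<close> by a multiple of
  \<open>k\<close>, which the cross product with \<open>k\<close> annihilates; at
  \<open>k = 0\<close> both sides vanish.\<close>

lemma transv_curl: "k $ a * transv k S $ b - k $ b * transv k S $ a = k $ a * S $ b - k $ b * S $ a"
  by (cases "k = 0") (simp_all add: transv_def field_simps)

lemma transv_kernel_sum:
  "transv k S \<bullet> transv k U = (\<Sum>m\<in>UNIV. \<Sum>m'\<in>UNIV. S $ m * U $ m' * transv_kernel m m' k)"
proof -
  have "(\<Sum>m\<in>UNIV. \<Sum>m'\<in>UNIV. S $ m * U $ m' * transv_kernel m m' k)
     = (\<Sum>m\<in>UNIV. \<Sum>m'\<in>UNIV. (if m = m' then S $ m * U $ m * (k \<bullet> k) else 0) - (k $ m * S $ m) * (k $ m' * U $ m')) / (k \<bullet> k)"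
    unfolding sum_divide_distrib by (intro sum.cong refl) (auto simp: transv_kernel_def algebra_simps)
  also have "\<dots> = transv k S \<bullet> transv k U"
    unfolding transv_inner
    by (simp add: sum_subtractf sum_product[symmetric] inner_vec_def sum_distrib_right[symmetric] mult.commute)
  finally show ?thesis ..
qed

lemma transv_kernel_bound: "\<bar>transv_kernel m m' k\<bar> \<le> 1"
proof -
  have "transv_kernel m m' k = transv k (axis m 1) \<bullet> transv k (axis m' 1)"
    unfolding transv_inner transv_kernel_def inner_axis_axis inner_axis[of k] by auto
  also have "\<bar>\<dots>\<bar> \<le> norm (transv k (axis m 1)) * norm (transv k (axis m' 1))"
    by (rule Cauchy_Schwarz_ineq2)
  also have "\<dots> \<le> 1 * 1"
    using norm_transv[of k "axis _ 1"] by (intro mult_mono) (simp_all add: norm_axis_1)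
  finally show ?thesis by simp
qed

lemma transv_measurable [measurable]: "(\<lambda>k. transv k S) \<in> borel_measurable borel"
  unfolding transv_def by measurable

lemma transv_kernel_measurable [measurable]: "transv_kernel m m' \<in> borel_measurable borel"
proof -
  have [measurable]: "(\<lambda>k::real^3. k $ i) \<in> borel_measurable borel" for i
    by (intro borel_measurable_continuous_onI continuous_intros)
  show ?thesis unfolding transv_kernel_def[abs_def] by measurable
qed

lemma isCont_transv: "k \<noteq> 0 \<Longrightarrow> isCont (\<lambda>k. transv k S) k"
  unfolding transv_def by (intro continuous_intros) auto

section \<open>The classical field as a Fourier integral, and its energy\<close>

lemma schwartz_measurable: "schwartz \<phi> \<Longrightarrow> \<phi> \<in> borel_measurable borel"
  by (intro borel_measurable_continuous_onI schwartz_continuous)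

text \<open>After the Fourier transform the curl equation prescribes the cross product of
  \<open>k\<close> with the field, and the divergence equation makes the field orthogonal to
  \<open>k\<close>. Since the current is the curl of a sum of translates of
  \<open>rho \<phi>\<close> times the vectors \<open>M l *\<^sub>R S l\<close>, the solution is the
  transverse part of the transform of that sum.\<close>

definition Bhat :: "(real \<Rightarrow> real) \<Rightarrow> nat \<Rightarrow> (nat \<Rightarrow> real^3) \<Rightarrow> (nat \<Rightarrow> real) \<Rightarrow> (nat \<Rightarrow> real^3) \<Rightarrow> 3 \<Rightarrow> real^3 \<Rightarrow> complex" where
  "Bhat \<phi> P xs M S j k = of_real (\<phi> (norm k)) * (\<Sum>l<P. of_real (M l * transv k (S l) $ j) * iexp (- (k \<bullet> xs l)))"

text \<open>\<open>Re\<close> only changes the type here: the transforms are real by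
  \<open>Bhat_cnj\<close> and \<open>fourier_real\<close>.\<close>

definition Bsol :: "(real \<Rightarrow> real) \<Rightarrow> nat \<Rightarrow> (nat \<Rightarrow> real^3) \<Rightarrow> (nat \<Rightarrow> real) \<Rightarrow> (nat \<Rightarrow> real^3) \<Rightarrow> real^3 \<Rightarrow> real^3" where
  "Bsol \<phi> P xs M S x = (\<chi> j. (2 * pi) powr (-3) * Re (fourier (Bhat \<phi> P xs M S j) x))"

lemma Bhat_bounds:
  assumes "schwartz \<phi>"
  shows "integrable lborel (Bhat \<phi> P xs M S j)" "integrable lborel (\<lambda>k. norm k * norm (Bhat \<phi> P xs M S j k))"
    "\<exists>B. \<forall>k. norm (Bhat \<phi> P xs M S j k) \<le> B"
proof -
  note [measurable] = schwartz_measurable[OF assms]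
  have [measurable]: "(\<lambda>k. transv k (S l) $ j) \<in> borel_measurable borel" for l
    by (rule measurable_compose[OF transv_measurable]) (intro borel_measurable_continuous_onI continuous_intros)
  have m: "Bhat \<phi> P xs M S j \<in> borel_measurable borel"
    unfolding Bhat_def[abs_def] by measurable
  have bd: "norm (Bhat \<phi> P xs M S j k) \<le> (\<Sum>l<P. \<bar>M l\<bar> * norm (S l)) * \<bar>\<phi> (norm k)\<bar>" for k
  proof -
    have "norm (\<Sum>l<P. of_real (M l * transv k (S l) $ j) * iexp (- (k \<bullet> xs l))) \<le> (\<Sum>l<P. \<bar>M l\<bar> * norm (S l))"
    proof (rule sum_norm_le)
      fix l
      have "norm (of_real (M l * transv k (S l) $ j) * iexp (- (k \<bullet> xs l))) = \<bar>M l\<bar> * \<bar>transv k (S l) $ j\<bar>"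
        unfolding norm_mult norm_of_real norm_exp_i_times abs_mult by simp
      also have "\<dots> \<le> \<bar>M l\<bar> * norm (S l)"
        by (intro mult_left_mono order_trans[OF component_le_norm_cart norm_transv]) simp
      finally show "norm (of_real (M l * transv k (S l) $ j) * iexp (- (k \<bullet> xs l))) \<le> \<bar>M l\<bar> * norm (S l)" .
    qed
    then show ?thesis
      unfolding Bhat_def norm_mult norm_of_real by (subst mult.commute) (rule mult_right_mono, simp_all)
  qed
  have K: "0 \<le> (\<Sum>l<P. \<bar>M l\<bar> * norm (S l))" by (intro sum_nonneg) simp
  show "integrable lborel (Bhat \<phi> P xs M S j)" "integrable lborel (\<lambda>k. norm k * norm (Bhat \<phi> P xs M S j k))"
    "\<exists>B. \<forall>k. norm (Bhat \<phi> P xs M S j k) \<le> B"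
    using integrable_schwartz_bound[OF assms m bd K] by blast+
qed

text \<open>At the origin the limit of the projection depends on the direction of approach. A single
  point is a null set, so the almost everywhere hypothesis of \<open>plancherel\<close> still
  holds.\<close>

lemma isCont_Bhat:
  assumes "schwartz \<phi>" "k \<noteq> 0"
  shows "isCont (Bhat \<phi> P xs M S j) k"
proof -
  have "continuous_on UNIV (\<lambda>k::real^3. \<phi> (norm k))"
    by (rule continuous_on_compose2[OF schwartz_continuous[OF assms(1)]]) (auto intro: continuous_intros)
  then have \<phi>: "isCont (\<lambda>k::real^3. \<phi> (norm k)) k"
    by (simp add: continuous_on_eq_continuous_at)
  have t: "isCont (\<lambda>k. transv k (S l) $ j) k" for l
    by (rule bounded_linear.isCont[OF bounded_linear_vec_nth isCont_transv[OF assms(2)]])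
  show ?thesis
    unfolding Bhat_def[abs_def]
    by (intro continuous_intros \<phi> t)
qed

lemma Bhat_cnj: "cnj (Bhat \<phi> P xs M S j k) = Bhat \<phi> P xs M S j (- k)"
proof -
  have "transv (- k) S' = transv k S'" for S' by (simp add: transv_def)
  then show ?thesis by (simp add: Bhat_def exp_cnj)
qed

lemma rho_fourier: "rho \<phi> x = (2 * pi) powr (-3) * Re (fourier (\<lambda>k. of_real (\<phi> (norm k))) x)"
proof -
  have "complex_of_real (2 * pi) powr (-3) = of_real ((2 * pi) powr (-3))"
    by (subst powr_of_real[symmetric]) simp_all
  then show ?thesis
    by (simp add: rho_def fourier_def del: of_real_mult)
qed

text \<open>Differentiation multiplies the transform by \<open>\<i>\<close> times a coordinate of
  \<open>k\<close>. The divergence then vanishes under the integral by \<open>inner_transv\<close>,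
  and \<open>transv_curl\<close> replaces the projected spins by the spins themselves, which
  produces derivatives of \<open>rho \<phi>\<close> at the shifted points.\<close>

lemma Bsol_properties:
  fixes P :: nat and xs :: "nat \<Rightarrow> real^3" and M :: "nat \<Rightarrow> real" and S :: "nat \<Rightarrow> real^3"
  assumes \<phi>: "schwartz \<phi>"
  defines "B \<equiv> Bsol \<phi> P xs M S"
  shows "B differentiable (at x)" "divg B x = 0" "curl B x = jclass \<phi> P xs M S x"
proof -
  define c where "c = (2 * pi) powr (-3)"
  let ?F = "Bhat \<phi> P xs M S"
  let ?R = "\<lambda>l k. of_real (\<phi> (norm k)) * iexp (- (k \<bullet> xs l))"
  have Bn: "B y $ j = c * Re (fourier (?F j) y)" for y j by (simp add: B_def Bsol_def c_def)
  have pdB: "pd (\<lambda>y. B y $ j) i x = c * Re (fourier (\<lambda>k. \<i> * of_real (k $ i) * ?F j k) x)" for i j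
    unfolding Bn by (rule fourier_pd(1)[OF Bhat_bounds(1,2)[OF \<phi>]])
  have mi[measurable]: "(\<lambda>k::real^3. k $ i) \<in> borel_measurable borel" for i
    by (intro borel_measurable_continuous_onI continuous_intros)
  have weighted: "integrable lborel (\<lambda>k. \<i> * of_real (k $ i) * G k)"
    if G: "integrable lborel G" "integrable lborel (\<lambda>k. norm k * norm (G k))" for G :: "real^3 \<Rightarrow> complex" and i
  proof (rule Bochner_Integration.integrable_bound[OF G(2)])
    have [measurable]: "G \<in> borel_measurable borel" using G(1) by auto
    show "(\<lambda>k. \<i> * of_real (k $ i) * G k) \<in> borel_measurable lborel" by measurable
    show "AE k in lborel. norm (\<i> * of_real (k $ i) * G k) \<le> norm (norm k * norm (G k))"
      by (intro AE_I2) (simp add: norm_mult mult_right_mono component_le_norm_cart)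
  qed
  show "B differentiable (at x)"
    using fourier_pd(2)[OF Bhat_bounds(1,2)[OF \<phi>]]
    by (subst differentiable_componentwise_within) (auto simp: Basis_vec_def inner_axis Bn)
  have Fi: "integrable lborel (\<lambda>k. \<i> * of_real (k $ i) * ?F j k * iexp (k \<bullet> x))" for i j
    by (rule fourier_integrable[OF weighted[OF Bhat_bounds(1,2)[OF \<phi>]]])
  show "divg B x = 0"
  proof -
    have "(\<Sum>i\<in>UNIV. fourier (\<lambda>k. \<i> * of_real (k $ i) * ?F i k) x)
       = (\<integral>k. (\<Sum>i\<in>UNIV. \<i> * of_real (k $ i) * ?F i k * iexp (k \<bullet> x)) \<partial>lborel)"
      unfolding fourier_def by (rule Bochner_Integration.integral_sum[symmetric, OF Fi])
    also have "\<dots> = (\<integral>k. 0 \<partial>(lborel :: (real^3) measure))"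
    proof (intro Bochner_Integration.integral_cong refl)
      fix k :: "real^3"
      have "(\<Sum>i\<in>UNIV. \<i> * of_real (k $ i) * ?F i k * iexp (k \<bullet> x))
        = (\<Sum>i\<in>UNIV. \<Sum>l<P. \<i> * of_real (\<phi> (norm k)) * of_real (M l) * iexp (- (k \<bullet> xs l)) * iexp (k \<bullet> x) * of_real (k $ i * transv k (S l) $ i))"
        unfolding Bhat_def sum_distrib_left sum_distrib_right of_real_mult by (simp only: mult_ac)
      also have "\<dots> = (\<Sum>l<P. \<i> * of_real (\<phi> (norm k)) * of_real (M l) * iexp (- (k \<bullet> xs l)) * iexp (k \<bullet> x) * of_real (k \<bullet> transv k (S l)))"
        by (subst sum.swap) (simp only: sum_distrib_left[symmetric] of_real_sum[symmetric] inner_vec_def inner_real_def)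
      finally show "(\<Sum>i\<in>UNIV. \<i> * of_real (k $ i) * ?F i k * iexp (k \<bullet> x)) = 0"
        by (simp add: inner_transv)
    qed
    finally have "(\<Sum>i\<in>UNIV. fourier (\<lambda>k. \<i> * of_real (k $ i) * ?F i k) x) = 0" by simp
    then have "(\<Sum>i\<in>UNIV. Re (fourier (\<lambda>k. \<i> * of_real (k $ i) * ?F i k) x)) = 0"
      by (metis Re_sum zero_complex.simps(1))
    then show ?thesis unfolding divg_def pdB sum_distrib_left[symmetric] by simp
  qed
  have mp[measurable]: "(\<lambda>k::real^3. \<phi> (norm k)) \<in> borel_measurable borel"
    using schwartz_measurable[OF \<phi>] by measurable
  have \<Phi>: "integrable lborel (\<lambda>k::real^3. complex_of_real (\<phi> (norm k)))"
     "integrable lborel (\<lambda>k::real^3. norm k * norm (complex_of_real (\<phi> (norm k))))"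
    by (rule integrable_schwartz_bound(1,2)[OF \<phi>, where K=1]; simp)+
  have R: "integrable lborel (?R l)" "integrable lborel (\<lambda>k. norm k * norm (?R l k))" for l
    by (rule integrable_schwartz_bound(1,2)[OF \<phi>, where K=1]; simp add: norm_mult)+
  have pdr: "pd (rho \<phi>) i (x - xs l) = c * Re (fourier (\<lambda>k. \<i> * of_real (k $ i) * ?R l k) x)" for i l
  proof -
    have "pd (rho \<phi>) i (x - xs l) = c * Re (fourier (\<lambda>k. \<i> * of_real (k $ i) * of_real (\<phi> (norm k))) (x - xs l))"
      unfolding c_def using fourier_pd(1)[OF \<Phi>] by (simp add: rho_fourier[abs_def])
    then show ?thesis unfolding fourier_shift by (simp only: mult.assoc)
  qed
  have Ri: "integrable lborel (\<lambda>k. \<i> * of_real (k $ i) * ?R l k * iexp (k \<bullet> x))" for i l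
    by (rule fourier_integrable[OF weighted[OF R]])
  \<comment> \<open>One antisymmetric identity for arbitrary axes \<open>a\<close> and
    \<open>b\<close> serves all three components of the curl.\<close>
  have key: "pd (\<lambda>y. B y $ b) a x - pd (\<lambda>y. B y $ a) b x
     = (\<Sum>l<P. M l * (pd (rho \<phi>) a (x - xs l) * S l $ b - pd (rho \<phi>) b (x - xs l) * S l $ a))" for a b
  proof -
    have "fourier (\<lambda>k. \<i> * of_real (k $ a) * ?F b k) x - fourier (\<lambda>k. \<i> * of_real (k $ b) * ?F a k) x
      = (\<integral>k. \<i> * of_real (k $ a) * ?F b k * iexp (k \<bullet> x) - \<i> * of_real (k $ b) * ?F a k * iexp (k \<bullet> x) \<partial>lborel)"
      unfolding fourier_def by (rule Bochner_Integration.integral_diff[symmetric, OF Fi Fi])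
    also have "\<dots> = (\<integral>k. (\<Sum>l<P. of_real (M l * S l $ b) * (\<i> * of_real (k $ a) * ?R l k * iexp (k \<bullet> x))
        - of_real (M l * S l $ a) * (\<i> * of_real (k $ b) * ?R l k * iexp (k \<bullet> x))) \<partial>lborel)"
    proof (intro Bochner_Integration.integral_cong refl)
      fix k :: "real^3"
      have "\<i> * of_real (k $ a) * ?F b k * iexp (k \<bullet> x) - \<i> * of_real (k $ b) * ?F a k * iexp (k \<bullet> x)
        = (\<Sum>l<P. \<i> * of_real (\<phi> (norm k)) * of_real (M l) * iexp (- (k \<bullet> xs l)) * iexp (k \<bullet> x)
            * of_real (k $ a * transv k (S l) $ b - k $ b * transv k (S l) $ a))"
        unfolding Bhat_def sum_distrib_left sum_distrib_right sum_subtractf[symmetric] of_real_mult of_real_diff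
        by (intro sum.cong refl) (simp only: algebra_simps)
      also have "\<dots> = (\<Sum>l<P. of_real (M l * S l $ b) * (\<i> * of_real (k $ a) * ?R l k * iexp (k \<bullet> x))
        - of_real (M l * S l $ a) * (\<i> * of_real (k $ b) * ?R l k * iexp (k \<bullet> x)))"
        unfolding transv_curl of_real_mult of_real_diff by (intro sum.cong refl) (simp only: algebra_simps)
      finally show "\<i> * of_real (k $ a) * ?F b k * iexp (k \<bullet> x) - \<i> * of_real (k $ b) * ?F a k * iexp (k \<bullet> x)
         = (\<Sum>l<P. of_real (M l * S l $ b) * (\<i> * of_real (k $ a) * ?R l k * iexp (k \<bullet> x))
        - of_real (M l * S l $ a) * (\<i> * of_real (k $ b) * ?R l k * iexp (k \<bullet> x)))" .
    qed
    also have "\<dots> = (\<Sum>l<P. \<integral>k. of_real (M l * S l $ b) * (\<i> * of_real (k $ a) * ?R l k * iexp (k \<bullet> x))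
        - of_real (M l * S l $ a) * (\<i> * of_real (k $ b) * ?R l k * iexp (k \<bullet> x)) \<partial>lborel)"
      by (intro Bochner_Integration.integral_sum Bochner_Integration.integrable_diff integrable_mult_right Ri)
    also have "\<dots> = (\<Sum>l<P. of_real (M l * S l $ b) * fourier (\<lambda>k. \<i> * of_real (k $ a) * ?R l k) x
        - of_real (M l * S l $ a) * fourier (\<lambda>k. \<i> * of_real (k $ b) * ?R l k) x)"
      unfolding fourier_def
      by (intro sum.cong refl, subst Bochner_Integration.integral_diff) (simp_all only: integral_mult_right_zero integrable_mult_right Ri)
    finally have "fourier (\<lambda>k. \<i> * of_real (k $ a) * ?F b k) x - fourier (\<lambda>k. \<i> * of_real (k $ b) * ?F a k) x = \<dots>" .
    moreover have Re_of: "Re (of_real r * z) = r * Re z" for r z by simp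
    ultimately have "Re (fourier (\<lambda>k. \<i> * of_real (k $ a) * ?F b k) x) - Re (fourier (\<lambda>k. \<i> * of_real (k $ b) * ?F a k) x)
      = (\<Sum>l<P. M l * S l $ b * Re (fourier (\<lambda>k. \<i> * of_real (k $ a) * ?R l k) x)
        - M l * S l $ a * Re (fourier (\<lambda>k. \<i> * of_real (k $ b) * ?R l k) x))"
      by (simp only: minus_complex.simps(1)[symmetric] Re_sum) (simp only: minus_complex.simps(1) Re_of)
    then show ?thesis
      unfolding pdB pdr right_diff_distrib[symmetric] by (simp only:) (simp add: sum_distrib_left algebra_simps)
  qed
  show "curl B x = jclass \<phi> P xs M S x"
    unfolding curl_def key
    by (simp add: vec_eq_iff forall_3 jclass_def cross3_def grad_def)
qed

lemma transv_kernel_integrable: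
  assumes \<phi>: "schwartz \<phi>"
  shows "integrable lborel (\<lambda>k. complex_of_real ((\<phi> (norm k))\<^sup>2 * transv_kernel m m' k))"
proof -
  note [measurable] = schwartz_measurable[OF \<phi>]
  obtain b where b: "\<And>k::real^3. norm (complex_of_real (\<phi> (norm k))) \<le> b"
    using integrable_schwartz_bound(3)[OF \<phi>, where K=1 and F="\<lambda>k. of_real (\<phi> (norm k))"] by auto
  have b0: "0 \<le> b" using order_trans[OF norm_ge_zero b] by blast
  show ?thesis
  proof (rule integrable_schwartz_bound(1)[OF \<phi> _ _ b0])
    fix k :: "real^3"
    have "\<bar>\<phi> (norm k)\<bar> * (\<bar>\<phi> (norm k)\<bar> * \<bar>transv_kernel m m' k\<bar>) \<le> b * (\<bar>\<phi> (norm k)\<bar> * 1)"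
      using b[of k] b0 by (intro mult_mono transv_kernel_bound) auto
    then show "norm (complex_of_real ((\<phi> (norm k))\<^sup>2 * transv_kernel m m' k)) \<le> b * \<bar>\<phi> (norm k)\<bar>"
      unfolding norm_of_real abs_mult power2_eq_square by (simp add: mult_ac)
  qed measurable
qed

text \<open>Plancherel for each component, followed by expansion of the square into pairs of spins.
  The sum is left as transforms of \<open>transv_kernel\<close> at \<open>xs l - xs l'\<close>
  because \<open>A_op_expand\<close> produces the same quantities.\<close>

lemma Bsol_energy:
  assumes \<phi>: "schwartz \<phi>"
  shows "integrable lborel (\<lambda>x. (norm (Bsol \<phi> P xs M S x))\<^sup>2)"
    and "complex_of_real (\<integral>x. (norm (Bsol \<phi> P xs M S x))\<^sup>2 \<partial>lborel) = of_real ((2 * pi) powr (-3)) *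
      (\<Sum>l<P. \<Sum>l'<P. \<Sum>m\<in>UNIV. \<Sum>m'\<in>UNIV. of_real (M l * M l' * (S l $ m * S l' $ m')) *
         fourier (\<lambda>k. of_real ((\<phi> (norm k))\<^sup>2 * transv_kernel m m' k)) (xs l - xs l'))"
proof -
  define c where "c = (2 * pi) powr (-3)"
  let ?F = "Bhat \<phi> P xs M S"
  let ?f = "\<lambda>j. fourier (?F j)"
  \<comment> \<open>The normalisation \<open>c\<close> of the field enters the energy squared and
    Plancherel contributes \<open>(2 * pi) ^ 3\<close>, so a single \<open>c\<close> remains, as in
    \<open>A11\<close> and \<open>Bfield_product\<close>.\<close>
  have c: "c\<^sup>2 * (2 * pi) ^ 3 = c"
  proof -
    have "c = inverse ((2 * pi) ^ 3)"
      unfolding c_def powr_minus by (subst powr_numeral) simp_all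
    then have "c * (2 * pi) ^ 3 = 1" by (simp only: left_inverse) simp
    then show ?thesis by (simp only: power2_eq_square mult.assoc mult_1_right)
  qed
  have d3: "DIM(real^3) = 3" by simp
  have "AE k in lborel. isCont (?F j) (k::real^3)" for j
    using AE_lborel_singleton[of "0::real^3"] by eventually_elim (rule isCont_Bhat[OF \<phi>])
  then have P: "integrable lborel (\<lambda>x. (norm (?f j x))\<^sup>2)"
      "(\<integral>x. (norm (?f j x))\<^sup>2 \<partial>lborel) = (2 * pi) ^ 3 * (\<integral>k. (norm (?F j k))\<^sup>2 \<partial>lborel)" for j
    using plancherel[OF Bhat_bounds(1)[OF \<phi>]] Bhat_bounds(3)[OF \<phi>] by (metis d3)+
  have n: "(norm (Bsol \<phi> P xs M S x))\<^sup>2 = (\<Sum>j\<in>UNIV. c\<^sup>2 * (norm (?f j x))\<^sup>2)" for x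
  proof -
    have "Im (?f j x) = 0" for j by (intro fourier_real Bhat_cnj)
    then have "(norm (?f j x))\<^sup>2 = (Re (?f j x))\<^sup>2" for j by (simp add: cmod_power2)
    moreover have "(norm (Bsol \<phi> P xs M S x))\<^sup>2 = (\<Sum>j\<in>UNIV. (c * Re (?f j x)) * (c * Re (?f j x)))"
      unfolding power2_norm_eq_inner inner_vec_def Bsol_def c_def by simp
    ultimately show ?thesis by (simp add: power2_eq_square mult_ac)
  qed
  show "integrable lborel (\<lambda>x. (norm (Bsol \<phi> P xs M S x))\<^sup>2)"
    unfolding n by (intro Bochner_Integration.integrable_sum integrable_mult_right P)
  have F2: "integrable lborel (\<lambda>k. (norm (?F j k))\<^sup>2)" for j
  proof -
    obtain b where b: "\<And>k. norm (?F j k) \<le> b" using Bhat_bounds(3)[OF \<phi>] by blast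
    have [measurable]: "?F j \<in> borel_measurable borel" using Bhat_bounds(1)[OF \<phi>] by auto
    show ?thesis
    proof (rule Bochner_Integration.integrable_bound)
      show "integrable lborel (\<lambda>k. b * norm (?F j k))"
        by (intro integrable_mult_right integrable_norm Bhat_bounds(1)[OF \<phi>])
      show "AE k in lborel. norm ((norm (?F j k))\<^sup>2) \<le> norm (b * norm (?F j k))"
        unfolding real_norm_def
        by (intro AE_I2 order_trans[OF _ abs_ge_self]) (simp add: power2_eq_square b mult_right_mono)
    qed measurable
  qed
  have "(\<integral>x. (norm (Bsol \<phi> P xs M S x))\<^sup>2 \<partial>lborel) = (\<Sum>j\<in>UNIV. \<integral>x. c\<^sup>2 * (norm (?f j x))\<^sup>2 \<partial>lborel)"
    unfolding n by (intro Bochner_Integration.integral_sum integrable_mult_right P)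
  also have "\<dots> = (\<Sum>j\<in>UNIV. c\<^sup>2 * ((2 * pi) ^ 3 * (\<integral>k. (norm (?F j k))\<^sup>2 \<partial>lborel)))"
    by (simp only: integral_mult_right_zero P(2))
  also have "\<dots> = c * (\<Sum>j\<in>UNIV. \<integral>k. (norm (?F j k))\<^sup>2 \<partial>lborel)"
    unfolding mult.assoc[symmetric] c by (rule sum_distrib_left[symmetric])
  also have "(\<Sum>j\<in>UNIV. \<integral>k. (norm (?F j k))\<^sup>2 \<partial>lborel) = (\<integral>k. (\<Sum>j\<in>UNIV. (norm (?F j k))\<^sup>2) \<partial>lborel)"
    by (rule Bochner_Integration.integral_sum[symmetric, OF F2])
  finally have "complex_of_real (\<integral>x. (norm (Bsol \<phi> P xs M S x))\<^sup>2 \<partial>lborel)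
     = of_real c * (\<integral>k. of_real (\<Sum>j\<in>UNIV. (norm (?F j k))\<^sup>2) \<partial>lborel)"
    by (simp only: of_real_mult integral_complex_of_real)
  also have "(\<integral>k. complex_of_real (\<Sum>j\<in>UNIV. (norm (?F j k))\<^sup>2) \<partial>lborel)
    = (\<integral>k. (\<Sum>l<P. \<Sum>l'<P. \<Sum>m\<in>UNIV. \<Sum>m'\<in>UNIV. of_real (M l * M l' * (S l $ m * S l' $ m')) *
         (of_real ((\<phi> (norm k))\<^sup>2 * transv_kernel m m' k) * iexp (k \<bullet> (xs l - xs l')))) \<partial>lborel)"
  proof (intro Bochner_Integration.integral_cong refl)
    fix k :: "real^3"
    let ?e = "\<lambda>l. iexp (k \<bullet> xs l)" and ?e' = "\<lambda>l. iexp (- (k \<bullet> xs l))"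
    have ee: "?e l * ?e' l' = iexp (k \<bullet> (xs l - xs l'))" for l l'
      by (simp add: inner_diff_right algebra_simps flip: exp_add)
    have "complex_of_real (\<Sum>j\<in>UNIV. (norm (?F j k))\<^sup>2) = (\<Sum>j\<in>UNIV. cnj (?F j k) * ?F j k)"
      unfolding of_real_sum complex_norm_square by (simp only: mult.commute)
    also have "\<dots> = (\<Sum>j\<in>UNIV. \<Sum>l<P. \<Sum>l'<P. (of_real ((\<phi> (norm k))\<^sup>2 * (M l * M l')) * (?e l * ?e' l')) * of_real (transv k (S l) $ j * transv k (S l') $ j))"
    proof (intro sum.cong refl)
      fix j
      have "cnj (?F j k) = of_real (\<phi> (norm k)) * (\<Sum>l<P. of_real (M l * transv k (S l) $ j) * ?e l)"
        by (simp add: Bhat_def exp_cnj)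
      then have "cnj (?F j k) * ?F j k = of_real (\<phi> (norm k) * \<phi> (norm k)) * ((\<Sum>l<P. of_real (M l * transv k (S l) $ j) * ?e l) * (\<Sum>l<P. of_real (M l * transv k (S l) $ j) * ?e' l))"
        by (simp only: Bhat_def of_real_mult mult_ac)
      also have "\<dots> = (\<Sum>l<P. \<Sum>l'<P. (of_real ((\<phi> (norm k))\<^sup>2 * (M l * M l')) * (?e l * ?e' l')) * of_real (transv k (S l) $ j * transv k (S l') $ j))"
        unfolding sum_product unfolding sum_distrib_left of_real_mult power2_eq_square by (simp only: mult_ac)
      finally show "cnj (?F j k) * ?F j k = (\<Sum>l<P. \<Sum>l'<P. (of_real ((\<phi> (norm k))\<^sup>2 * (M l * M l')) * (?e l * ?e' l')) * of_real (transv k (S l) $ j * transv k (S l') $ j))" .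
    qed
    also have "\<dots> = (\<Sum>l<P. \<Sum>l'<P. \<Sum>j\<in>UNIV. (of_real ((\<phi> (norm k))\<^sup>2 * (M l * M l')) * (?e l * ?e' l')) * of_real (transv k (S l) $ j * transv k (S l') $ j))"
      by (subst sum.swap, intro sum.cong refl, rule sum.swap)
    also have "\<dots> = (\<Sum>l<P. \<Sum>l'<P. (of_real ((\<phi> (norm k))\<^sup>2 * (M l * M l')) * (?e l * ?e' l')) * of_real (transv k (S l) \<bullet> transv k (S l')))"
      by (simp only: sum_distrib_left[symmetric] of_real_sum[symmetric] inner_vec_def inner_real_def)
    also have "\<dots> = (\<Sum>l<P. \<Sum>l'<P. \<Sum>m\<in>UNIV. \<Sum>m'\<in>UNIV. of_real (M l * M l' * (S l $ m * S l' $ m')) *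
         (of_real ((\<phi> (norm k))\<^sup>2 * transv_kernel m m' k) * iexp (k \<bullet> (xs l - xs l'))))"
      unfolding transv_kernel_sum ee of_real_sum sum_distrib_left of_real_mult
      by (simp only: mult_ac)
    finally show "complex_of_real (\<Sum>j\<in>UNIV. (norm (?F j k))\<^sup>2) = (\<Sum>l<P. \<Sum>l'<P. \<Sum>m\<in>UNIV. \<Sum>m'\<in>UNIV. of_real (M l * M l' * (S l $ m * S l' $ m')) *
         (of_real ((\<phi> (norm k))\<^sup>2 * transv_kernel m m' k) * iexp (k \<bullet> (xs l - xs l'))))" .
  qed
  also have "\<dots> = (\<Sum>l<P. \<Sum>l'<P. \<Sum>m\<in>UNIV. \<Sum>m'\<in>UNIV. of_real (M l * M l' * (S l $ m * S l' $ m')) *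
         fourier (\<lambda>k. of_real ((\<phi> (norm k))\<^sup>2 * transv_kernel m m' k)) (xs l - xs l'))"
    unfolding fourier_def integral_mult_right_zero[symmetric]
    by (simp only: Bochner_Integration.integral_sum Bochner_Integration.integrable_sum integrable_mult_right
      fourier_integrable[OF transv_kernel_integrable[OF \<phi>]])
  finally show "complex_of_real (\<integral>x. (norm (Bsol \<phi> P xs M S x))\<^sup>2 \<partial>lborel) = of_real ((2 * pi) powr (-3)) *
      (\<Sum>l<P. \<Sum>l'<P. \<Sum>m\<in>UNIV. \<Sum>m'\<in>UNIV. of_real (M l * M l' * (S l $ m * S l' $ m')) *
         fourier (\<lambda>k. of_real ((\<phi> (norm k))\<^sup>2 * transv_kernel m m' k)) (xs l - xs l'))"
    unfolding c_def .
qed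

section \<open>The operator side and the diagonal kernel\<close>

lemma Bfield_product:
  "(\<Sum>j\<in>UNIV. cnj (Bfield \<phi> m x k $ j) * of_real (1 / norm k) * Bfield \<phi> m' y k $ j)
    = of_real ((2 * pi) powr (-3)) * (of_real ((\<phi> (norm k))\<^sup>2 * transv_kernel m m' k) * iexp (k \<bullet> (x - y)))"
proof -
  define a where "a = \<phi> (norm k) * sqrt (norm k) / (2 * pi) powr (3/2)"
  define v v' where "v = cross3 k (axis m 1)" and "v' = cross3 k (axis m' 1)"
  have cmB: "cnj (Bfield \<phi> m x k $ j) = - \<i> * of_real a * iexp (k \<bullet> x) * of_real (v $ j / norm k)" for j
    unfolding Bfield_def a_def v_def by (simp add: exp_cnj)
  have mB: "Bfield \<phi> m' y k $ j = \<i> * of_real a * iexp (- (k \<bullet> y)) * of_real (v' $ j / norm k)" for j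
    unfolding Bfield_def a_def v'_def by simp
  have ee: "iexp (k \<bullet> x) * iexp (- (k \<bullet> y)) = iexp (k \<bullet> (x - y))"
    by (simp add: inner_diff_right algebra_simps flip: exp_add)
  have "(\<Sum>j\<in>UNIV. cnj (Bfield \<phi> m x k $ j) * of_real (1 / norm k) * Bfield \<phi> m' y k $ j)
     = (\<Sum>j\<in>UNIV. iexp (k \<bullet> (x - y)) * of_real (a\<^sup>2 / norm k ^ 3) * of_real (v $ j * v' $ j))"
    unfolding cmB mB ee[symmetric]
    by (intro sum.cong refl) (simp add: power2_eq_square eval_nat_numeral mult_ac)
  also have "\<dots> = iexp (k \<bullet> (x - y)) * of_real (a\<^sup>2 / norm k ^ 3 * (v \<bullet> v'))"
    by (simp only: inner_vec_def[of v v'] inner_real_def of_real_mult[of "a\<^sup>2 / norm k ^ 3"] of_real_sum sum_distrib_left mult.assoc)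
  \<comment> \<open>Of the three powers of \<open>norm k\<close> in the denominator, one is the
    inverse photon energy and two normalise the cross products. The two square roots in
    \<open>a\<^sup>2\<close> cancel one of them, and Lagrange's identity turns the product of the
    cross products into the numerator of \<open>transv_kernel\<close>. At \<open>k = 0\<close> both
    sides are 0 by the convention for division.\<close>
  also have "a\<^sup>2 / norm k ^ 3 * (v \<bullet> v') = (2 * pi) powr (-3) * ((\<phi> (norm k))\<^sup>2 * transv_kernel m m' k)"
  proof -
    have "((2 * pi) powr (3/2))\<^sup>2 = (2 * pi) powr 3"
      by (subst powr_power) simp_all
    then have a2: "a\<^sup>2 = (2 * pi) powr (-3) * (\<phi> (norm k))\<^sup>2 * norm k"
      unfolding a_def by (simp only: power_divide power_mult_distrib powr_minus_divide real_sqrt_pow2[OF norm_ge_zero]) simp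
    have vv: "v \<bullet> v' = (if m = m' then k \<bullet> k else 0) - k $ m * k $ m'"
      unfolding v_def v'_def dot_cross inner_axis_axis by (simp add: inner_axis inner_commute)
    show ?thesis
      unfolding a2 vv transv_kernel_def
      by (cases "k = 0") (simp_all add: eval_nat_numeral norm_eq_sqrt_inner[symmetric] dot_square_norm)
  qed
  finally show ?thesis by (simp only: of_real_mult mult_ac)
qed

text \<open>The pair \<open>l, m\<close> comes from the interaction that annihilates the photon,
  \<open>l', m'\<close> from the one that creates it. Their Segal factors \<open>1 / sqrt 2\<close>
  multiply to the 1/2, and the Pauli operators, acting only on spin, pull out of the integral over
  \<open>k\<close>.\<close>

lemma A_op_expand:
  assumes \<phi>: "schwartz \<phi>"
  shows "A_op \<phi> P xs M X s = - (1/2) * of_real ((2 * pi) powr (-3)) *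
    (\<Sum>l<P. \<Sum>m\<in>UNIV. \<Sum>l'<P. \<Sum>m'\<in>UNIV. of_real (M l * M l') *
      fourier (\<lambda>k. of_real ((\<phi> (norm k))\<^sup>2 * transv_kernel m m' k)) (xs l - xs l') * pauli_at m l (pauli_at m' l' X) s)"
proof -
  define c where "c = complex_of_real ((2 * pi) powr (-3))"
  define r where "r = complex_of_real (1 / sqrt 2)"
  have rr: "r * r = 1/2" unfolding r_def of_real_mult[symmetric] by simp
  let ?g = "\<lambda>m m' d k. of_real ((\<phi> (norm k))\<^sup>2 * transv_kernel m m' k) * iexp (k \<bullet> d)"
  have pH: "pauli_at m l (HintE \<phi> P xs M X k j) s
     = (\<Sum>l'<P. \<Sum>m'\<in>UNIV. r * of_real (M l') * pauli_at m l (pauli_at m' l' X) s * Bfield \<phi> m' (xs l') k $ j)" for m l k j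
  proof -
    have "pauli_at m l (HintE \<phi> P xs M X k j) s
      = (\<Sum>b\<in>UNIV. \<Sum>l'<P. \<Sum>m'\<in>UNIV. r * of_real (M l') * Bfield \<phi> m' (xs l') k $ j * (pmat m (s ! l) b * pauli_at m' l' X (s[l := b])))"
      unfolding pauli_at_def[of m l "HintE \<phi> P xs M X k j"] HintE_def sum_distrib_left r_def by (simp add: mult_ac)
    also have "\<dots> = (\<Sum>l'<P. \<Sum>m'\<in>UNIV. \<Sum>b\<in>UNIV. r * of_real (M l') * Bfield \<phi> m' (xs l') k $ j * (pmat m (s ! l) b * pauli_at m' l' X (s[l := b])))"
      by (subst sum.swap, intro sum.cong refl, rule sum.swap)
    also have "\<dots> = (\<Sum>l'<P. \<Sum>m'\<in>UNIV. r * of_real (M l') * pauli_at m l (pauli_at m' l' X) s * Bfield \<phi> m' (xs l') k $ j)"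
      unfolding sum_distrib_left[symmetric] pauli_at_def[of m l "pauli_at _ _ X"] by (simp only: mult_ac)
    finally show ?thesis .
  qed
  have inner: "(\<integral>k. (\<Sum>j\<in>UNIV. cnj (Bfield \<phi> m (xs l) k $ j) * of_real (1 / norm k) * pauli_at m l (HintE \<phi> P xs M X k j) s) \<partial>lborel)
     = (\<Sum>l'<P. \<Sum>m'\<in>UNIV. r * of_real (M l') * pauli_at m l (pauli_at m' l' X) s * (c *
         fourier (\<lambda>k. of_real ((\<phi> (norm k))\<^sup>2 * transv_kernel m m' k)) (xs l - xs l')))" for m l
  proof -
    have "(\<Sum>j\<in>UNIV. cnj (Bfield \<phi> m (xs l) k $ j) * of_real (1 / norm k) * pauli_at m l (HintE \<phi> P xs M X k j) s)
      = (\<Sum>l'<P. \<Sum>m'\<in>UNIV. r * of_real (M l') * pauli_at m l (pauli_at m' l' X) s * (c * ?g m m' (xs l - xs l') k))" for k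
    proof -
      have "(\<Sum>j\<in>UNIV. cnj (Bfield \<phi> m (xs l) k $ j) * of_real (1 / norm k) * pauli_at m l (HintE \<phi> P xs M X k j) s)
        = (\<Sum>j\<in>UNIV. \<Sum>l'<P. \<Sum>m'\<in>UNIV. r * of_real (M l') * pauli_at m l (pauli_at m' l' X) s *
            (cnj (Bfield \<phi> m (xs l) k $ j) * of_real (1 / norm k) * Bfield \<phi> m' (xs l') k $ j))"
        unfolding pH sum_distrib_left by (simp only: mult_ac)
      also have "\<dots> = (\<Sum>l'<P. \<Sum>m'\<in>UNIV. \<Sum>j\<in>UNIV. r * of_real (M l') * pauli_at m l (pauli_at m' l' X) s *
            (cnj (Bfield \<phi> m (xs l) k $ j) * of_real (1 / norm k) * Bfield \<phi> m' (xs l') k $ j))"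
        by (subst sum.swap, rule sum.cong[OF refl], rule sum.swap)
      finally show ?thesis
        unfolding sum_distrib_left[symmetric] Bfield_product c_def .
    qed
    then have "(\<integral>k. (\<Sum>j\<in>UNIV. cnj (Bfield \<phi> m (xs l) k $ j) * of_real (1 / norm k) * pauli_at m l (HintE \<phi> P xs M X k j) s) \<partial>lborel)
      = (\<integral>k. (\<Sum>l'<P. \<Sum>m'\<in>UNIV. r * of_real (M l') * pauli_at m l (pauli_at m' l' X) s * (c * ?g m m' (xs l - xs l') k)) \<partial>lborel)"
      by (simp only:)
    also have "\<dots> = (\<Sum>l'<P. \<Sum>m'\<in>UNIV. r * of_real (M l') * pauli_at m l (pauli_at m' l' X) s * (c *
         fourier (\<lambda>k. of_real ((\<phi> (norm k))\<^sup>2 * transv_kernel m m' k)) (xs l - xs l')))"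
      unfolding fourier_def integral_mult_right_zero[symmetric]
      by (simp only: Bochner_Integration.integral_sum Bochner_Integration.integrable_sum integrable_mult_right
        fourier_integrable[OF transv_kernel_integrable[OF \<phi>]])
    finally show ?thesis .
  qed
  have "A_op \<phi> P xs M X s = - (\<Sum>l<P. \<Sum>m\<in>UNIV. of_real (M l) * r * (\<Sum>l'<P. \<Sum>m'\<in>UNIV. r * of_real (M l') * pauli_at m l (pauli_at m' l' X) s * (c *
         fourier (\<lambda>k. of_real ((\<phi> (norm k))\<^sup>2 * transv_kernel m m' k)) (xs l - xs l'))))"
    unfolding A_op_def inner by (simp add: r_def)
  also have "\<dots> = - (\<Sum>l<P. \<Sum>m\<in>UNIV. \<Sum>l'<P. \<Sum>m'\<in>UNIV. (r * r) * c * (of_real (M l * M l') *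
      fourier (\<lambda>k. of_real ((\<phi> (norm k))\<^sup>2 * transv_kernel m m' k)) (xs l - xs l') * pauli_at m l (pauli_at m' l' X) s))"
    unfolding sum_distrib_left of_real_mult by (simp only: mult_ac)
  also have "\<dots> = - (1/2) * c *
    (\<Sum>l<P. \<Sum>m\<in>UNIV. \<Sum>l'<P. \<Sum>m'\<in>UNIV. of_real (M l * M l') *
      fourier (\<lambda>k. of_real ((\<phi> (norm k))\<^sup>2 * transv_kernel m m' k)) (xs l - xs l') * pauli_at m l (pauli_at m' l' X) s)"
    unfolding sum_distrib_left[symmetric] rr by simp
  finally show ?thesis unfolding c_def .
qed

text \<open>The profile is rotation invariant, and two kinds of symmetry suffice: reflecting the
  coordinate \<open>m\<close> changes the sign of an off-diagonal entry, and exchanging the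
  coordinates 1 and \<open>m\<close> identifies each diagonal entry with the first.\<close>

lemma transv_kernel_integral:
  assumes \<phi>: "schwartz \<phi>"
  shows "of_real ((2 * pi) powr (-3)) * fourier (\<lambda>k. of_real ((\<phi> (norm k))\<^sup>2 * transv_kernel m m' k)) 0
     = complex_of_real (if m = m' then A11 \<phi> else 0)"
proof -
  note [measurable] = schwartz_measurable[OF \<phi>]
  let ?f = "\<lambda>m m' k. (\<phi> (norm k))\<^sup>2 * transv_kernel m m' k"
  have [measurable]: "?f m m' \<in> borel_measurable borel" for m m' by measurable
  have f0: "fourier (\<lambda>k. of_real (?f m m' k)) 0 = of_real (\<integral>k. ?f m m' k \<partial>lborel)"
    unfolding fourier_def by (simp del: of_real_mult of_real_power)
  have nrm: "(\<chi> i. s i * k $ \<pi> i) \<bullet> (\<chi> i. s i * k $ \<pi> i) = k \<bullet> k"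
    if "bij \<pi>" "\<And>i. s i = 1 \<or> s i = -1" for s :: "3 \<Rightarrow> real" and \<pi> and k :: "real^3"
  proof -
    have ss: "s i * s i = 1" for i using that(2)[of i] by auto
    have "(\<chi> i. s i * k $ \<pi> i) \<bullet> (\<chi> i. s i * k $ \<pi> i) = (\<Sum>i\<in>UNIV. (s i * s i) * (k $ \<pi> i * k $ \<pi> i))"
      unfolding inner_vec_def by (simp add: mult_ac)
    also have "\<dots> = (\<Sum>i\<in>UNIV. k $ \<pi> i * k $ \<pi> i)" by (simp add: ss)
    also have "\<dots> = (\<Sum>i\<in>UNIV. k $ i * k $ i)" by (rule sum.reindex_bij_betw[OF that(1)])
    finally show ?thesis by (simp add: inner_vec_def)
  qed
  have nrm': "norm (\<chi> i. s i * k $ \<pi> i) = norm k"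
    if "bij \<pi>" "\<And>i. s i = 1 \<or> s i = -1" for s :: "3 \<Rightarrow> real" and \<pi> and k :: "real^3"
    using nrm[OF that, where k=k] by (simp add: norm_eq_sqrt_inner)
  show ?thesis
  proof (cases "m = m'")
    case False
    let ?s = "\<lambda>i. if i = m then -1 else 1 :: real"
    have s: "?s i = 1 \<or> ?s i = -1" for i by simp
    have "(\<integral>k. ?f m m' k \<partial>lborel) = (\<integral>k. ?f m m' (\<chi> i. ?s i * k $ id i) \<partial>lborel)"
      by (rule integral_signed_permutation[symmetric, OF _ bij_id s]) measurable
    also have "\<dots> = (\<integral>k. - ?f m m' k \<partial>lborel)"
      unfolding nrm'[OF bij_id s] transv_kernel_def nrm[OF bij_id s]
      by (intro Bochner_Integration.integral_cong refl) (use False in auto)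
    finally have "(\<integral>k. ?f m m' k \<partial>lborel) = 0" by simp
    with False show ?thesis unfolding f0 by simp
  next
    case True
    let ?\<pi> = "\<lambda>i. if i = 1 then m else if i = m then 1 else i"
    have b: "bij ?\<pi>" by (rule involuntory_imp_bij) auto
    have "(\<integral>k. ?f 1 1 k \<partial>lborel) = (\<integral>k. ?f 1 1 (\<chi> i. (1::real) * k $ ?\<pi> i) \<partial>lborel)"
      by (rule integral_signed_permutation[symmetric, OF _ b, of _ "\<lambda>_. 1"]) simp_all
    also have "\<dots> = (\<integral>k. ?f m m k \<partial>lborel)"
    proof (intro Bochner_Integration.integral_cong refl)
      fix k :: "real^3"
      have "(\<chi> i. (1::real) * k $ ?\<pi> i) \<bullet> (\<chi> i. 1 * k $ ?\<pi> i) = k \<bullet> k" "norm (\<chi> i. (1::real) * k $ ?\<pi> i) = norm k"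
        by (rule nrm[OF b] nrm'[OF b], simp)+
      then show "?f 1 1 (\<chi> i. (1::real) * k $ ?\<pi> i) = ?f m m k"
        unfolding transv_kernel_def by (simp only:) simp
    qed
    finally have "(\<integral>k. ?f m m k \<partial>lborel) = (\<integral>k. ?f 1 1 k \<partial>lborel)" ..
    moreover have "A11 \<phi> = (2 * pi) powr (-3) * (\<integral>k. ?f 1 1 k \<partial>lborel)"
      unfolding A11_def transv_kernel_def by (simp only: power2_norm_eq_inner power2_abs) (simp add: power2_eq_square)
    ultimately show ?thesis unfolding f0 unfolding True[symmetric] by simp
  qed
qed

theorem theorem2p3:
  fixes \<phi> :: "real \<Rightarrow> real" and P :: nat and xs :: "nat \<Rightarrow> real^3"
    and V :: "nat \<Rightarrow> bool \<Rightarrow> complex" and M :: "nat \<Rightarrow> real"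
    and Bc :: "real^3 \<Rightarrow> real^3"
  assumes "P \<ge> 1"
    and "schwartz \<phi>"
    and "\<forall>l<P. (\<Sum>a\<in>UNIV. (cmod (V l a))^2) = 1"
    and "\<forall>x. Bc differentiable (at x)"
    and "integrable lborel (\<lambda>x. (norm (Bc x))^2)"
    and "\<forall>x. divg Bc x = 0"
    and "\<forall>x. curl Bc x = jclass \<phi> P xs M (\<lambda>l. spinvec (V l)) x"
  shows "spin_inner P (A_op \<phi> P xs M (tensor P V)) (tensor P V) =
    complex_of_real (- (1/2) * integral\<^sup>L lborel (\<lambda>x. (norm (Bc x))^2)
                     - A11 \<phi> * (\<Sum>l<P. (M l)^2))"
proof -
  define S where "S l = spinvec (V l)" for l
  define c where "c = complex_of_real ((2 * pi) powr (-3))"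
  define W where "W m m' d = c * fourier (\<lambda>k. of_real ((\<phi> (norm k))\<^sup>2 * transv_kernel m m' k)) d" for m m' d
  define T where "T m l m' l' = spin_inner P (pauli_at m l (pauli_at m' l' (tensor P V))) (tensor P V)" for m l m' l'
  have W0: "W m m' 0 = of_real (if m = m' then A11 \<phi> else 0)" for m m'
    unfolding W_def c_def by (rule transv_kernel_integral[OF assms(2)])
  \<comment> \<open>Uniqueness replaces the abstract field \<open>Bc\<close> by the explicit Fourier
    integral, whose energy is known.\<close>
  have "Bc = Bsol \<phi> P xs M S"
    using assms(4-7) Bsol_properties[OF assms(2)] Bsol_energy(1)[OF assms(2)]
    by (intro div_curl_unique) (simp_all add: S_def[abs_def])
  then have energy: "complex_of_real (integral\<^sup>L lborel (\<lambda>x. (norm (Bc x))\<^sup>2)) =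
     (\<Sum>l<P. \<Sum>l'<P. of_real (M l * M l') * (\<Sum>m\<in>UNIV. \<Sum>m'\<in>UNIV. of_real (S l $ m * S l' $ m') * W m m' (xs l - xs l')))"
    using Bsol_energy(2)[OF assms(2), of P xs M S] unfolding c_def[symmetric] W_def
    by (simp add: sum_distrib_left mult_ac)
  have pair: "(\<Sum>m\<in>UNIV. \<Sum>m'\<in>UNIV. W m m' (xs l - xs l') * T m l m' l')
     = (\<Sum>m\<in>UNIV. \<Sum>m'\<in>UNIV. of_real (S l $ m * S l' $ m') * W m m' (xs l - xs l')) + (if l = l' then 2 * of_real (A11 \<phi>) else 0)"
    if l: "l < P" "l' < P" for l l'
  proof (cases "l = l'")
    case False
    then show ?thesis
      unfolding T_def S_def using spin_inner_pauli_pauli(1)[OF assms(3) l False] by (simp add: mult.commute)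
  next
    case True
    have T1: "T m l m l = 1" for m
      unfolding T_def by (rule spin_inner_pauli_pauli(2)[OF assms(3) l(1) l(1) refl refl])
    \<comment> \<open>At a single site the kernel is evaluated at 0, where it is diagonal, so only
      the expectations of squares of Pauli matrices enter.\<close>
    have "(\<Sum>m\<in>UNIV. \<Sum>m'\<in>UNIV. W m m' (xs l - xs l') * T m l m' l')
      = (\<Sum>m\<in>(UNIV::3 set). \<Sum>m'\<in>UNIV. if m = m' then of_real (A11 \<phi>) else 0)"
      unfolding True[symmetric] by (intro sum.cong refl) (auto simp: W0 T1)
    \<comment> \<open>The trace 3 is split as 1 + 2 so that the 1 can be read as the squared length
      of \<open>S l\<close>, which restores the classical term.\<close>
    also have "\<dots> = of_real (A11 \<phi>) * 1 + 2 * of_real (A11 \<phi>)" by simp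
    also have "of_real (A11 \<phi>) * 1 = of_real (A11 \<phi>) * complex_of_real (\<Sum>m\<in>UNIV. S l $ m * S l $ m)"
      unfolding S_def using norm_spinvec assms(3) l(1) by simp
    also have "\<dots> = (\<Sum>m\<in>(UNIV::3 set). \<Sum>m'\<in>UNIV. if m = m' then of_real (A11 \<phi>) * of_real (S l $ m * S l $ m) else 0)"
      by (simp add: sum_distrib_left)
    also have "\<dots> = (\<Sum>m\<in>UNIV. \<Sum>m'\<in>UNIV. of_real (S l $ m * S l' $ m') * W m m' (xs l - xs l'))"
      unfolding True[symmetric] by (intro sum.cong refl) (auto simp: W0)
    finally show ?thesis using True by simp
  qed
  have "spin_inner P (A_op \<phi> P xs M (tensor P V)) (tensor P V)
    = (\<Sum>s\<in>spin_idx P. \<Sum>l<P. \<Sum>m\<in>UNIV. \<Sum>l'<P. \<Sum>m'\<in>UNIV. - (1/2) * (of_real (M l * M l') * W m m' (xs l - xs l'))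
       * (pauli_at m l (pauli_at m' l' (tensor P V)) s * cnj (tensor P V s)))"
    unfolding spin_inner_def A_op_expand[OF assms(2)] c_def[symmetric] W_def sum_distrib_left sum_distrib_right
    by (simp only: mult_ac)
  also have "\<dots> = (\<Sum>l<P. \<Sum>m\<in>UNIV. \<Sum>l'<P. \<Sum>m'\<in>UNIV. - (1/2) * (of_real (M l * M l') * W m m' (xs l - xs l')) * T m l m' l')"
    unfolding T_def spin_inner_def sum_distrib_left
    by (subst sum.swap, rule sum.cong[OF refl], subst sum.swap, rule sum.cong[OF refl],
        subst sum.swap, rule sum.cong[OF refl], rule sum.swap)
  also have "\<dots> = (\<Sum>l<P. \<Sum>l'<P. \<Sum>m\<in>UNIV. \<Sum>m'\<in>UNIV. - (1/2) * (of_real (M l * M l') * W m m' (xs l - xs l')) * T m l m' l')"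
    by (intro sum.cong refl, rule sum.swap)
  also have "\<dots> = - (1/2) * (\<Sum>l<P. \<Sum>l'<P. of_real (M l * M l') * (\<Sum>m\<in>UNIV. \<Sum>m'\<in>UNIV. W m m' (xs l - xs l') * T m l m' l'))"
    unfolding sum_distrib_left by (simp only: mult_ac)
  \<comment> \<open>The diagonal excess carries a 2, which the prefactor -1/2 reduces to the
    coefficient -1 of \<open>A11 \<phi>\<close>.\<close>
  also have "(\<Sum>l<P. \<Sum>l'<P. of_real (M l * M l') * (\<Sum>m\<in>UNIV. \<Sum>m'\<in>UNIV. W m m' (xs l - xs l') * T m l m' l'))
     = (\<Sum>l<P. \<Sum>l'<P. of_real (M l * M l') * (\<Sum>m\<in>UNIV. \<Sum>m'\<in>UNIV. of_real (S l $ m * S l' $ m') * W m m' (xs l - xs l'))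
         + (if l = l' then 2 * of_real (A11 \<phi> * (M l)\<^sup>2) else 0))"
    by (intro sum.cong refl) (simp add: pair distrib_left power2_eq_square)
  also have "\<dots> = of_real (integral\<^sup>L lborel (\<lambda>x. (norm (Bc x))\<^sup>2)) + 2 * of_real (A11 \<phi> * (\<Sum>l<P. (M l)\<^sup>2))"
    unfolding energy sum.distrib by (simp add: sum_distrib_left)
  finally show ?thesis by (simp add: distrib_left)
qed

end
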